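(* Let $\alpha\in\mathbb C$, let $\tau(\alpha)=-\frac{d^2}{dx^2}+\alpha^2e^{ix}$, $x\in\mathbb R$, and let $H_p(\alpha)$ be the operator in $L^2([0,2\pi];dx)$ given by $(H_p(\alpha)f)(x)=(\tau(\alpha)f)(x)$ for a.e. $x\in[0,2\pi]$, with $$\operatorname{dom}(H_p(\alpha))=\{g\in L^2([0,2\pi];dx)\mid g,g'\in AC([0,2\pi]);\ g(0)=g(2\pi),\ g'(0)=g'(2\pi);\ g''\in L^2([0,2\pi];dx)\}.$$ Write $I$ for the identity operator in $L^2([0,2\pi];dx)$. Then: (1) The spectrum of $H_p(\alpha)$ is purely discrete and $$\sigma(H_p(\alpha))=\{z\in\mathbb C\mid D(z)=1\}=\{m^2\}_{m\in\mathbb N_0},$$ where $D$ is the Floquet discriminant of $\tau(\alpha)$, and in fact $D(z)=\cos(2\pi z^{1/2})$, $z\in\mathbb C$. (2) If $\alpha\neq0$, then for every $m\in\mathbb N_0$ the function $$y(m^2,x)=J_{2m}(2\alpha e^{ix/2}),\quad x\in[0,2\pi],$$ belongs to $\operatorname{dom}(H_p(\alpha))$, is an eigenfunction for the eigenvalue $m^2$, and $\ker(H_p(\alpha)-m^2I)=\{c_m\,y(m^2,\cdot)\mid c_m\in\mathbb C\}$ is one-dimensional. If $\alpha=0$, then for every $m\in\mathbb N_0$, $\ker(H_p(0)-m^2I)=\{x\mapsto c_me^{imx}+d_me^{-imx}\mid c_m,d_m\in\mathbb C\}$, which is two-dimensional, except if $m=0$, when it is one-dimensional. (3) If $\alpha\neq0$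 and $m\in\mathbb N$, put $$\dot y(m^2,x)=(2m-1)!\sum_{k=0}^{2m-1}\frac{1}{(2m-k)\,k!}\big[\alpha e^{ix/2}\big]^{k-2m}J_k(2\alpha e^{ix/2}),\quad x\in[0,2\pi].$$ Then $\dot y(m^2,\cdot)\in\operatorname{dom}\big((H_p(\alpha)-m^2I)^2\big)$ and $$(H_p(\alpha)-m^2I)\,\dot y(m^2,\cdot)=y(m^2,\cdot),\qquad (H_p(\alpha)-m^2I)^2\,\dot y(m^2,\cdot)=0.$$ Moreover, the algebraic eigenspace of $H_p(\alpha)$ corresponding to the eigenvalue $m^2$ is two-dimensional and given by $\{c_m\,y(m^2,\cdot)+d_m\,\dot y(m^2,\cdot)\mid c_m,d_m\in\mathbb C\}$, exhibiting the Jordan chain $\{y(m^2,\cdot),\dot y(m^2,\cdot)\}$ corresponding to the eigenvalue $m^2$. (4) In particular, for all $\alpha\in\mathbb C$: $m_g(0;H_p(\alpha))=1$ and $m_a(0;H_p(\alpha))=1$; and for all $m\in\mathbb N$: $m_g(m^2;H_p(\alpha))=1$ if $\alpha\neq0$, $m_g(m^2;H_p(0))=2$, and $m_a(m^2;H_p(\alpha))=2$ for all $\alpha\in\mathbb C$.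
   Context: $AC([0,2\pi])$ denotes absolutely continuous functions; $J_\nu$ is the (regular) Bessel function of the first kind of order $\nu$; $\mathbb N_0=\mathbb N\cup\{0\}$. Floquet discriminant: let $\theta_0(z,\cdot),\phi_0(z,\cdot)$ be the solutions of $\tau(\alpha)y=zy$ on $\mathbb R$ with $\theta_0(z,0)=1$, $\theta_0'(z,0)=0$, $\phi_0(z,0)=0$, $\phi_0'(z,0)=1$. Then $D(z)=[\theta_0(z,2\pi)+\phi_0'(z,2\pi)]/2$, $z\in\mathbb C$. For a closed operator $A$ and an isolated point $\lambda_0$ of $\sigma(A)$, the Riesz projection is $P(\lambda_0;A)=\frac{-1}{2\pi i}\oint_{|\zeta-\lambda_0|=\varepsilon}(A-\zeta I)^{-1}d\zeta$ (counterclockwise circle, $\varepsilon>0$ small enough to exclude the rest of $\sigma(A)$). The discrete spectrum $\sigma_d(A)$ is the set of eigenvalues that are isolated points of $\sigma(A)$ with finite-rank Riesz projection; "purely discrete" means $\sigma(A)=\sigma_d(A)$. For $\lambda_0\in\sigma_d(A)$, the algebraic eigenspace is $\operatorname{ran}P(\lambda_0;A)$, $m_a(\lambda_0;A)=\dim\operatorname{ran}P(\lambda_0;A)$, and $m_g(\lambda_0;A)=\dim\ker(A-\lambda_0I)$. Vectors $\{\varphi_0,\dots,\varphi_{k-1}\}\subset\operatorname{dom}(A)$ form a Jordan chain of length $k$ for $A$ at $\lambda_0$ if $\varphi_0\neq0$, $(A-\lambda_0I)\varphi_0=0$, and $(A-\lambda_0I)\varphi_j=\varphi_{j-1}$ for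 $1\le j\le k-1$. *)

theory Defs
  imports "HOL-Analysis.Analysis"
begin

section \<open>Complex normed spaces\<close>

class complex_normed_vector = real_normed_vector +
  fixes scaleC :: "complex \<Rightarrow> 'a \<Rightarrow> 'a"  (infixr "*\<^sub>C" 75)
  assumes scaleC_add_right: "a *\<^sub>C (x + y) = a *\<^sub>C x + a *\<^sub>C y"
    and scaleC_add_left: "(a + b) *\<^sub>C x = a *\<^sub>C x + b *\<^sub>C x"
    and scaleC_scaleC: "a *\<^sub>C (b *\<^sub>C x) = (a * b) *\<^sub>C x"
    and scaleR_eq_scaleC: "r *\<^sub>R x = complex_of_real r *\<^sub>C x"
    and norm_scaleC: "norm (a *\<^sub>C x) = cmod a * norm x"

global_interpretation cvec: vector_space "scaleC :: complex \<Rightarrow> 'a::complex_normed_vector \<Rightarrow> 'a"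
proof
  fix x :: "'a::complex_normed_vector"
  show "1 *\<^sub>C x = x"
    using scaleR_eq_scaleC[of 1 x] by simp
qed (simp_all add: scaleC_add_right scaleC_add_left scaleC_scaleC)

lemma bounded_linear_scaleC_right: "bounded_linear (\<lambda>x::'a::complex_normed_vector. c *\<^sub>C x)"
  by (rule bounded_linear_intro[of _ "cmod c"])
     (simp_all add: scaleC_add_right scaleR_eq_scaleC scaleC_scaleC norm_scaleC mult.commute)

text \<open>The type of bounded operators consists of real-linear maps; the complex-linear
  ones form a closed complex subspace of it, with the same norm.\<close>

instantiation blinfun :: (real_normed_vector, complex_normed_vector) complex_normed_vector
begin

lift_definition scaleC_blinfun :: "complex \<Rightarrow> 'a \<Rightarrow>\<^sub>L 'b \<Rightarrow> 'a \<Rightarrow>\<^sub>L 'b"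
  is "\<lambda>c T x. c *\<^sub>C T x"
  by (rule bounded_linear_compose[OF bounded_linear_scaleC_right])

instance
proof
  fix a b :: complex and r :: real and x y :: "'a \<Rightarrow>\<^sub>L 'b"
  show "a *\<^sub>C (x + y) = a *\<^sub>C x + a *\<^sub>C y"
    by transfer (simp add: scaleC_add_right)
  show "(a + b) *\<^sub>C x = a *\<^sub>C x + b *\<^sub>C x"
    by transfer (simp add: scaleC_add_left)
  show scale: "a *\<^sub>C (b *\<^sub>C x) = (a * b) *\<^sub>C x" for a b and x :: "'a \<Rightarrow>\<^sub>L 'b"
    by transfer (simp add: scaleC_scaleC)
  show "r *\<^sub>R x = complex_of_real r *\<^sub>C x"
    by transfer (simp add: scaleR_eq_scaleC)
  have le: "norm (a *\<^sub>C x) \<le> cmod a * norm x" for a and x :: "'a \<Rightarrow>\<^sub>L 'b"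
  proof (rule norm_blinfun_bound)
    fix u
    have "norm (blinfun_apply (a *\<^sub>C x) u) = cmod a * norm (x u)"
      by (simp add: scaleC_blinfun.rep_eq norm_scaleC)
    also have "\<dots> \<le> cmod a * (norm x * norm u)"
      by (intro mult_left_mono norm_blinfun) auto
    finally show "norm (blinfun_apply (a *\<^sub>C x) u) \<le> cmod a * norm x * norm u"
      by (simp add: mult.assoc)
  qed simp
  have one: "1 *\<^sub>C x = x" for x :: "'a \<Rightarrow>\<^sub>L 'b"
    by transfer simp
  show "norm (a *\<^sub>C x) = cmod a * norm x"
  proof (cases "a = 0")
    case True
    then show ?thesis using le[of 0 x] by simp
  next
    case False
    have "norm x = norm (inverse a *\<^sub>C (a *\<^sub>C x))"
      using False by (simp add: scale one)
    also have "\<dots> \<le> cmod (inverse a) * norm (a *\<^sub>C x)"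
      by (rule le)
    finally have "cmod a * norm x \<le> cmod a * (cmod (inverse a) * norm (a *\<^sub>C x))"
      by (intro mult_left_mono) auto
    also have "\<dots> = norm (a *\<^sub>C x)"
      using False by (simp add: norm_inverse)
    finally have "cmod a * norm x \<le> norm (a *\<^sub>C x)" .
    then show ?thesis using le[of a x] by simp
  qed
qed

end


section \<open>Spectral notions for unbounded operators\<close>

text \<open>An (unbounded) operator is represented by its graph, so that its domain is
  \<^term>\<open>Domain A\<close> and the square of \<^term>\<open>A\<close>, with its natural domain, is the relational
  power \<^term>\<open>A ^^ 2\<close>.\<close>

definition op_minus :: "('a \<times> 'a) set \<Rightarrow> complex \<Rightarrow> ('a::complex_normed_vector \<times> 'a) set" where
  "op_minus A l = {(u, v - l *\<^sub>C u) | u v. (u, v) \<in> A}"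

definition op_ker :: "('a \<times> 'a) set \<Rightarrow> 'a::complex_normed_vector set" where
  "op_ker A = {u. (u, 0) \<in> A}"

definition is_resolvent ::
  "('a \<times> 'a) set \<Rightarrow> complex \<Rightarrow> ('a::complex_normed_vector \<Rightarrow>\<^sub>L 'a) \<Rightarrow> bool" where
  "is_resolvent A l R \<longleftrightarrow> (op_minus A l)\<inverse> = {(v, blinfun_apply R v) | v. True}"

definition resolvent ::
  "('a \<times> 'a) set \<Rightarrow> complex \<Rightarrow> ('a::complex_normed_vector \<Rightarrow>\<^sub>L 'a)" where
  "resolvent A l = (THE R. is_resolvent A l R)"

definition spectrum :: "('a::complex_normed_vector \<times> 'a) set \<Rightarrow> complex set" where
  "spectrum A = {l. \<nexists>R. is_resolvent A l R}"

definition eigenvector :: "('a \<times> 'a) set \<Rightarrow> complex \<Rightarrow> 'a::complex_normed_vector \<Rightarrow> bool" where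
  "eigenvector A l u \<longleftrightarrow> u \<noteq> 0 \<and> u \<in> op_ker (op_minus A l)"

text \<open>The contour integral is taken in operator norm, along \<open>t \<mapsto> l + e * cis t\<close>. The
  radius is an arbitrary admissible one; the value does not depend on the choice.\<close>

definition riesz_radius :: "('a::complex_normed_vector \<times> 'a) set \<Rightarrow> complex \<Rightarrow> real" where
  "riesz_radius A l = (SOME e. 0 < e \<and> spectrum A \<inter> cball l e = {l})"

definition riesz_projection ::
  "('a \<times> 'a) set \<Rightarrow> complex \<Rightarrow> ('a::complex_normed_vector \<Rightarrow>\<^sub>L 'a)" where
  "riesz_projection A l =
     (let e = complex_of_real (riesz_radius A l) in
      (- 1 / (2 * complex_of_real pi * \<i>)) *\<^sub>C
        integral {0..2 * pi} (\<lambda>t. (\<i> * e * cis t) *\<^sub>C resolvent A (l + e * cis t)))"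

definition alg_eigenspace :: "('a \<times> 'a) set \<Rightarrow> complex \<Rightarrow> 'a::complex_normed_vector set" where
  "alg_eigenspace A l = range (blinfun_apply (riesz_projection A l))"

definition discrete_spectrum :: "('a::complex_normed_vector \<times> 'a) set \<Rightarrow> complex set" where
  "discrete_spectrum A =
     {l. (\<exists>u. eigenvector A l u) \<and> l isolated_in spectrum A \<and>
         (\<exists>B. finite B \<and> alg_eigenspace A l \<subseteq> cvec.span B)}"

text \<open>\<^term>\<open>cvec.dim\<close> is \<open>0\<close> on infinite-dimensional subspaces, so only positive values of
  the multiplicities determine a finite dimension.\<close>

definition geometric_mult :: "('a::complex_normed_vector \<times> 'a) set \<Rightarrow> complex \<Rightarrow> nat" where
  "geometric_mult A l = cvec.dim (op_ker (op_minus A l))"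

definition algebraic_mult :: "('a::complex_normed_vector \<times> 'a) set \<Rightarrow> complex \<Rightarrow> nat" where
  "algebraic_mult A l = cvec.dim (alg_eigenspace A l)"

definition jordan_chain ::
  "('a \<times> 'a) set \<Rightarrow> complex \<Rightarrow> 'a::complex_normed_vector list \<Rightarrow> bool" where
  "jordan_chain A l us \<longleftrightarrow>
     us \<noteq> [] \<and> us ! 0 \<noteq> 0 \<and> (us ! 0, 0) \<in> op_minus A l \<and>
     (\<forall>j. 1 \<le> j \<and> j < length us \<longrightarrow> (us ! j, us ! (j - 1)) \<in> op_minus A l)"


section \<open>The Hilbert space of square-integrable functions on the period interval\<close>

abbreviation period :: "real set" where
  "period \<equiv> {0..2 * pi}"

abbreviation leb_period :: "real measure" where
  "leb_period \<equiv> lebesgue_on period"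

definition square_integrable :: "(real \<Rightarrow> complex) \<Rightarrow> bool" where
  "square_integrable f \<longleftrightarrow>
     f \<in> borel_measurable leb_period \<and> integrable leb_period (\<lambda>x. (cmod (f x))\<^sup>2)"

lemma square_integrable_measurable:
  "square_integrable f \<Longrightarrow> f \<in> borel_measurable leb_period"
  by (simp add: square_integrable_def)

lemma square_integrable_zero: "square_integrable (\<lambda>_. 0)"
  by (simp add: square_integrable_def)

lemma square_integrable_scale:
  assumes "square_integrable f"
  shows "square_integrable (\<lambda>x. c * f x)"
  using assms by (auto simp: square_integrable_def norm_mult power_mult_distrib)

lemma square_integrable_add:
  assumes f: "square_integrable f" and g: "square_integrable g"
  shows "square_integrable (\<lambda>x. f x + g x)"
proof -
  have [measurable]: "f \<in> borel_measurable leb_period" "g \<in> borel_measurable leb_period"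
    using f g by (simp_all add: square_integrable_def)
  have int: "integrable leb_period (\<lambda>x. 2 * ((cmod (f x))\<^sup>2 + (cmod (g x))\<^sup>2))"
    using f g by (simp add: square_integrable_def)
  have le: "(cmod (f x + g x))\<^sup>2 \<le> 2 * ((cmod (f x))\<^sup>2 + (cmod (g x))\<^sup>2)" for x
  proof -
    have "(cmod (f x + g x))\<^sup>2 \<le> (cmod (f x) + cmod (g x))\<^sup>2"
      by (intro power_mono norm_triangle_ineq) auto
    also have "\<dots> \<le> 2 * ((cmod (f x))\<^sup>2 + (cmod (g x))\<^sup>2)"
      using sum_squares_bound[of "cmod (f x)" "cmod (g x)"] by (simp add: power2_sum)
    finally show ?thesis .
  qed
  have "integrable leb_period (\<lambda>x. (cmod (f x + g x))\<^sup>2)"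
    by (rule Bochner_Integration.integrable_bound[OF int]) (simp, rule AE_I2, use le in simp)
  then show ?thesis by (simp add: square_integrable_def)
qed

lemma square_integrable_inner:
  assumes f: "square_integrable f" and g: "square_integrable g"
  shows "integrable leb_period (\<lambda>x. f x \<bullet> g x)"
proof -
  have [measurable]: "f \<in> borel_measurable leb_period" "g \<in> borel_measurable leb_period"
    using f g by (simp_all add: square_integrable_def)
  have int: "integrable leb_period (\<lambda>x. (cmod (f x))\<^sup>2 + (cmod (g x))\<^sup>2)"
    using f g by (simp add: square_integrable_def)
  have le: "\<bar>f x \<bullet> g x\<bar> \<le> (cmod (f x))\<^sup>2 + (cmod (g x))\<^sup>2" for x
  proof -
    have "\<bar>f x \<bullet> g x\<bar> \<le> cmod (f x) * cmod (g x)"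
      by (rule Cauchy_Schwarz_ineq2)
    also have "\<dots> \<le> (cmod (f x))\<^sup>2 + (cmod (g x))\<^sup>2"
      using sum_squares_bound[of "cmod (f x)" "cmod (g x)"]
        mult_nonneg_nonneg[of "cmod (f x)" "cmod (g x)"] by (simp del: mult_nonneg_nonneg)
    finally show ?thesis .
  qed
  show ?thesis
    by (rule Bochner_Integration.integrable_bound[OF int]) (simp, simp add: le)
qed

definition L2_rel :: "(real \<Rightarrow> complex) \<Rightarrow> (real \<Rightarrow> complex) \<Rightarrow> bool" where
  "L2_rel f g \<longleftrightarrow> square_integrable f \<and> square_integrable g \<and> (AE x in leb_period. f x = g x)"

lemma part_equivp_L2_rel: "part_equivp L2_rel"
proof (rule part_equivpI)
  show "\<exists>f. L2_rel f f"
    by (rule exI[of _ "\<lambda>_. 0"]) (simp add: L2_rel_def square_integrable_zero)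
  show "symp L2_rel"
    by (rule sympI) (auto simp: L2_rel_def elim!: eventually_mono)
  show "transp L2_rel"
  proof (rule transpI)
    fix f g h assume "L2_rel f g" "L2_rel g h"
    then show "L2_rel f h"
      by (auto simp: L2_rel_def elim: eventually_elim2)
  qed
qed

text \<open>\<open>L2_class f\<close> is the almost-everywhere class of \<open>f\<close>; it is meaningful only for
  square-integrable \<open>f\<close>.\<close>

quotient_type L2 = "real \<Rightarrow> complex" / partial: L2_rel
  morphisms L2_rep L2_class
  by (rule part_equivp_L2_rel)

text \<open>The real inner product below is the real part of the usual complex one and induces
  the usual norm.\<close>

instantiation L2 :: real_inner
begin

lift_definition zero_L2 :: L2 is "\<lambda>_. 0"
  by (simp add: L2_rel_def square_integrable_zero)

lift_definition plus_L2 :: "L2 \<Rightarrow> L2 \<Rightarrow> L2" is "\<lambda>f g x. f x + g x"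
  by (auto simp: L2_rel_def square_integrable_add elim: eventually_elim2)

lift_definition scaleR_L2 :: "real \<Rightarrow> L2 \<Rightarrow> L2" is "\<lambda>r f x. complex_of_real r * f x"
  by (auto simp: L2_rel_def square_integrable_scale elim!: eventually_mono)

lift_definition uminus_L2 :: "L2 \<Rightarrow> L2" is "\<lambda>f x. (- 1) * f x"
  by (intro L2_rel_def[THEN iffD2] conjI)
     (auto simp only: L2_rel_def square_integrable_scale elim!: eventually_mono)

definition minus_L2 :: "L2 \<Rightarrow> L2 \<Rightarrow> L2" where
  "minus_L2 u v = u + (- v)"

lift_definition inner_L2 :: "L2 \<Rightarrow> L2 \<Rightarrow> real" is "\<lambda>f g. LINT x|leb_period. f x \<bullet> g x"
proof -
  fix f f' g g' :: "real \<Rightarrow> complex"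
  assume f: "L2_rel f f'" and g: "L2_rel g g'"
  have "AE x in leb_period. f x \<bullet> g x = f' x \<bullet> g' x"
    using f g by (auto simp: L2_rel_def elim: eventually_elim2)
  moreover have "integrable leb_period (\<lambda>x. f x \<bullet> g x)" "integrable leb_period (\<lambda>x. f' x \<bullet> g' x)"
    using f g by (auto simp: L2_rel_def square_integrable_inner)
  ultimately show "(LINT x|leb_period. f x \<bullet> g x) = (LINT x|leb_period. f' x \<bullet> g' x)"
    by (intro integral_cong_AE) auto
qed

definition norm_L2 :: "L2 \<Rightarrow> real" where
  "norm_L2 u = sqrt (u \<bullet> u)"

definition dist_L2 :: "L2 \<Rightarrow> L2 \<Rightarrow> real" where
  "dist_L2 u v = norm (u - v)"

definition sgn_L2 :: "L2 \<Rightarrow> L2" where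
  "sgn_L2 u = inverse (norm u) *\<^sub>R u"

definition uniformity_L2 :: "(L2 \<times> L2) filter" where
  "uniformity_L2 = (INF e\<in>{0<..}. principal {(u, v). dist u v < e})"

definition open_L2 :: "L2 set \<Rightarrow> bool" where
  "open_L2 U = (\<forall>u\<in>U. \<forall>\<^sub>F (u', v) in uniformity. u' = u \<longrightarrow> v \<in> U)"

instance
proof
  fix u v w :: L2 and a b :: real
  show "u + v + w = u + (v + w)"
    by transfer (auto simp: L2_rel_def square_integrable_add add.assoc)
  show "u + v = v + u"
    by transfer (auto simp: L2_rel_def square_integrable_add add.commute)
  show "0 + u = u"
    by transfer (auto simp: L2_rel_def)
  show "- u + u = 0"
    by transfer (auto simp: L2_rel_def square_integrable_zero)
  show "u - v = u + - v"
    by (rule minus_L2_def)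
  show "a *\<^sub>R (u + v) = a *\<^sub>R u + a *\<^sub>R v"
    by transfer (auto simp: L2_rel_def distrib_left intro!: square_integrable_add square_integrable_scale)
  show "(a + b) *\<^sub>R u = a *\<^sub>R u + b *\<^sub>R u"
    by transfer (auto simp: L2_rel_def distrib_right intro!: square_integrable_add square_integrable_scale)
  show "a *\<^sub>R b *\<^sub>R u = (a * b) *\<^sub>R u"
    by transfer
       (use square_integrable_scale in \<open>auto simp: L2_rel_def mult.assoc\<close>)
  show "1 *\<^sub>R u = u"
    by transfer (auto simp: L2_rel_def)
  show "dist u v = norm (u - v)"
    by (rule dist_L2_def)
  show "sgn u = inverse (norm u) *\<^sub>R u"
    by (rule sgn_L2_def)
  show "uniformity = (INF e\<in>{0<..}. principal {(u, v::L2). dist u v < e})"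
    by (rule uniformity_L2_def)
  show "open U = (\<forall>u\<in>U. \<forall>\<^sub>F (u', v) in uniformity. u' = u \<longrightarrow> v \<in> U)" for U :: "L2 set"
    by (rule open_L2_def)
  show "u \<bullet> v = v \<bullet> u"
    by transfer (simp add: inner_commute)
  show "(u + v) \<bullet> w = u \<bullet> w + v \<bullet> w"
    by transfer (simp add: L2_rel_def inner_add_left square_integrable_inner)
  show "(a *\<^sub>R u) \<bullet> v = a * (u \<bullet> v)"
    by transfer (simp add: scaleR_conv_of_real[symmetric])
  show "0 \<le> u \<bullet> u"
    by transfer simp
  show "u \<bullet> u = 0 \<longleftrightarrow> u = 0"
  proof transfer
    fix f assume "L2_rel f f"
    then have f: "square_integrable f" by (simp add: L2_rel_def)
    have "(LINT x|leb_period. f x \<bullet> f x) = 0 \<longleftrightarrow> (AE x in leb_period. f x \<bullet> f x = 0)"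
      by (rule integral_nonneg_eq_0_iff_AE) (auto simp: square_integrable_inner f)
    then show "(LINT x|leb_period. f x \<bullet> f x) = 0 \<longleftrightarrow> L2_rel f (\<lambda>_. 0)"
      by (simp add: L2_rel_def f square_integrable_zero)
  qed
  show "norm u = sqrt (u \<bullet> u)"
    by (rule norm_L2_def)
qed

end

instantiation L2 :: complex_normed_vector
begin

lift_definition scaleC_L2 :: "complex \<Rightarrow> L2 \<Rightarrow> L2" is "\<lambda>c f x. c * f x"
  by (auto simp: L2_rel_def square_integrable_scale elim!: eventually_mono)

instance
proof
  fix u v :: L2 and a b :: complex and r :: real
  show "a *\<^sub>C (u + v) = a *\<^sub>C u + a *\<^sub>C v"
    by transfer (auto simp: L2_rel_def distrib_left intro!: square_integrable_add square_integrable_scale)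
  show "(a + b) *\<^sub>C u = a *\<^sub>C u + b *\<^sub>C u"
    by transfer (auto simp: L2_rel_def distrib_right intro!: square_integrable_add square_integrable_scale)
  show "a *\<^sub>C b *\<^sub>C u = (a * b) *\<^sub>C u"
    by transfer
       (use square_integrable_scale in \<open>auto simp: L2_rel_def mult.assoc\<close>)
  show "r *\<^sub>R u = complex_of_real r *\<^sub>C u"
    by transfer (auto simp: L2_rel_def square_integrable_scale)
  have "(a *\<^sub>C u) \<bullet> (a *\<^sub>C u) = (cmod a)\<^sup>2 * (u \<bullet> u)"
    by transfer (simp add: dot_square_norm norm_mult power_mult_distrib)
  then show "norm (a *\<^sub>C u) = cmod a * norm u"
    by (simp add: norm_eq_sqrt_inner real_sqrt_mult)
qed

end


section \<open>The periodic Schroedinger operator\<close>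

definition ac_on :: "real \<Rightarrow> real \<Rightarrow> (real \<Rightarrow> complex) \<Rightarrow> bool" where
  "ac_on a b f \<longleftrightarrow>
     (\<forall>e>0. \<exists>d>0. \<forall>K. K division_of \<Union>K \<and> \<Union>K \<subseteq> {a..b} \<and> (\<Sum>k\<in>K. Sup k - Inf k) < d \<longrightarrow>
        (\<Sum>k\<in>K. cmod (f (Sup k) - f (Inf k))) < e)"

text \<open>One-sided derivatives at the end points of an interval \<open>S\<close>.\<close>

abbreviation derivative_on :: "real set \<Rightarrow> (real \<Rightarrow> complex) \<Rightarrow> real \<Rightarrow> complex" where
  "derivative_on S f x \<equiv> vector_derivative f (at x within S)"

definition tau :: "complex \<Rightarrow> real set \<Rightarrow> (real \<Rightarrow> complex) \<Rightarrow> real \<Rightarrow> complex" where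
  "tau \<alpha> S f x =
     - derivative_on S (derivative_on S f) x + \<alpha>\<^sup>2 * exp (\<i> * complex_of_real x) * f x"

text \<open>Almost-everywhere differentiability of \<open>g'\<close> is a consequence of its absolute
  continuity; it is listed because \<^const>\<open>vector_derivative\<close> is unspecified elsewhere.\<close>

definition periodic_fun_dom :: "(real \<Rightarrow> complex) set" where
  "periodic_fun_dom =
     {g. square_integrable g \<and>
         (\<forall>x\<in>period. g differentiable (at x within period)) \<and>
         ac_on 0 (2 * pi) g \<and> ac_on 0 (2 * pi) (derivative_on period g) \<and>
         g 0 = g (2 * pi) \<and> derivative_on period g 0 = derivative_on period g (2 * pi) \<and>
         (AE x in leb_period. derivative_on period g differentiable (at x within period)) \<and>
         square_integrable (derivative_on period (derivative_on period g))}"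

definition Hp :: "complex \<Rightarrow> (L2 \<times> L2) set" where
  "Hp \<alpha> = {(L2_class g, L2_class (tau \<alpha> period g)) | g. g \<in> periodic_fun_dom}"


section \<open>Floquet discriminant\<close>

definition tau_solution :: "complex \<Rightarrow> complex \<Rightarrow> (real \<Rightarrow> complex) \<Rightarrow> bool" where
  "tau_solution \<alpha> z y \<longleftrightarrow>
     (\<forall>x. y differentiable (at x)) \<and> (\<forall>x. derivative_on UNIV y differentiable (at x)) \<and>
     (\<forall>x. tau \<alpha> UNIV y x = z * y x)"

definition theta0 :: "complex \<Rightarrow> complex \<Rightarrow> real \<Rightarrow> complex" where
  "theta0 \<alpha> z = (THE y. tau_solution \<alpha> z y \<and> y 0 = 1 \<and> derivative_on UNIV y 0 = 0)"

definition phi0 :: "complex \<Rightarrow> complex \<Rightarrow> real \<Rightarrow> complex" where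
  "phi0 \<alpha> z = (THE y. tau_solution \<alpha> z y \<and> y 0 = 0 \<and> derivative_on UNIV y 0 = 1)"

definition floquet_discriminant :: "complex \<Rightarrow> complex \<Rightarrow> complex" where
  "floquet_discriminant \<alpha> z =
     (theta0 \<alpha> z (2 * pi) + derivative_on UNIV (phi0 \<alpha> z) (2 * pi)) / 2"


section \<open>Bessel functions and generalized eigenfunctions\<close>

text \<open>Nonnegative integer order only, where the Bessel function is entire.\<close>

definition bessel_J :: "nat \<Rightarrow> complex \<Rightarrow> complex" where
  "bessel_J n z = (\<Sum>k. (- 1) ^ k / (fact k * fact (n + k)) * (z / 2) ^ (2 * k + n))"

definition y_fun :: "complex \<Rightarrow> nat \<Rightarrow> real \<Rightarrow> complex" where
  "y_fun \<alpha> m x = bessel_J (2 * m) (2 * \<alpha> * exp (\<i> * complex_of_real x / 2))"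

definition ydot_fun :: "complex \<Rightarrow> nat \<Rightarrow> real \<Rightarrow> complex" where
  "ydot_fun \<alpha> m x =
     fact (2 * m - 1) *
     (\<Sum>k = 0..2 * m - 1.
        1 / (of_nat (2 * m - k) * fact k) *
        (\<alpha> * exp (\<i> * complex_of_real x / 2)) powi (int k - int (2 * m)) *
        bessel_J k (2 * \<alpha> * exp (\<i> * complex_of_real x / 2)))"


section \<open>The relation defining the periodic operator is a function\<close>

lemma ac_on_continuous:
  assumes "ac_on a b f"
  shows "continuous_on {a..b} f"
proof (unfold continuous_on_iff, intro ballI allI impI)
  fix x and e :: real assume x: "x \<in> {a..b}" and "e > 0"
  then obtain d where d: "d > 0" and *: "\<And>K. K division_of \<Union>K \<Longrightarrow> \<Union>K \<subseteq> {a..b} \<Longrightarrow>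
      (\<Sum>k\<in>K. Sup k - Inf k) < d \<Longrightarrow> (\<Sum>k\<in>K. cmod (f (Sup k) - f (Inf k))) < e"
    using assms unfolding ac_on_def by (elim allE[of _ e]) auto
  have le: "cmod (f v - f u) < e" if "u \<le> v" "a \<le> u" "v \<le> b" "v - u < d" for u v
  proof -
    have "{{u..v}} division_of \<Union>{{u..v}}"
      using that division_of_self[of u v] by (simp add: cbox_interval)
    from *[OF this] that show ?thesis by simp
  qed
  show "\<exists>d>0. \<forall>x'\<in>{a..b}. dist x' x < d \<longrightarrow> dist (f x') (f x) < e"
  proof (intro exI[of _ d] conjI ballI impI d)
    fix x' assume "x' \<in> {a..b}" "dist x' x < d"
    then show "dist (f x') (f x) < e"
      using le[of x x'] le[of x' x] x
      by (cases "x \<le> x'") (auto simp: dist_norm norm_minus_commute)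
  qed
qed

lemma AE_eq_continuous_imp_eq:
  fixes f g :: "real \<Rightarrow> complex"
  assumes f: "continuous_on period f" and g: "continuous_on period g"
    and ae: "AE x in leb_period. f x = g x" and x: "x \<in> period"
  shows "f x = g x"
proof (rule ccontr)
  assume ne: "f x \<noteq> g x"
  have "continuous_on period (\<lambda>t. f t - g t)"
    by (intro continuous_intros f g)
  then obtain d where d: "d > 0"
    and *: "\<And>t. t \<in> period \<Longrightarrow> dist t x < d \<Longrightarrow> dist (f t - g t) (f x - g x) < cmod (f x - g x)"
    using x ne unfolding continuous_on_iff
    by (elim ballE[of _ _ x] allE[of _ "cmod (f x - g x)"]) auto
  define a where "a = max 0 (x - d / 2)"
  define b where "b = min (2 * pi) (x + d / 2)"
  have ab: "a < b" "{a..b} \<subseteq> period"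
    using x d pi_gt_zero unfolding a_def b_def by auto
  have neq: "f t \<noteq> g t" if "t \<in> {a..b}" for t
  proof -
    have "dist t x < d" using that d by (auto simp: a_def b_def dist_real_def abs_less_iff)
    moreover have "t \<in> period" using that ab by blast
    ultimately show ?thesis using *[of t] by (auto simp: dist_norm norm_minus_commute)
  qed
  have "AE t in lebesgue. t \<in> period \<longrightarrow> f t = g t"
    using ae by (simp add: AE_restrict_space_iff)
  then have "AE t in lebesgue. t \<notin> {a..b}"
    by (rule eventually_mono) (use neq ab in blast)
  then have "negligible {a..b}"
    by (simp add: negligible_iff_null_sets AE_iff_null_sets)
  then show False
    using ab negligible_interval(1)[of a b] by (simp add: box_real)
qed

lemma square_integrable_tau:
  assumes "g \<in> periodic_fun_dom"
  shows "square_integrable (tau \<alpha> period g)"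
proof -
  let ?e = "\<lambda>x. \<alpha>\<^sup>2 * exp (\<i> * complex_of_real x)"
  have g: "square_integrable g" "square_integrable (derivative_on period (derivative_on period g))"
    using assms by (auto simp: periodic_fun_dom_def)
  have [measurable]: "?e \<in> borel_measurable leb_period"
    by (intro continuous_imp_measurable_on_sets_lebesgue continuous_intros) auto
  have [measurable]: "g \<in> borel_measurable leb_period"
    using g by (simp add: square_integrable_def)
  have "square_integrable (\<lambda>x. ?e x * g x)"
    using g by (simp add: square_integrable_def norm_mult power_mult_distrib)
  moreover have
    "square_integrable (\<lambda>x. (- 1) * derivative_on period (derivative_on period g) x)"
    by (intro square_integrable_scale g)
  ultimately have "square_integrable (\<lambda>x. (- 1) * derivative_on period (derivative_on period g) x + ?e x * g x)"
    by (intro square_integrable_add)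
  then show ?thesis
    by (simp add: tau_def[abs_def])
qed

lemma single_valued_Hp: "single_valued (Hp \<alpha>)"
proof (rule single_valuedI)
  fix u v w assume "(u, v) \<in> Hp \<alpha>" "(u, w) \<in> Hp \<alpha>"
  then obtain g h where g: "g \<in> periodic_fun_dom" and h: "h \<in> periodic_fun_dom"
    and u: "u = L2_class g" "u = L2_class h"
    and v: "v = L2_class (tau \<alpha> period g)" and w: "w = L2_class (tau \<alpha> period h)"
    unfolding Hp_def by auto
  have sq: "square_integrable g" "square_integrable h"
    using g h by (auto simp: periodic_fun_dom_def)
  then have "L2_rel g h"
    using u Quotient_rel[OF Quotient_L2, of g h] by (simp add: L2_rel_def)
  then have "AE x in leb_period. g x = h x"
    by (simp add: L2_rel_def)
  moreover have "continuous_on period g" "continuous_on period h"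
    using g h by (auto simp: periodic_fun_dom_def intro: ac_on_continuous)
  ultimately have eq: "g x = h x" if "x \<in> period" for x
    using AE_eq_continuous_imp_eq that by blast
  have vd: "derivative_on period p x = derivative_on period q x"
    if "\<And>t. t \<in> period \<Longrightarrow> p t = q t" "x \<in> period" for p q x
    unfolding vector_derivative_def
    by (intro arg_cong[where f = Eps] ext has_vector_derivative_cong_ev)
       (use that in auto)
  have "tau \<alpha> period g x = tau \<alpha> period h x" if "x \<in> period" for x
    unfolding tau_def using that eq vd[of "derivative_on period g" "derivative_on period h" x]
      vd[of g h] by simp
  moreover have "square_integrable (tau \<alpha> period p)" if "p \<in> periodic_fun_dom" for p
    using that by (simp add: square_integrable_tau)
  ultimately have "L2_rel (tau \<alpha> period g) (tau \<alpha> period h)"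
    using g h by (auto simp: L2_rel_def intro!: AE_I2)
  then show "v = w"
    unfolding v w by (rule Quotient_rel_abs[OF Quotient_L2])
qed

end

theory Submission
  imports Defs "HOL-Complex_Analysis.Complex_Analysis"
begin

text \<open>
  Fourier series turn the statement into algebra. Let \<open>u p\<close> be the coefficients of \<open>u\<close> with respect to the
  functions \<open>exp(ipx)\<close>. Multiplication by \<open>exp(ix)\<close> shifts the index, so \<open>(u, v)\<close> is in the graph of
  \<open>Hp \<alpha>\<close> exactly if \<open>v p = p\<^sup>2 u p + \<alpha>\<^sup>2 u (p - 1)\<close> for all integers \<open>p\<close> (\<open>Hp_iff_fourier\<close>). The
  operator is a lower triangular matrix with diagonal entries \<open>p\<^sup>2\<close>, whatever \<open>\<alpha>\<close> is. The analytic
  content of the equivalence is the fundamental theorem of calculus for absolutely continuous functions in one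
  direction; in the other it is Lebesgue's differentiation theorem, which provides periodic functions with a
  prescribed second derivative, and the completeness of the trigonometric system.

  If \<open>z\<close> is not the square of an integer, the triangular system with diagonal \<open>p\<^sup>2 - z\<close> is solved
  recursively, column by column. The columns are so small that they add up to a bounded operator, and this
  operator is the resolvent because a nonzero solution of the homogeneous system would grow factorially towards
  minus infinity (\<open>resolvent_exists\<close>).

  For \<open>l = m\<^sup>2\<close> consider the moments \<open>- 1 / (2\<pi>i) \<integral> (\<zeta> - l)\<^sup>j R(\<zeta>) d\<zeta>\<close> of the resolvent over a small
  circle. The operator \<open>Hp \<alpha> - l\<close> maps each one to the next. An entry of the resolvent matrix is a constant times a
  product of factors \<open>1 / (q\<^sup>2 - \<zeta>)\<close> with distinct \<open>q\<close>, of which only \<open>q = m\<close> and \<open>q = -m\<close> are singular at \<open>l\<close>, so the pole has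
  order at most two and the moment of order two vanishes. Therefore the range of the Riesz projection is the kernel
  of \<open>(Hp \<alpha> - l)\<^sup>2\<close> (\<open>alg_eigenspace_eq_ker2\<close>).

  The kernels are found from the recursion. If \<open>\<alpha> \<noteq> 0\<close>, an element of the kernel of \<open>Hp \<alpha> - m\<^sup>2\<close> is determined by
  its coefficient at \<open>m\<close>, and the power series of the Bessel function in \<open>\<alpha>\<^sup>2 exp(ix)\<close> is a solution. That \<open>ydot_fun\<close>
  is mapped to \<open>y_fun\<close> amounts to the evaluation of a partial alternating sum of binomial coefficients
  (\<open>ydot_weight_rec\<close>).

  The Floquet discriminant is half the trace of the monodromy matrix. Its determinant is a Wronskian, hence \<open>1\<close>, and
  the Frobenius solution \<open>exp(i\<nu>x) (\<Sum>k. c k exp(ikx))\<close> with \<open>\<nu> = csqrt z\<close>, which exists for every \<open>z\<close>, exhibits the eigenvalue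
  \<open>exp(2\<pi>i\<nu>)\<close>; so the trace is \<open>2 cos(2\<pi>\<nu>)\<close>.
\<close>

section \<open>Differentiation and absolute continuity\<close>

text \<open>The points at which the difference quotients of the indefinite integral miss \<open>f x\<close> by at
  least \<open>e\<close> are covered, in the sense of Vitali, by arbitrarily short intervals witnessing this.
  On a disjoint subfamily Henstock's lemma makes the sum of the errors small, and each error is
  at least \<open>e\<close> times the length of its interval.\<close>

lemma bad_difference_quotient_negligible:
  fixes f :: "real \<Rightarrow> 'b::euclidean_space"
  assumes f: "f integrable_on {a..b}" and e: "e > 0"
  defines "F \<equiv> (\<lambda>t. integral {a..t} f)"
  defines "S \<equiv> {x\<in>{a..b}. \<forall>d>0. \<exists>y\<in>{a..b}. y \<noteq> x \<and> \<bar>y - x\<bar> < d \<and>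
              norm (F y - F x - (y - x) *\<^sub>R f x) \<ge> e * \<bar>y - x\<bar>}"
  shows "negligible S"
  unfolding negligible_outer_le
proof (intro allI impI)
  fix r :: real assume r: "r > 0"
  obtain \<gamma> where \<gamma>: "gauge \<gamma>" and hen:
    "\<And>p. \<lbrakk>p tagged_partial_division_of (cbox a b); \<gamma> fine p\<rbrakk> \<Longrightarrow>
             (\<Sum>(x,k)\<in>p. norm(measure lborel k *\<^sub>R f x - integral k f)) < r * e"
    using Henstock_lemma[of f a b "r * e"] f r e by auto
  define lo hi :: "real \<times> real \<Rightarrow> real" where "lo = (\<lambda>(x,y). min x y)" and "hi = (\<lambda>(x,y). max x y)"
  define K where "K = {(x,y). x \<in> S \<and> y \<in> {a..b} \<and> y \<noteq> x \<and> {lo (x,y)..hi (x,y)} \<subseteq> \<gamma> x \<and>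
      norm (F y - F x - (y - x) *\<^sub>R f x) \<ge> e * \<bar>y - x\<bar>}"
  define c rad where "c = (\<lambda>i. (lo i + hi i) / 2)" and "rad = (\<lambda>i. (hi i - lo i) / 2)"
  have cb: "cball (c i) (rad i) = {lo i..hi i}" for i
    by (auto simp: c_def rad_def dist_real_def abs_le_iff field_simps split: abs_split)
  have radpos: "rad i > 0" if "i \<in> K" for i
    using that by (auto simp: K_def rad_def lo_def hi_def)
  have cover: "\<exists>i. i \<in> K \<and> x \<in> cball (c i) (rad i) \<and> rad i < d" if x: "x \<in> S" and d: "0 < d" for x d
  proof -
    obtain d' where d': "d' > 0" "ball x d' \<subseteq> \<gamma> x"
      using \<gamma> open_contains_ball[of "\<gamma> x"] unfolding gauge_def by blast
    obtain y where y: "y\<in>{a..b}" "y \<noteq> x" "\<bar>y - x\<bar> < min d d'"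
        "norm (F y - F x - (y - x) *\<^sub>R f x) \<ge> e * \<bar>y - x\<bar>"
      using x d d'(1) unfolding S_def by (auto dest!: spec[of _ "min d d'"])
    have "{lo (x,y)..hi (x,y)} \<subseteq> ball x d'"
      using y(3) by (auto simp: lo_def hi_def dist_real_def)
    then have "(x,y) \<in> K" using y x d'(2) by (auto simp: K_def)
    moreover have "x \<in> cball (c (x,y)) (rad (x,y))" unfolding cb by (auto simp: lo_def hi_def)
    moreover have "rad (x,y) < d" using y(3) d by (auto simp: rad_def lo_def hi_def)
    ultimately show ?thesis by blast
  qed
  obtain C where C: "countable C" "C \<subseteq> K"
     "pairwise (\<lambda>i j. disjnt (cball (c i) (rad i)) (cball (c j) (rad j))) C"
     and neg: "negligible(S - (\<Union>i \<in> C. cball (c i) (rad i)))"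
    by (rule Vitali_covering_theorem_cballs[of K rad S c, OF radpos cover]) auto
  have fin: "measure lebesgue (\<Union>i\<in>D. cball (c i) (rad i)) \<le> r" if D: "D \<subseteq> C" "finite D" for D
  proof -
    define p where "p = (\<lambda>i. (fst i, {lo i..hi i})) ` D"
    have DK: "D \<subseteq> K" using D C by auto
    have inj: "inj_on (\<lambda>i. (fst i, {lo i..hi i})) D"
    proof (rule inj_onI, rule ccontr)
      fix i j assume ij: "i \<in> D" "j \<in> D" "(fst i, {lo i..hi i}) = (fst j, {lo j..hi j})" "i \<noteq> j"
      then have "disjnt {lo i..hi i} {lo j..hi j}"
        using C(3) D unfolding pairwise_def cb by blast
      moreover have "lo i \<le> hi i" using radpos[of i] ij(1) DK unfolding rad_def by auto
      ultimately show False using ij(3) by (auto simp: disjnt_def)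
    qed
    have ptag: "p tagged_partial_division_of (cbox a b)"
      unfolding tagged_partial_division_of_def
    proof (intro conjI allI impI)
      show "finite p" using D by (simp add: p_def)
      fix x L assume xL: "(x, L) \<in> p"
      then obtain i where i: "i \<in> D" "x = fst i" "L = {lo i..hi i}" by (auto simp: p_def)
      obtain u v where uv: "i = (u,v)" by (cases i)
      have "i \<in> K" using i DK by auto
      then show "x \<in> L" "L \<subseteq> cbox a b"
        using i uv by (auto simp: K_def lo_def hi_def S_def)
      show "\<exists>a b. L = cbox a b" using i by auto
    next
      fix x1 L1 x2 L2 assume *: "(x1, L1) \<in> p \<and> (x2, L2) \<in> p \<and> (x1, L1) \<noteq> (x2, L2)"
      then obtain i j where ij: "i \<in> D" "j \<in> D" "L1 = {lo i..hi i}" "L2 = {lo j..hi j}" "i \<noteq> j"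
        by (auto simp: p_def)
      then have "disjnt L1 L2"
        using C(3) D unfolding pairwise_def cb by blast
      then show "interior L1 \<inter> interior L2 = {}"
        unfolding disjnt_def by (meson disjoint_iff interior_subset subsetD)
    qed
    have pfine: "\<gamma> fine p"
      using DK unfolding p_def fine_def K_def by fastforce
    have "measure lebesgue (\<Union>i\<in>D. cball (c i) (rad i)) \<le> (\<Sum>i\<in>D. measure lebesgue (cball (c i) (rad i)))"
      by (intro measure_UNION_le) (use D in auto)
    also have "\<dots> = (\<Sum>i\<in>D. hi i - lo i)"
    proof (intro sum.cong refl)
      fix i assume "i \<in> D"
      then have "rad i > 0" using radpos DK by blast
      then show "measure lebesgue (cball (c i) (rad i)) = hi i - lo i" unfolding cb by (simp add: rad_def)
    qed
    also have "e * \<dots> \<le> (\<Sum>i\<in>D. norm (measure lborel {lo i..hi i} *\<^sub>R f (fst i) - integral {lo i..hi i} f))"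
      unfolding sum_distrib_left
    proof (rule sum_mono)
      fix i assume "i \<in> D"
      then have iK: "i \<in> K" using DK by auto
      obtain x y where xy: "i = (x,y)" by (cases i)
      have x: "x \<in> {a..b}" "y \<in> {a..b}" "x \<noteq> y" using iK xy by (auto simp: K_def S_def)
      have ge: "norm (F y - F x - (y - x) *\<^sub>R f x) \<ge> e * \<bar>y - x\<bar>" using iK xy by (auto simp: K_def)
      have comb: "F v - F u = integral {u..v} f" if "a \<le> u" "u \<le> v" "v \<le> b" for u v
      proof -
        have "f integrable_on {a..v}" using f that by (meson integrable_on_subinterval atLeastatMost_subset_iff order_refl)
        then show ?thesis unfolding F_def
          using Henstock_Kurzweil_Integration.integral_combine[of a u v f] that by (auto simp: algebra_simps)
      qed
      show "e * (hi i - lo i) \<le> norm (measure lborel {lo i..hi i} *\<^sub>R f (fst i) - integral {lo i..hi i} f)"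
      proof (cases "x \<le> y")
        case True
        then show ?thesis using comb[of x y] x ge xy
          by (auto simp: lo_def hi_def norm_minus_commute)
      next
        case False
        have "F y - F x - (y - x) *\<^sub>R f x = (x - y) *\<^sub>R f x - integral {y..x} f"
          using comb[of y x] x False by (auto simp: algebra_simps)
        then show ?thesis using x ge xy False
          by (auto simp: lo_def hi_def)
      qed
    qed
    also have "\<dots> = (\<Sum>(x,k)\<in>p. norm(measure lborel k *\<^sub>R f x - integral k f))"
      unfolding p_def by (subst sum.reindex[OF inj]) (auto simp: o_def)
    also have "\<dots> \<le> r * e" using hen[OF ptag pfine] by simp
    finally have "e * measure lebesgue (\<Union>i\<in>D. cball (c i) (rad i)) \<le> r * e"
      using e by (simp add: mult_left_mono)
    then show ?thesis using e by (simp add: mult.commute)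
  qed
  let ?U = "\<Union>i\<in>C. cball (c i) (rad i)"
  have meas: "cball (c i) (rad i) \<in> lmeasurable" for i by simp
  have U: "?U \<in> lmeasurable" by (rule fmeasurable_UN_bound[OF C(1) meas fin])
  have Ur: "measure lebesgue ?U \<le> r" by (rule measure_UN_bound[OF C(1) meas fin])
  let ?N = "S - ?U"
  have "?U \<union> ?N \<in> lmeasurable" by (intro fmeasurable.Un U negligible_imp_measurable neg)
  moreover have "measure lebesgue (?U \<union> ?N) \<le> measure lebesgue ?U + measure lebesgue ?N"
    by (intro measure_Un_le fmeasurableD U negligible_imp_measurable neg)
  then have "measure lebesgue (?U \<union> ?N) \<le> r"
    using Ur negligible_imp_measure0[OF neg] by linarith
  ultimately show "\<exists>T. S \<subseteq> T \<and> T \<in> lmeasurable \<and> measure lebesgue T \<le> r"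
    by (intro exI[of _ "?U \<union> ?N"]) auto
qed

text \<open>This is what produces elements of the domain of \<^const>\<open>Hp\<close>: for a merely square-integrable
  \<open>g\<close> a function with second derivative \<open>g\<close> almost everywhere is found by integrating twice.\<close>

lemma lebesgue_differentiation:
  fixes f :: "real \<Rightarrow> 'b::euclidean_space"
  assumes f: "f integrable_on {a..b}"
  shows "negligible {x\<in>{a..b}. \<not> ((\<lambda>t. integral {a..t} f) has_vector_derivative f x) (at x within {a..b})}"
proof -
  define F where "F \<equiv> (\<lambda>t. integral {a..t} f)"
  define S where "S e = {x\<in>{a..b}. \<forall>d>0. \<exists>y\<in>{a..b}. y \<noteq> x \<and> \<bar>y - x\<bar> < d \<and>
              norm (F y - F x - (y - x) *\<^sub>R f x) \<ge> e * \<bar>y - x\<bar>}" for e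
  have "negligible (\<Union>n. S (1 / real (Suc n)))"
    unfolding S_def F_def by (intro negligible_Union_nat bad_difference_quotient_negligible[OF f]) simp
  moreover have "{x\<in>{a..b}. \<not> (F has_vector_derivative f x) (at x within {a..b})} \<subseteq> (\<Union>n. S (1 / real (Suc n)))"
  proof (rule subsetI, rule ccontr)
    fix x assume x: "x \<in> {x\<in>{a..b}. \<not> (F has_vector_derivative f x) (at x within {a..b})}"
      and no: "x \<notin> (\<Union>n. S (1 / real (Suc n)))"
    have "(F has_vector_derivative f x) (at x within {a..b})"
      unfolding has_vector_derivative_def has_derivative_within_alt
    proof (intro conjI allI impI)
      show "bounded_linear (\<lambda>y. y *\<^sub>R f x)" by (rule bounded_linear_scaleR_left)
      fix e :: real assume "e > 0"
      then obtain n where n: "1 / real (Suc n) < e"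
        using nat_approx_posE by blast
      have "x \<notin> S (1 / real (Suc n))" using no by blast
      then have "\<not> (\<forall>d>0. \<exists>y\<in>{a..b}. y \<noteq> x \<and> \<bar>y - x\<bar> < d \<and>
              norm (F y - F x - (y - x) *\<^sub>R f x) \<ge> 1 / real (Suc n) * \<bar>y - x\<bar>)"
        using x unfolding S_def by blast
      then obtain d where d: "d > 0" "\<And>y. y\<in>{a..b} \<Longrightarrow> y \<noteq> x \<Longrightarrow> \<bar>y - x\<bar> < d \<Longrightarrow>
             norm (F y - F x - (y - x) *\<^sub>R f x) < 1 / real (Suc n) * \<bar>y - x\<bar>"
        by (meson not_le)
      show "\<exists>d>0. \<forall>y\<in>{a..b}. norm (y - x) < d \<longrightarrow> norm (F y - F x - (y - x) *\<^sub>R f x) \<le> e * norm (y - x)"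
      proof (intro exI[of _ d] conjI d(1) ballI impI)
        fix y assume y: "y \<in> {a..b}" "norm (y - x) < d"
        show "norm (F y - F x - (y - x) *\<^sub>R f x) \<le> e * norm (y - x)"
        proof (cases "y = x")
          case False
          have "norm (F y - F x - (y - x) *\<^sub>R f x) \<le> 1 / real (Suc n) * \<bar>y - x\<bar>"
            using d(2)[OF y(1) False] y(2) by simp
          also have "\<dots> \<le> e * norm (y - x)"
            using n by (intro mult_mono) (auto simp: less_imp_le \<open>e > 0\<close>)
          finally show ?thesis .
        qed auto
      qed
    qed
    then show False using x by auto
  qed
  ultimately show ?thesis unfolding F_def using negligible_subset by blast
qed

lemma division_of_real_intervalE:
  assumes "K division_of \<Union>K" "\<Union>K \<subseteq> {a..b::real}" "k \<in> K"
  obtains u v where "k = {u..v}" "u \<le> v" "a \<le> u" "v \<le> b"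
proof -
  obtain u v where uv: "k = cbox u v" using division_ofD(4)[OF assms(1,3)] by blast
  then have "u \<le> v" using division_ofD(3)[OF assms(1,3)] by auto
  moreover have "{u..v} \<subseteq> {a..b}" using uv assms(2,3) by (metis Union_upper cbox_interval order_trans)
  ultimately show thesis using that[of u v] uv by simp
qed

text \<open>A gauge that is fine near the points of differentiability controls the tags outside \<open>N\<close>. A tag in
  \<open>N\<close> gets an open neighbourhood of \<open>N\<close> of small measure as its gauge, so that the intervals with
  such tags have small total length and absolute continuity bounds their contribution.\<close>

lemma ac_on_fundamental_theorem:
  fixes F f :: "real \<Rightarrow> complex"
  assumes ac: "ac_on a b F" and ab: "a \<le> b" and N: "negligible N"
    and der: "\<And>x. x \<in> {a..b} - N \<Longrightarrow> (F has_vector_derivative f x) (at x within {a..b})"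
  shows "(f has_integral (F b - F a)) {a..b}"
proof -
  define g where "g x = (if x \<in> N then 0 else f x)" for x
  have "(g has_integral (F b - F a)) (cbox a b)"
    unfolding has_integral
  proof (intro allI impI)
    fix e :: real assume e: "e > 0"
    define e' where "e' = e / (2 * (b - a + 1))"
    have e': "e' > 0" "e' * (b - a) < e / 2"
    proof -
      show "e' > 0" using e ab by (auto simp: e'_def)
      have "e' * (b - a) < e' * (b - a + 1)" using \<open>e' > 0\<close> by simp
      also have "\<dots> = e / 2" using ab by (simp add: e'_def field_simps)
      finally show "e' * (b - a) < e / 2" .
    qed
    obtain d where d: "d > 0" and ACd: "\<And>K. K division_of \<Union>K \<Longrightarrow> \<Union>K \<subseteq> {a..b} \<Longrightarrow>
      (\<Sum>k\<in>K. Sup k - Inf k) < d \<Longrightarrow> (\<Sum>k\<in>K. cmod (F (Sup k) - F (Inf k))) < e / 2"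
      using ac e unfolding ac_on_def by (elim allE[of _ "e/2"]) auto
    obtain U where U: "open U" "N \<subseteq> U" "(U - N) \<in> lmeasurable" "emeasure lebesgue (U - N) < ennreal d"
      using sets_lebesgue_outer_open[OF _ d, of N] N negligible_imp_sets by blast
    have Um: "U \<in> lmeasurable" "measure lebesgue U < d"
    proof -
      have "U = (U - N) \<union> N" using U by auto
      then show Ul: "U \<in> lmeasurable"
        using U(3) N by (metis fmeasurable.Un negligible_imp_measurable)
      have "measure lebesgue U = measure lebesgue (U - N)"
        using N by (metis Ul fmeasurableD measure_Diff_null_set negligible_iff_null_sets)
      also have "\<dots> < d" using U(3,4) d
        by (simp add: emeasure_eq_measure2 ennreal_less_iff)
      finally show "measure lebesgue U < d" .
    qed
    have "\<exists>r>0. \<forall>y\<in>{a..b}. \<bar>y - x\<bar> < r \<longrightarrow> norm (F y - F x - (y - x) *\<^sub>R f x) \<le> e' * \<bar>y - x\<bar>"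
      if "x \<in> {a..b} - N" for x
      using der[OF that] e' unfolding has_vector_derivative_def has_derivative_within_alt by auto
    then obtain r where r: "\<And>x. x \<in> {a..b} - N \<Longrightarrow> r x > 0"
      "\<And>x y. x \<in> {a..b} - N \<Longrightarrow> y\<in>{a..b} \<Longrightarrow> \<bar>y - x\<bar> < r x \<Longrightarrow> norm (F y - F x - (y - x) *\<^sub>R f x) \<le> e' * \<bar>y - x\<bar>"
      by metis
    define \<gamma> where "\<gamma> x = (if x \<in> N then U else if x \<in> {a..b} then ball x (r x) else ball x 1)" for x
    show "\<exists>\<gamma>. gauge \<gamma> \<and> (\<forall>\<D>. \<D> tagged_division_of cbox a b \<and> \<gamma> fine \<D> \<longrightarrow>
                norm ((\<Sum>(x, k)\<in>\<D>. measure lborel k *\<^sub>R g x) - (F b - F a)) < e)"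
    proof (intro exI[of _ \<gamma>] conjI allI impI)
      show "gauge \<gamma>" using U r by (auto simp: gauge_def \<gamma>_def)
      fix p assume p: "p tagged_division_of cbox a b \<and> \<gamma> fine p"
      then have pt: "p tagged_division_of {a..b}" and fine: "\<gamma> fine p" by auto
      have fp: "finite p" using pt by auto
      define G where "G = (\<lambda>(x::real,K). F (Sup K) - F (Inf K))"
      have tel: "(\<Sum>y\<in>p. G y) = F b - F a"
        using additive_tagged_division_1[OF ab pt, of F] by (simp add: G_def split_def)
      define pN where "pN = {y\<in>p. fst y \<in> N}"
      have split: "(\<Sum>y\<in>p. h y) = (\<Sum>y\<in>pN. h y) + (\<Sum>y\<in>p - pN. h y)" for h :: "_ \<Rightarrow> 'c::comm_monoid_add"
        using sum.subset_diff[of pN p h] fp by (auto simp: pN_def add.commute)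
      have pNt: "pN tagged_partial_division_of {a..b}"
        using pt tagged_partial_division_subset[of p "{a..b}" pN] by (auto simp: pN_def tagged_division_of_def)
      have ints: "\<exists>u v. K = {u..v} \<and> u \<le> v \<and> x \<in> {u..v} \<and> {u..v} \<subseteq> {a..b}" if "(x,K) \<in> p" for x K
        using tagged_division_ofD(2-4)[OF pt that] by (force simp: cbox_interval)
      have N1: "norm (\<Sum>y\<in>pN. G y) < e / 2"
      proof -
        let ?K = "snd ` pN"
        have dv: "?K division_of \<Union>?K" using partial_division_of_tagged_division[OF pNt] .
        have sub: "\<Union>?K \<subseteq> {a..b}" using pNt unfolding tagged_partial_division_of_def by fastforce
        have subU: "\<Union>?K \<subseteq> U" using fine by (fastforce simp: pN_def fine_def \<gamma>_def)
        have "(\<Sum>k\<in>?K. Sup k - Inf k) = (\<Sum>k\<in>?K. measure lebesgue k)"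
          by (intro sum.cong) (use ints in \<open>fastforce simp: pN_def\<close>)+
        also have "\<dots> = measure lebesgue (\<Union>?K)"
          using content_division[OF dv] by (simp cong: sum.cong)
        also have "\<dots> \<le> measure lebesgue U"
          using subU Um(1) lmeasurable_division[OF dv] by (intro measure_mono_fmeasurable) auto
        finally have "(\<Sum>k\<in>?K. cmod (F (Sup k) - F (Inf k))) < e / 2"
          using Um(2) by (intro ACd dv sub) simp
        moreover have "(\<Sum>y\<in>pN. cmod (G y)) = (\<Sum>k\<in>?K. cmod (F (Sup k) - F (Inf k)))"
        proof -
          \<comment> \<open>On intervals without interior the increment of \<open>F\<close> vanishes; the empty set has to be set apart because its \<^const>\<open>Sup\<close> and \<^const>\<open>Inf\<close> are unspecified.\<close>
          define g' where "g' K = (if K = {} then 0 else cmod (F (Sup K) - F (Inf K)))" for K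
          have "(\<Sum>(x,k)\<in>pN. g' k) = (\<Sum>k\<in>?K. g' k)"
          proof (rule sum.over_tagged_division_lemma[OF tagged_partial_division_of_Union_self[OF pNt]])
            fix u v :: real assume "box u v = {}"
            then have "v \<le> u" by (simp add: box_real)
            then show "g' (cbox u v) = 0"
              by (cases "u = v") (auto simp: g'_def)
          qed
          moreover have "g' K = cmod (F (Sup K) - F (Inf K))" if "(x,K) \<in> pN" for x K
            using pNt that by (auto simp: g'_def tagged_partial_division_of_def)
          then have "(\<Sum>(x,k)\<in>pN. g' k) = (\<Sum>y\<in>pN. cmod (G y))"
            "(\<Sum>k\<in>?K. g' k) = (\<Sum>k\<in>?K. cmod (F (Sup k) - F (Inf k)))"
            by (auto intro!: sum.cong simp: G_def)
          ultimately show ?thesis by simp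
        qed
        ultimately show ?thesis
          by (metis order.strict_trans1 norm_sum)
      qed
      have N2: "norm (\<Sum>y\<in>p - pN. (case y of (x,k) \<Rightarrow> measure lborel k *\<^sub>R g x) - G y) \<le> e' * (b - a)"
      proof -
        have "norm (\<Sum>y\<in>p - pN. (case y of (x,k) \<Rightarrow> measure lborel k *\<^sub>R g x) - G y)
            \<le> (\<Sum>y\<in>p - pN. e' * measure lborel (snd y))"
        proof (rule sum_norm_le)
          fix y assume y: "y \<in> p - pN"
          obtain x K where xK: "y = (x,K)" by (cases y)
          have xN: "x \<notin> N" using y xK by (auto simp: pN_def)
          obtain u v where uv: "K = {u..v}" "u \<le> v" "x \<in> {u..v}" "{u..v} \<subseteq> {a..b}"
            using ints y xK by blast
          have x: "x \<in> {a..b} - N" using xN uv by auto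
          have "K \<subseteq> ball x (r x)" using fine y xK x by (force simp: fine_def \<gamma>_def)
          then have "\<bar>u - x\<bar> < r x" "\<bar>v - x\<bar> < r x" using uv(1,2) by (auto simp: dist_real_def subset_eq abs_minus_commute)
          then have u: "norm (F u - F x - (u - x) *\<^sub>R f x) \<le> e' * (x - u)"
            and v: "norm (F v - F x - (v - x) *\<^sub>R f x) \<le> e' * (v - x)"
            using r(2)[OF x, of u] r(2)[OF x, of v] uv by auto
          have "(case y of (x,k) \<Rightarrow> measure lborel k *\<^sub>R g x) - G y =
             (F u - F x - (u - x) *\<^sub>R f x) - (F v - F x - (v - x) *\<^sub>R f x)"
            using uv xK xN by (simp add: G_def g_def algebra_simps)
          also have "norm \<dots> \<le> e' * (x - u) + e' * (v - x)"
            by (rule order_trans[OF norm_triangle_ineq4 add_mono[OF u v]])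
          finally show "norm ((case y of (x,k) \<Rightarrow> measure lborel k *\<^sub>R g x) - G y) \<le> e' * measure lborel (snd y)"
            using uv xK by (simp add: algebra_simps)
        qed
        also have "\<dots> \<le> (\<Sum>y\<in>p. e' * measure lborel (snd y))"
          using fp e' by (intro sum_mono2) auto
        also have "\<dots> = e' * (b - a)"
          using additive_content_tagged_division[of p a b] pt ab
          by (simp add: sum_distrib_left[symmetric] split_def)
        finally show ?thesis .
      qed
      have gN: "(\<Sum>y\<in>pN. case y of (x,k) \<Rightarrow> measure lborel k *\<^sub>R g x) = 0"
        by (intro sum.neutral) (auto simp: pN_def g_def)
      have "(\<Sum>y\<in>p. case y of (x,k) \<Rightarrow> measure lborel k *\<^sub>R g x) - (F b - F a)
          = (\<Sum>y\<in>p - pN. (case y of (x,k) \<Rightarrow> measure lborel k *\<^sub>R g x) - G y) - (\<Sum>y\<in>pN. G y)"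
        unfolding tel[symmetric] split gN by (simp add: sum_subtractf)
      also have "norm \<dots> < e' * (b - a) + e / 2"
        using norm_triangle_ineq4 N1 N2 by (smt (verit))
      also have "\<dots> < e" using e'(2) by simp
      finally show "norm ((\<Sum>(x, k)\<in>p. measure lborel k *\<^sub>R g x) - (F b - F a)) < e" .
    qed
  qed
  then show ?thesis
    using has_integral_spike[OF N, of "{a..b}" f g] by (simp add: g_def cbox_interval)
qed

lemma ac_on_lipschitz:
  assumes "\<And>x y. x \<in> {a..b} \<Longrightarrow> y \<in> {a..b} \<Longrightarrow> cmod (F y - F x) \<le> L * \<bar>y - x\<bar>"
  shows "ac_on a b F"
  unfolding ac_on_def
proof (intro allI impI)
  fix e :: real assume e: "e > 0"
  define L' where "L' = max L 1"
  have L': "L' > 0" "L \<le> L'" by (auto simp: L'_def)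
  show "\<exists>d>0. \<forall>K. K division_of \<Union> K \<and> \<Union> K \<subseteq> {a..b} \<and> (\<Sum>k\<in>K. Sup k - Inf k) < d \<longrightarrow>
               (\<Sum>k\<in>K. cmod (F (Sup k) - F (Inf k))) < e"
  proof (intro exI[of _ "e / L'"] conjI allI impI)
    show "0 < e / L'" using e L' by simp
    fix K assume K: "K division_of \<Union> K \<and> \<Union> K \<subseteq> {a..b} \<and> (\<Sum>k\<in>K. Sup k - Inf k) < e / L'"
    have "(\<Sum>k\<in>K. cmod (F (Sup k) - F (Inf k))) \<le> (\<Sum>k\<in>K. L' * (Sup k - Inf k))"
    proof (rule sum_mono)
      fix k assume k: "k \<in> K"
      then obtain u v where uv: "k = {u..v}" "u \<le> v" "a \<le> u" "v \<le> b"
        using K division_of_real_intervalE by metis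
      then have "u \<in> {a..b}" "v \<in> {a..b}" by auto
      then have "cmod (F v - F u) \<le> L * \<bar>v - u\<bar>" by (rule assms)
      also have "\<dots> \<le> L' * (v - u)" using uv L' by (auto intro: mult_right_mono)
      finally show "cmod (F (Sup k) - F (Inf k)) \<le> L' * (Sup k - Inf k)" using uv by simp
    qed
    also have "\<dots> = L' * (\<Sum>k\<in>K. Sup k - Inf k)" by (simp add: sum_distrib_left)
    also have "\<dots> < e" using K L' by (simp add: pos_less_divide_eq mult.commute)
    finally show "(\<Sum>k\<in>K. cmod (F (Sup k) - F (Inf k))) < e" .
  qed
qed

lemma ac_on_bounded_combination:
  assumes f: "ac_on a b f" and M: "M \<ge> 0" "M' \<ge> 0" and g: "ac_on a b g"
    and le: "\<And>x y. x \<in> {a..b} \<Longrightarrow> y \<in> {a..b} \<Longrightarrow>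
        cmod (h y - h x) \<le> M * cmod (f y - f x) + M' * cmod (g y - g x)"
  shows "ac_on a b h"
  unfolding ac_on_def
proof (intro allI impI)
  fix e :: real assume e: "e > 0"
  define e1 where "e1 = e / (M + M' + 1)"
  have e1: "e1 > 0" "(M + M') * e1 < e"
    using e M by (auto simp: e1_def field_simps add_pos_nonneg)
  obtain d1 where d1: "d1 > 0" "\<And>K. K division_of \<Union>K \<Longrightarrow> \<Union>K \<subseteq> {a..b} \<Longrightarrow>
      (\<Sum>k\<in>K. Sup k - Inf k) < d1 \<Longrightarrow> (\<Sum>k\<in>K. cmod (f (Sup k) - f (Inf k))) < e1"
      using f e1 unfolding ac_on_def by (elim allE[of _ "e1"]) auto
  obtain d2 where d2: "d2 > 0" "\<And>K. K division_of \<Union>K \<Longrightarrow> \<Union>K \<subseteq> {a..b} \<Longrightarrow>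
      (\<Sum>k\<in>K. Sup k - Inf k) < d2 \<Longrightarrow> (\<Sum>k\<in>K. cmod (g (Sup k) - g (Inf k))) < e1"
      using g e1 unfolding ac_on_def by (elim allE[of _ "e1"]) auto
  show "\<exists>d>0. \<forall>K. K division_of \<Union> K \<and> \<Union> K \<subseteq> {a..b} \<and> (\<Sum>k\<in>K. Sup k - Inf k) < d \<longrightarrow>
               (\<Sum>k\<in>K. cmod (h (Sup k) - h (Inf k))) < e"
  proof (intro exI[of _ "min d1 d2"] conjI allI impI)
    show "min d1 d2 > 0" using d1 d2 by auto
    fix K assume K: "K division_of \<Union> K \<and> \<Union> K \<subseteq> {a..b} \<and> (\<Sum>k\<in>K. Sup k - Inf k) < min d1 d2"
    have "(\<Sum>k\<in>K. cmod (h (Sup k) - h (Inf k))) \<le>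
       (\<Sum>k\<in>K. M * cmod (f (Sup k) - f (Inf k)) + M' * cmod (g (Sup k) - g (Inf k)))"
    proof (rule sum_mono)
      fix k assume k: "k \<in> K"
      then obtain u v where uv: "k = {u..v}" "u \<le> v" "a \<le> u" "v \<le> b"
        using K division_of_real_intervalE by metis
      then have "u \<in> {a..b}" "v \<in> {a..b}" by auto
      then show "cmod (h (Sup k) - h (Inf k)) \<le> M * cmod (f (Sup k) - f (Inf k)) + M' * cmod (g (Sup k) - g (Inf k))"
        using le[of u v] uv by simp
    qed
    also have "\<dots> = M * (\<Sum>k\<in>K. cmod (f (Sup k) - f (Inf k))) + M' * (\<Sum>k\<in>K. cmod (g (Sup k) - g (Inf k)))"
      by (simp add: sum_distrib_left sum.distrib)
    also have "\<dots> \<le> M * e1 + M' * e1"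
      using d1(2)[of K] d2(2)[of K] K M by (intro add_mono mult_left_mono) (auto simp: less_imp_le)
    also have "\<dots> < e" using e1(2) by (simp add: algebra_simps)
    finally show "(\<Sum>k\<in>K. cmod (h (Sup k) - h (Inf k))) < e" .
  qed
qed

text \<open>The bound \<open>cmod (h x) \<le> M + (cmod (h x))\<^sup>2 / M\<close> separates the total length of the intervals,
  which is multiplied by \<open>M\<close>, from the integral of the square, which is divided by \<open>M\<close>.\<close>

lemma ac_on_indefinite_integral:
  fixes h :: "real \<Rightarrow> complex"
  assumes h: "h absolutely_integrable_on {a..b}"
    and h2: "(\<lambda>x. (cmod (h x))\<^sup>2) integrable_on {a..b}"
  shows "ac_on a b (\<lambda>t. integral {a..t} h)"
  unfolding ac_on_def
proof (intro allI impI)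
  fix e :: real assume e: "e > 0"
  define B where "B = integral {a..b} (\<lambda>x. (cmod (h x))\<^sup>2)"
  have B0: "B \<ge> 0" unfolding B_def using h2 by (intro integral_nonneg) auto
  \<comment> \<open>This \<open>M\<close> makes the quadratic part, at most \<open>B / M\<close>, smaller than \<open>e / 2\<close>.\<close>
  define M where "M = 2 * (B + 1) / e"
  have M: "M > 0" using e B0 by (auto simp: M_def)
  have BM: "B / M < e / 2" using e B0 by (auto simp: M_def field_simps)
  have hi: "h integrable_on {a..b}" "(\<lambda>x. cmod (h x)) integrable_on {a..b}"
    using h unfolding absolutely_integrable_on_def by auto
  show "\<exists>d>0. \<forall>K. K division_of \<Union> K \<and> \<Union> K \<subseteq> {a..b} \<and> (\<Sum>k\<in>K. Sup k - Inf k) < d \<longrightarrow>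
               (\<Sum>k\<in>K. cmod (integral {a..Sup k} h - integral {a..Inf k} h)) < e"
  proof (intro exI[of _ "e / (2 * M)"] conjI allI impI)
    show "e / (2 * M) > 0" using e M by auto
    fix K assume K: "K division_of \<Union> K \<and> \<Union> K \<subseteq> {a..b} \<and> (\<Sum>k\<in>K. Sup k - Inf k) < e / (2 * M)"
    have "(\<Sum>k\<in>K. cmod (integral {a..Sup k} h - integral {a..Inf k} h)) \<le>
       (\<Sum>k\<in>K. M * (Sup k - Inf k) + integral k (\<lambda>x. (cmod (h x))\<^sup>2) / M)"
    proof (rule sum_mono)
      fix k assume k: "k \<in> K"
      then obtain u v where uv: "k = {u..v}" "u \<le> v" and ab: "a \<le> u" "v \<le> b"
        using K division_of_real_intervalE by metis
      have sub: "f integrable_on {u..v}" if "f integrable_on {a..b}" for f :: "real \<Rightarrow> 'c::euclidean_space"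
        using that ab by (meson integrable_on_subinterval atLeastatMost_subset_iff)
      have "h integrable_on {a..v}" using hi ab by (meson integrable_on_subinterval atLeastatMost_subset_iff order_refl)
      then have "integral {a..v} h - integral {a..u} h = integral {u..v} h"
        using Henstock_Kurzweil_Integration.integral_combine[of a u v h] uv ab by (auto simp: algebra_simps)
      also have "cmod \<dots> \<le> integral {u..v} (\<lambda>x. M + (cmod (h x))\<^sup>2 / M)"
      proof (rule integral_norm_bound_integral)
        show "h integrable_on {u..v}" by (rule sub[OF hi(1)])
        show "(\<lambda>x. M + (cmod (h x))\<^sup>2 / M) integrable_on {u..v}"
          by (intro integrable_add integrable_on_divide sub[OF h2]) auto
        fix x
        have "cmod (h x) * M \<le> M\<^sup>2 + (cmod (h x))\<^sup>2"
          using sum_squares_bound[of M "cmod (h x)"] mult_nonneg_nonneg[OF less_imp_le[OF M] norm_ge_zero[of "h x"]]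
          by (simp only: mult.commute mult.left_commute)
        then show "cmod (h x) \<le> M + (cmod (h x))\<^sup>2 / M"
          using M by (simp add: divide_simps) (simp add: algebra_simps power2_eq_square)
      qed
      also have "\<dots> = M * (v - u) + integral {u..v} (\<lambda>x. (cmod (h x))\<^sup>2) / M"
        using uv by (subst Henstock_Kurzweil_Integration.integral_add) (auto intro!: sub[OF h2] integrable_on_divide)
      finally show "cmod (integral {a..Sup k} h - integral {a..Inf k} h) \<le> M * (Sup k - Inf k) + integral k (\<lambda>x. (cmod (h x))\<^sup>2) / M"
        using uv by simp
    qed
    also have "\<dots> = M * (\<Sum>k\<in>K. Sup k - Inf k) + (\<Sum>k\<in>K. integral k (\<lambda>x. (cmod (h x))\<^sup>2)) / M"
      by (simp add: sum.distrib sum_distrib_left sum_divide_distrib)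
    also have "(\<Sum>k\<in>K. integral k (\<lambda>x. (cmod (h x))\<^sup>2)) = integral (\<Union>K) (\<lambda>x. (cmod (h x))\<^sup>2)"
      using K h2 by (intro integral_combine_division_topdown[symmetric])
        (auto intro: integrable_on_subdivision[of K])
    also have "\<dots> \<le> B"
      unfolding B_def using K h2 by (intro integral_subset_le) (auto intro: integrable_on_subdivision[of K])
    also have "M * (\<Sum>k\<in>K. Sup k - Inf k) < e / 2" using K M by (simp add: field_simps)
    finally have "(\<Sum>k\<in>K. cmod (integral {a..Sup k} h - integral {a..Inf k} h)) < e / 2 + B / M"
      using M by (auto simp: divide_right_mono)
    then show "(\<Sum>k\<in>K. cmod (integral {a..Sup k} h - integral {a..Inf k} h)) < e"
      using BM by linarith
  qed
qed

section \<open>The Hilbert space of the period interval\<close>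

lemma L2_rep_square_integrable: "square_integrable (L2_rep u)"
  using Quotient_rep_reflp[OF Quotient_L2, of u] by (simp add: L2_rel_def)

lemma L2_class_rep: "L2_class (L2_rep u) = u"
  by (rule Quotient_abs_rep[OF Quotient_L2])

lemma L2_cases: obtains f where "square_integrable f" "u = L2_class f"
  using that[of "L2_rep u"] by (simp add: L2_rep_square_integrable L2_class_rep)

lemma L2_rel_self: "square_integrable f \<Longrightarrow> L2_rel f f"
  by (simp add: L2_rel_def)

lemma L2_class_eq_iff:
  assumes "square_integrable f" "square_integrable g"
  shows "L2_class f = L2_class g \<longleftrightarrow> (AE x in leb_period. f x = g x)"
  using Quotient_rel[OF Quotient_L2, of f g] assms by (auto simp: L2_rel_def)

lemma L2_class_add:
  "square_integrable f \<Longrightarrow> square_integrable g \<Longrightarrow> L2_class f + L2_class g = L2_class (\<lambda>x. f x + g x)"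
  by (simp add: plus_L2.abs_eq L2_rel_self)

lemma L2_class_scale:
  "square_integrable f \<Longrightarrow> c *\<^sub>C L2_class f = L2_class (\<lambda>x. c * f x)"
  by (simp add: scaleC_L2.abs_eq L2_rel_self)

lemma square_integrable_diff:
  assumes "square_integrable f" "square_integrable g"
  shows "square_integrable (\<lambda>x. f x - g x)"
  using square_integrable_add[OF assms(1) square_integrable_scale[OF assms(2), of "-1"]] by simp

lemma L2_class_diff:
  "square_integrable f \<Longrightarrow> square_integrable g \<Longrightarrow> L2_class f - L2_class g = L2_class (\<lambda>x. f x - g x)"
  using square_integrable_scale[of g "-1"]
  by (simp add: minus_L2_def uminus_L2.abs_eq L2_rel_self plus_L2.abs_eq)

lemma L2_class_zero: "L2_class (\<lambda>_. 0) = 0"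
  by (simp add: zero_L2_def)

lemma L2_class_sum:
  assumes "finite A" "\<And>i. i \<in> A \<Longrightarrow> square_integrable (f i)"
  shows "square_integrable (\<lambda>x. \<Sum>i\<in>A. f i x) \<and> (\<Sum>i\<in>A. L2_class (f i)) = L2_class (\<lambda>x. \<Sum>i\<in>A. f i x)"
  using assms
proof (induction rule: finite_induct)
  case empty
  then show ?case by (simp add: square_integrable_zero L2_class_zero)
next
  case (insert i A)
  then show ?case by (simp add: L2_class_add square_integrable_add)
qed

lemma norm_L2_class:
  assumes "square_integrable f"
  shows "(norm (L2_class f))\<^sup>2 = (LINT x|leb_period. (cmod (f x))\<^sup>2)"
proof -
  have "(norm (L2_class f))\<^sup>2 = L2_class f \<bullet> L2_class f"
    by (simp add: dot_square_norm)
  also have "\<dots> = (LINT x|leb_period. f x \<bullet> f x)"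
    using assms by (simp add: inner_L2.abs_eq L2_rel_self)
  also have "\<dots> = (LINT x|leb_period. (cmod (f x))\<^sup>2)" by (simp add: dot_square_norm)
  finally show ?thesis .
qed

lemma emeasure_leb_period: "emeasure leb_period (space leb_period) = ennreal (2 * pi)"
  by (simp add: emeasure_restrict_space)

lemma finite_measure_leb_period: "finite_measure leb_period"
  by (rule finite_measureI, subst emeasure_leb_period) simp

lemma measure_leb_period: "measure leb_period (space leb_period) = 2 * pi"
  using emeasure_leb_period by (simp add: measure_def)

lemma square_integrable_of_real_norm:
  "square_integrable f \<Longrightarrow> square_integrable (\<lambda>x. complex_of_real (cmod (f x)))"
  by (auto simp: square_integrable_def)

lemma square_integrable_const: "square_integrable (\<lambda>_. c)"
  using finite_measure_leb_period by (simp add: square_integrable_def finite_measure.integrable_const)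

lemma square_integrable_imp_integrable:
  assumes "square_integrable f" shows "integrable leb_period f"
proof -
  have "integrable leb_period (\<lambda>x. complex_of_real (cmod (f x)) \<bullet> 1)"
    by (rule square_integrable_inner[OF square_integrable_of_real_norm[OF assms] square_integrable_const])
  then have "integrable leb_period (\<lambda>x. cmod (f x))"
    by (simp add: inner_complex_def)
  then show ?thesis
    using assms by (simp add: square_integrable_def integrable_norm_iff)
qed

text \<open>Cauchy-Schwarz against the constant function \<open>1\<close>; it makes the Fourier coefficients continuous
  and turns convergence in \<open>L2\<close> into convergence in \<open>L1\<close>.\<close>

lemma integral_norm_le_L2_norm:
  assumes "square_integrable f"
  shows "(LINT x|leb_period. cmod (f x)) \<le> sqrt (2 * pi) * norm (L2_class f)"
proof -
  let ?a = "\<lambda>x. complex_of_real (cmod (f x))"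
  have a: "square_integrable ?a" by (rule square_integrable_of_real_norm[OF assms])
  have "(norm (L2_class ?a))\<^sup>2 = (norm (L2_class f))\<^sup>2"
    using a assms by (simp add: norm_L2_class)
  then have na: "norm (L2_class ?a) = norm (L2_class f)" by (simp add: power2_eq_imp_eq)
  have "(norm (L2_class (\<lambda>_. 1)))\<^sup>2 = 2 * pi"
    using measure_leb_period by (simp add: norm_L2_class square_integrable_const)
  then have n1: "norm (L2_class (\<lambda>_. 1)) = sqrt (2 * pi)"
    by (metis norm_ge_zero real_sqrt_unique)
  have "(LINT x|leb_period. cmod (f x)) = L2_class ?a \<bullet> L2_class (\<lambda>_. 1)"
    using a by (simp add: inner_L2.abs_eq L2_rel_self square_integrable_const inner_complex_def)
  also have "\<dots> \<le> norm (L2_class ?a) * norm (L2_class (\<lambda>_. 1))" by (rule norm_cauchy_schwarz)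
  finally show ?thesis by (simp add: na n1 mult.commute)
qed

lemma bounded_square_integrable:
  assumes "f \<in> borel_measurable leb_period" "\<And>x. x \<in> period \<Longrightarrow> cmod (f x) \<le> M"
  shows "square_integrable f" "norm (L2_class f) \<le> sqrt (2 * pi) * M"
proof -
  interpret finite_measure leb_period by (rule finite_measure_leb_period)
  have M: "M \<ge> 0" using assms(2)[of 0] norm_ge_zero[of "f 0"] by (simp del: norm_ge_zero)
  have int: "integrable leb_period (\<lambda>x. (cmod (f x))\<^sup>2)"
    using assms M by (intro integrable_const_bound[where B = "M\<^sup>2"]) (auto intro!: power_mono AE_I2)
  then show sq: "square_integrable f" using assms by (simp add: square_integrable_def)
  have "(norm (L2_class f))\<^sup>2 = (LINT x|leb_period. (cmod (f x))\<^sup>2)" by (rule norm_L2_class[OF sq])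
  also have "\<dots> \<le> (LINT x|leb_period. M\<^sup>2)"
    using assms int by (intro integral_mono) (auto intro!: power_mono)
  also have "\<dots> = (sqrt (2 * pi) * M)\<^sup>2" using measure_leb_period by (simp add: power_mult_distrib)
  finally show "norm (L2_class f) \<le> sqrt (2 * pi) * M"
    using M by (intro power2_le_imp_le[of "norm (L2_class f)"]) auto
qed

lemma continuous_square_integrable:
  assumes "continuous_on period f" shows "square_integrable f"
proof -
  obtain M where "\<And>x. x \<in> period \<Longrightarrow> cmod (f x) \<le> M"
    using compact_imp_bounded[OF compact_continuous_image[OF assms compact_Icc]]
    unfolding bounded_iff by blast
  moreover have "f \<in> borel_measurable leb_period"
    using assms by (intro continuous_imp_measurable_on_sets_lebesgue) auto
  ultimately show ?thesis using bounded_square_integrable by blast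
qed

lemma nn_integral_norm_square:
  assumes "square_integrable f"
  shows "(\<integral>\<^sup>+x. ennreal ((cmod (f x))\<^sup>2) \<partial>leb_period) = ennreal ((norm (L2_class f))\<^sup>2)"
  using assms by (subst nn_integral_eq_integral) (auto simp: square_integrable_def norm_L2_class)

lemma square_integrable_if_nn_integral_le:
  assumes f: "f \<in> borel_measurable leb_period" and r: "r \<ge> 0"
    and le: "(\<integral>\<^sup>+x. ennreal ((cmod (f x))\<^sup>2) \<partial>leb_period) \<le> ennreal (r\<^sup>2)"
  shows "square_integrable f" "norm (L2_class f) \<le> r"
proof -
  have "integrable leb_period (\<lambda>x. (cmod (f x))\<^sup>2)"
    using f le by (intro integrableI_bounded) (auto simp: le_less_trans)
  then show sq: "square_integrable f" using f by (simp add: square_integrable_def)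
  have "ennreal ((norm (L2_class f))\<^sup>2) \<le> ennreal (r\<^sup>2)"
    using nn_integral_norm_square[OF sq] le by simp
  then show "norm (L2_class f) \<le> r"
    using r by (simp add: power_mono_iff)
qed

text \<open>Riesz-Fischer: a fast subsequence converges almost everywhere, since its increments are summable in
  \<open>L1\<close>, and Fatou's lemma shows that the limit is also the limit in \<open>L2\<close>. Completeness makes operator-norm
  limits and contour integrals of resolvents available.\<close>

instance L2 :: banach
proof
  fix X :: "nat \<Rightarrow> L2" assume X: "Cauchy X"
  define f where "f n = L2_rep (X n)" for n
  have f: "square_integrable (f n)" "X n = L2_class (f n)" for n
    by (simp_all add: f_def L2_rep_square_integrable L2_class_rep)
  have [measurable]: "f n \<in> borel_measurable leb_period" for n
    using f by (simp add: square_integrable_def)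
  have "\<forall>k. \<exists>N. \<forall>m\<ge>N. \<forall>n\<ge>N. norm (X m - X n) < (1/2)^k"
    using CauchyD[OF X] by simp
  then obtain N where N: "\<And>k m n. m \<ge> N k \<Longrightarrow> n \<ge> N k \<Longrightarrow> norm (X m - X n) < (1/2)^k"
    by metis
  \<comment> \<open>A nondecreasing sequence of indices with \<open>N k \<le> r k\<close>.\<close>
  define r where "r k = (\<Sum>j\<le>k. N j)" for k
  have r: "N k \<le> r j" if "k \<le> j" for k j
    using that unfolding r_def by (intro member_le_sum) auto
  let ?d = "\<lambda>k x. cmod (f (r (Suc k)) x - f (r k) x)"
  have dk: "(\<integral>\<^sup>+x. ennreal (?d k x) \<partial>leb_period) \<le> ennreal (sqrt (2 * pi) * (1/2)^k)" for k
  proof -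
    have sq: "square_integrable (\<lambda>x. f (r (Suc k)) x - f (r k) x)"
      by (intro square_integrable_diff f)
    have "(\<integral>\<^sup>+x. ennreal (?d k x) \<partial>leb_period) = ennreal (LINT x|leb_period. ?d k x)"
      using square_integrable_imp_integrable[OF sq] by (intro nn_integral_eq_integral) auto
    also have "(LINT x|leb_period. ?d k x) \<le> sqrt (2 * pi) * norm (X (r (Suc k)) - X (r k))"
      using integral_norm_le_L2_norm[OF sq] by (simp add: f(2) L2_class_diff f(1))
    also have "\<dots> \<le> sqrt (2 * pi) * (1/2)^k"
      using N[of k "r (Suc k)" "r k"] r[of k] by (intro mult_left_mono) (auto intro: less_imp_le)
    finally show ?thesis by (simp add: ennreal_leI)
  qed
  have "(\<integral>\<^sup>+x. (\<Sum>k. ennreal (?d k x)) \<partial>leb_period) = (\<Sum>k. \<integral>\<^sup>+x. ennreal (?d k x) \<partial>leb_period)"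
    by (intro nn_integral_suminf) measurable
  also have "\<dots> \<le> (\<Sum>k. ennreal (sqrt (2 * pi) * (1/2)^k))"
    by (intro suminf_le dk) auto
  also have "\<dots> = ennreal (\<Sum>k. sqrt (2 * pi) * (1/2)^k)"
    by (intro suminf_ennreal2 summable_mult summable_geometric) auto
  finally have "(\<integral>\<^sup>+x. (\<Sum>k. ennreal (?d k x)) \<partial>leb_period) \<noteq> \<infinity>"
    by (auto simp: top_unique)
  then have "AE x in leb_period. (\<Sum>k. ennreal (?d k x)) \<noteq> \<infinity>"
    by (intro nn_integral_noteq_infinite) auto
  then have ae: "AE x in leb_period. (\<lambda>k. f (r k) x) \<longlonglongrightarrow> lim (\<lambda>k. f (r k) x)"
  proof (rule eventually_mono)
    fix x assume "(\<Sum>k. ennreal (?d k x)) \<noteq> \<infinity>"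
    then have "summable (\<lambda>k. ?d k x)" by (intro summable_suminf_not_top) auto
    then have "summable (\<lambda>k. f (r (Suc k)) x - f (r k) x)" by (rule summable_norm_cancel)
    then have "convergent (\<lambda>k. f (r k) x)"
      using sum_lessThan_telescope[of "\<lambda>k. f (r k) x"]
      by (simp add: summable_iff_convergent convergent_diff_const_right_iff)
    then show "(\<lambda>k. f (r k) x) \<longlonglongrightarrow> lim (\<lambda>k. f (r k) x)" by (simp add: convergent_LIMSEQ_iff)
  qed
  define F where "F x = lim (\<lambda>k. f (r k) x)" for x
  have [measurable]: "F \<in> borel_measurable leb_period"
    unfolding F_def by (intro borel_measurable_lim_metric) measurable
  have close: "square_integrable (\<lambda>x. F x - f n x) \<and> norm (L2_class (\<lambda>x. F x - f n x)) \<le> e"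
    if e: "e > 0" and n: "\<And>m. m \<ge> M \<Longrightarrow> norm (X m - X n) \<le> e" and M: "M = N j" for e n M j
  proof -
    have "(\<integral>\<^sup>+x. ennreal ((cmod (F x - f n x))\<^sup>2) \<partial>leb_period)
        = (\<integral>\<^sup>+x. liminf (\<lambda>k. ennreal ((cmod (f (r k) x - f n x))\<^sup>2)) \<partial>leb_period)"
    proof (rule nn_integral_cong_AE, rule eventually_mono[OF ae])
      fix x assume "(\<lambda>k. f (r k) x) \<longlonglongrightarrow> lim (\<lambda>k. f (r k) x)"
      then have "(\<lambda>k. f (r k) x) \<longlonglongrightarrow> F x" by (simp add: F_def)
      then have "(\<lambda>k. ennreal ((cmod (f (r k) x - f n x))\<^sup>2)) \<longlonglongrightarrow> ennreal ((cmod (F x - f n x))\<^sup>2)"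
        by (intro tendsto_ennrealI tendsto_intros)
      then show "ennreal ((cmod (F x - f n x))\<^sup>2) = liminf (\<lambda>k. ennreal ((cmod (f (r k) x - f n x))\<^sup>2))"
        by (intro lim_imp_Liminf[symmetric] sequentially_bot)
    qed
    also have "\<dots> \<le> liminf (\<lambda>k. \<integral>\<^sup>+x. ennreal ((cmod (f (r k) x - f n x))\<^sup>2) \<partial>leb_period)"
      by (intro nn_integral_liminf) measurable
    also have "\<dots> \<le> liminf (\<lambda>k. ennreal (e\<^sup>2))"
    proof (intro Liminf_mono)
      show "\<forall>\<^sub>F k in sequentially. (\<integral>\<^sup>+x. ennreal ((cmod (f (r k) x - f n x))\<^sup>2) \<partial>leb_period) \<le> ennreal (e\<^sup>2)"
        using eventually_ge_at_top[of j]
      proof eventually_elim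
        case (elim k)
        have "norm (X (r k) - X n) \<le> e" using n r[OF elim] M by simp
        then show ?case
          using nn_integral_norm_square[OF square_integrable_diff[OF f(1)[of "r k"] f(1)[of n]]]
          by (simp add: f(2) L2_class_diff f(1) ennreal_leI power_mono)
      qed
    qed
    also have "\<dots> = ennreal (e\<^sup>2)" by (simp add: Liminf_const)
    finally show ?thesis
      using square_integrable_if_nn_integral_le[of "\<lambda>x. F x - f n x" e] e by auto
  qed
  have "square_integrable (\<lambda>x. F x - f (N 0) x)"
    using close[of 1 "N 0" "N 0" 0] N[of 0 "N 0"] N[of 0] by (force simp: less_imp_le)
  from square_integrable_add[OF this f(1)[of "N 0"]] have F: "square_integrable F" by simp
  show "convergent X"
  proof (rule convergentI[of _ "L2_class F"], rule LIMSEQ_I)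
    fix e :: real assume e: "e > 0"
    obtain j where j: "(1/2)^j < e" using real_arch_pow_inv[of e "1/2"] e by auto
    show "\<exists>no. \<forall>n\<ge>no. norm (X n - L2_class F) < e"
    proof (intro exI[of _ "N j"] allI impI)
      fix n assume n: "n \<ge> N j"
      have "norm (L2_class (\<lambda>x. F x - f n x)) \<le> (1/2)^j"
        using close[of "(1/2)^j" "N j" n j] N[of j _ n] n by (auto simp: less_imp_le)
      then show "norm (X n - L2_class F) < e"
        using j by (simp add: f(2) L2_class_diff[symmetric] F f(1) norm_minus_commute)
    qed
  qed
qed

section \<open>Fourier coefficients\<close>

definition expi :: "int \<Rightarrow> real \<Rightarrow> complex" where
  "expi p x = exp (\<i> * of_int p * of_real x)"

definition fourier_basis :: "int \<Rightarrow> L2" where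
  "fourier_basis p = L2_class (expi p)"

text \<open>The functional is defined on classes through a representative and is independent of it by the
  lemma \<open>fc_L2_class\<close> below.\<close>

definition fc :: "int \<Rightarrow> L2 \<Rightarrow> complex" where
  "fc p u = (LINT x|leb_period. L2_rep u x * expi (- p) x) / (2 * pi)"

lemma continuous_on_expi [continuous_intros]: "continuous_on S (expi p)"
  unfolding expi_def by (intro continuous_intros)

lemma norm_expi [simp]: "cmod (expi p x) = 1"
  by (simp add: expi_def)

lemma expi_add: "expi p x * expi q x = expi (p + q) x"
  by (simp add: expi_def exp_add[symmetric] algebra_simps)

lemma expi_0 [simp]: "expi 0 x = 1" "expi p 0 = 1"
  by (simp_all add: expi_def)

lemma expi_2pi [simp]: "expi p (2 * pi) = 1"
proof -
  have "expi p (2 * pi) = exp (2 * of_int p * pi * \<i>)" by (simp add: expi_def algebra_simps)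
  then show ?thesis by (simp add: exp_eq_1)
qed

lemma expi_measurable [measurable]: "expi p \<in> borel_measurable leb_period"
  by (intro continuous_imp_measurable_on_sets_lebesgue continuous_intros) auto

lemma square_integrable_expi: "square_integrable (expi p)"
  by (intro continuous_square_integrable continuous_intros)

lemma square_integrable_expi_mult:
  "square_integrable f \<Longrightarrow> square_integrable (\<lambda>x. expi p x * f x)"
  by (auto simp: square_integrable_def norm_mult intro!: borel_measurable_times)

lemma integrable_mult_expi:
  "square_integrable f \<Longrightarrow> integrable leb_period (\<lambda>x. f x * expi p x)"
  using square_integrable_imp_integrable[OF square_integrable_expi_mult[of f p]] by (simp add: mult.commute)

lemma fc_L2_class:
  assumes "square_integrable f"
  shows "fc p (L2_class f) = (LINT x|leb_period. f x * expi (- p) x) / (2 * pi)"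
proof -
  have "AE x in leb_period. L2_rep (L2_class f) x = f x"
    using L2_class_eq_iff[OF L2_rep_square_integrable assms] L2_class_rep by blast
  then have "(LINT x|leb_period. L2_rep (L2_class f) x * expi (- p) x) = (LINT x|leb_period. f x * expi (- p) x)"
    using assms L2_rep_square_integrable[of "L2_class f"]
    by (intro integral_cong_AE) (auto simp: square_integrable_def intro!: borel_measurable_times)
  then show ?thesis by (simp add: fc_def)
qed

lemma fc_integral:
  assumes "square_integrable f"
  shows "fc p (L2_class f) = integral period (\<lambda>x. f x * expi (- p) x) / (2 * pi)"
  by (simp add: fc_L2_class assms lebesgue_integral_eq_integral integrable_mult_expi)

lemma fc_add: "fc p (u + v) = fc p u + fc p v"
proof -
  obtain f where f: "square_integrable f" "u = L2_class f" by (rule L2_cases)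
  obtain g where g: "square_integrable g" "v = L2_class g" by (rule L2_cases)
  show ?thesis unfolding f(2) g(2)
    by (simp add: L2_class_add f(1) g(1) fc_L2_class square_integrable_add distrib_right
        integrable_mult_expi add_divide_distrib)
qed

lemma fc_scaleC: "fc p (c *\<^sub>C u) = c * fc p u"
proof -
  obtain f where f: "square_integrable f" "u = L2_class f" by (rule L2_cases)
  show ?thesis unfolding f(2)
    by (simp add: L2_class_scale f(1) fc_L2_class square_integrable_scale mult.assoc)
qed

lemma norm_fc_le: "cmod (fc p u) \<le> norm u"
proof -
  obtain f where f: "square_integrable f" "u = L2_class f" by (rule L2_cases)
  have "cmod (LINT x|leb_period. f x * expi (- p) x) \<le> (LINT x|leb_period. cmod (f x))"
    using integral_norm_bound[of leb_period "\<lambda>x. f x * expi (- p) x"] by (simp add: norm_mult)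
  also have "\<dots> \<le> sqrt (2 * pi) * norm u"
    using integral_norm_le_L2_norm[OF f(1)] f(2) by simp
  also have "\<dots> \<le> (2 * pi) * norm u"
  proof (intro mult_right_mono)
    show "sqrt (2 * pi) \<le> 2 * pi"
      using pi_gt3 by (intro real_le_lsqrt) (auto simp: power2_eq_square)
  qed auto
  finally show ?thesis
    by (simp add: f(2) fc_L2_class f(1) norm_divide norm_mult divide_le_eq mult.commute)
qed

lemma bounded_linear_fc: "bounded_linear (fc p)"
proof (rule bounded_linear_intro[of _ 1])
  show "fc p (r *\<^sub>R u) = r *\<^sub>R fc p u" for r u
    by (simp add: scaleR_eq_scaleC fc_scaleC scaleR_conv_of_real)
qed (simp_all add: fc_add norm_fc_le)

lemma linear_fc: "linear (fc p)"
  by (rule bounded_linear.linear[OF bounded_linear_fc])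

lemmas fc_diff = linear_diff[OF linear_fc]
lemmas fc_0 [simp] = linear_0[OF linear_fc]
lemmas fc_sum = linear_sum[OF linear_fc]

lemma has_vector_derivative_expi:
  "(expi p has_vector_derivative (\<i> * of_int p * expi p x)) (at x within S)"
proof -
  have "((\<lambda>x. exp (\<i> * of_int p * complex_of_real x)) has_vector_derivative (\<i> * of_int p * expi p x)) (at x within S)"
    by (rule has_vector_derivative_eq_rhs, (rule derivative_intros has_vector_derivative_of_real exp_scaleR_has_vector_derivative_right
      field_vector_diff_chain_within[where g = exp, unfolded o_def])+)
      (auto simp: expi_def)
  then show ?thesis by (simp add: expi_def[abs_def])
qed

lemma integral_expi: "integral period (expi p) = (if p = 0 then 2 * pi else 0)"
proof (cases "p = 0")
  case True
  then have "expi p = (\<lambda>_. 1)" by auto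
  then show ?thesis using True by (simp add: scaleR_conv_of_real)
next
  case False
  have "((\<lambda>x. \<i> * of_int p * expi p x) has_integral (expi p (2*pi) - expi p 0)) period"
    by (intro fundamental_theorem_of_calculus has_vector_derivative_expi) auto
  then have "((\<lambda>x. (1 / (\<i> * of_int p)) * (\<i> * of_int p * expi p x)) has_integral (1 / (\<i> * of_int p)) * 0) period"
    by (intro has_integral_mult_right) simp
  then show ?thesis using False by (simp add: integral_unique)
qed

lemma fc_fourier_basis: "fc p (fourier_basis q) = (if p = q then 1 else 0)"
proof -
  have "fc p (fourier_basis q) = integral period (\<lambda>x. expi q x * expi (- p) x) / (2 * pi)"
    unfolding fourier_basis_def by (rule fc_integral[OF square_integrable_expi])
  then show ?thesis by (simp add: expi_add integral_expi)
qed

lemma fc_expi_mult: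
  assumes "square_integrable f"
  shows "fc p (L2_class (\<lambda>x. expi q x * f x)) = fc (p - q) (L2_class f)"
proof -
  have "expi q x * f x * expi (- p) x = f x * expi (- (p - q)) x" for x
  proof -
    have "expi q x * f x * expi (- p) x = f x * (expi q x * expi (- p) x)" by (simp only: ac_simps)
    then show ?thesis by (simp add: expi_add)
  qed
  then show ?thesis
    by (simp only: fc_L2_class assms square_integrable_expi_mult)
qed

lemma norm_fourier_basis_le: "norm (fourier_basis p) \<le> 2 * pi"
proof -
  have "norm (fourier_basis p) \<le> sqrt (2 * pi) * 1"
    unfolding fourier_basis_def by (intro bounded_square_integrable) auto
  also have "sqrt (2 * pi) \<le> 2 * pi"
    using pi_gt3 by (intro real_le_lsqrt) (auto simp: power2_eq_square)
  finally show ?thesis by simp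
qed

lemma inner_fourier_basis: "u \<bullet> (c *\<^sub>C fourier_basis p) = 2 * pi * Re (cnj c * fc p u)"
proof -
  obtain f where f: "square_integrable f" "u = L2_class f" by (rule L2_cases)
  have ei: "cnj (expi p x) = expi (- p) x" for x
    by (simp add: expi_def exp_cnj)
  have "u \<bullet> (c *\<^sub>C fourier_basis p) = (LINT x|leb_period. f x \<bullet> (c * expi p x))"
    using f by (simp add: fourier_basis_def L2_class_scale square_integrable_expi inner_L2.abs_eq
        L2_rel_self square_integrable_scale)
  also have "\<dots> = (LINT x|leb_period. Re (cnj c * (f x * expi (- p) x)))"
    by (intro Bochner_Integration.integral_cong refl)
       (simp add: ei[symmetric] inner_complex_def algebra_simps)
  also have "\<dots> = Re (LINT x|leb_period. cnj c * (f x * expi (- p) x))"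
    using integrable_mult_expi[OF f(1)] by (intro integral_Re) auto
  also have "\<dots> = 2 * pi * Re (cnj c * fc p u)"
    by (simp add: f fc_L2_class Re_divide_of_real[symmetric] flip: of_real_mult)
  finally show ?thesis .
qed

lemma norm_trig_sum:
  assumes "finite A"
  shows "(norm (\<Sum>p\<in>A. a p *\<^sub>C fourier_basis p))\<^sup>2 = 2 * pi * (\<Sum>p\<in>A. (cmod (a p))\<^sup>2)"
proof -
  let ?S = "\<Sum>p\<in>A. a p *\<^sub>C fourier_basis p"
  have *: "a p * (if q = p then 1 else 0) = (if q = p then a p else 0)" for p q by simp
  have fcS: "fc q ?S = (if q \<in> A then a q else 0)" for q
    using assms by (simp add: fc_sum fc_scaleC fc_fourier_basis *)
  have "(norm ?S)\<^sup>2 = ?S \<bullet> ?S" by (simp add: dot_square_norm)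
  also have "\<dots> = (\<Sum>p\<in>A. ?S \<bullet> (a p *\<^sub>C fourier_basis p))" by (simp add: inner_sum_right)
  also have "\<dots> = (\<Sum>p\<in>A. 2 * pi * (cmod (a p))\<^sup>2)"
    unfolding inner_fourier_basis fcS by (intro sum.cong) (auto simp: cmod_power2, simp add: power2_eq_square)
  finally show ?thesis by (simp add: sum_distrib_left)
qed

lemma bessel_inequality:
  assumes "finite A"
  shows "2 * pi * (\<Sum>p\<in>A. (cmod (fc p u))\<^sup>2) \<le> (norm u)\<^sup>2"
proof -
  let ?S = "\<Sum>p\<in>A. fc p u *\<^sub>C fourier_basis p"
  have "u \<bullet> ?S = (\<Sum>p\<in>A. 2 * pi * (cmod (fc p u))\<^sup>2)"
    unfolding inner_sum_right inner_fourier_basis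
    by (intro sum.cong) (auto simp: cmod_power2, simp add: power2_eq_square)
  then have uS: "u \<bullet> ?S = 2 * pi * (\<Sum>p\<in>A. (cmod (fc p u))\<^sup>2)" by (simp add: sum_distrib_left)
  have "0 \<le> (norm (u - ?S))\<^sup>2" by simp
  also have "\<dots> = (norm u)\<^sup>2 - 2 * (u \<bullet> ?S) + (norm ?S)\<^sup>2"
    by (simp add: power2_norm_eq_inner inner_diff_left inner_diff_right inner_commute)
  finally show ?thesis unfolding uS norm_trig_sum[OF assms] by simp
qed

lemma constant_modulus_fc_imp_zero:
  assumes "infinite P" "\<And>p. p \<in> P \<Longrightarrow> cmod (fc p u) = c"
  shows "c = 0"
proof (rule ccontr)
  assume "c \<noteq> 0"
  moreover have "c \<ge> 0" using assms by (metis infinite_imp_nonempty ex_in_conv norm_ge_zero)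
  ultimately have c: "2 * pi * c\<^sup>2 > 0" by simp
  obtain n :: nat where n: "(norm u)\<^sup>2 < real n * (2 * pi * c\<^sup>2)"
    using reals_Archimedean3[OF c] by blast
  obtain A where A: "finite A" "card A = n" "A \<subseteq> P"
    using infinite_arbitrarily_large[OF assms(1)] by blast
  have "2 * pi * (\<Sum>p\<in>A. (cmod (fc p u))\<^sup>2) = real n * (2 * pi * c\<^sup>2)"
    using A assms(2) by (simp add: subset_iff)
  then show False using bessel_inequality[OF A(1), of u] n by linarith
qed

lemma has_vector_derivative_slope:
  fixes f :: "real \<Rightarrow> complex"
  assumes "(f has_vector_derivative d) (at x within S)"
  shows "((\<lambda>y. (f y - f x) / of_real (y - x)) \<longlongrightarrow> d) (at x within S)"
proof -
  have "((\<lambda>y. norm (f y - f x - (y - x) *\<^sub>R d) / norm (y - x)) \<longlongrightarrow> 0) (at x within S)"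
    using assms unfolding has_vector_derivative_def has_derivative_iff_norm by simp
  then have "((\<lambda>y. norm ((f y - f x) / of_real (y - x) - d)) \<longlongrightarrow> 0) (at x within S)"
  proof (rule Lim_transform_eventually)
    show "\<forall>\<^sub>F y in at x within S. norm (f y - f x - (y - x) *\<^sub>R d) / norm (y - x) = norm ((f y - f x) / of_real (y - x) - d)"
      unfolding eventually_at_filter
    proof (intro always_eventually allI impI)
      fix y assume "y \<noteq> x"
      then have "(f y - f x) / of_real (y - x) - d = (f y - f x - (y - x) *\<^sub>R d) / of_real (y - x)"
        by (simp add: scaleR_conv_of_real diff_divide_distrib)
      then show "norm (f y - f x - (y - x) *\<^sub>R d) / norm (y - x) = norm ((f y - f x) / of_real (y - x) - d)"
        by (metis norm_divide norm_of_real real_norm_def)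
    qed
  qed
  then show ?thesis
    by (simp add: tendsto_norm_zero_iff LIM_zero_iff)
qed

lemma expi_1_eq_iff:
  assumes "0 < x0" "x0 < 2 * pi" "x \<in> period"
  shows "expi 1 x = expi 1 x0 \<longleftrightarrow> x = x0"
proof
  assume "expi 1 x = expi 1 x0"
  then obtain n :: int where n: "\<i> * complex_of_real x = \<i> * complex_of_real x0 + (of_int (2 * n) * pi) * \<i>"
    by (auto simp: expi_def exp_eq)
  have "x = x0 + of_int (2 * n) * pi"
    using arg_cong[OF n, of Im] by simp
  moreover have x: "0 \<le> x" "x \<le> 2 * pi" using assms by auto
  have "\<not> n \<ge> 1"
  proof
    assume "n \<ge> 1"
    then have "real_of_int (2 * n) * pi \<ge> 2 * pi" by (intro mult_right_mono) auto
    then show False using \<open>x = _\<close> assms(1,2) x by linarith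
  qed
  moreover have "\<not> n \<le> - 1"
  proof
    assume "n \<le> - 1"
    then have "real_of_int (2 * n) * pi \<le> (- 2) * pi" by (intro mult_right_mono) auto
    then show False using \<open>x = _\<close> assms(1,2) x by linarith
  qed
  then have "n = 0 \<or> n \<ge> 1" by linarith
  ultimately show "x = x0" by auto
qed simp

text \<open>An argument of Chernoff. With \<open>h\<close> the quotient of \<open>g - g(x0)\<close> by \<open>exp(ix) - exp(i x0)\<close>, which is
  continuous because \<open>g\<close> is differentiable at \<open>x0\<close>, the equation \<open>g - g(x0) = (exp(ix) - exp(i x0)) h\<close>
  says for the coefficients that \<open>h (p-1) = exp(i x0) h p\<close> unless \<open>p = 0\<close>. So their modulus
  is constant on each side of \<open>0\<close>, hence zero by Bessel's inequality, and the equation for \<open>p = 0\<close>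
  leaves \<open>g(x0) = 0\<close>.\<close>

lemma fourier_uniqueness_at_differentiable_point:
  assumes g: "continuous_on period g" and x0: "0 < x0" "x0 < 2 * pi"
    and d: "(g has_vector_derivative d) (at x0 within period)"
    and z: "\<And>p. fc p (L2_class g) = 0"
  shows "g x0 = 0"
proof -
  define h where "h x = (if x = x0 then d / (\<i> * expi 1 x0) else (g x - g x0) / (expi 1 x - expi 1 x0))" for x
  have ne: "expi 1 x \<noteq> expi 1 x0" if "x \<in> period" "x \<noteq> x0" for x
    using expi_1_eq_iff[OF x0] that by blast
  have nz: "expi 1 x0 \<noteq> 0" by (metis norm_expi norm_zero zero_neq_one)
  have "continuous_on period h"
    unfolding continuous_on_def
  proof
    fix x assume x: "x \<in> period"
    show "(h \<longlongrightarrow> h x) (at x within period)"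
    proof (cases "x = x0")
      case True
      have "((\<lambda>y. ((g y - g x0) / of_real (y - x0)) / ((expi 1 y - expi 1 x0) / of_real (y - x0)))
          \<longlongrightarrow> d / (\<i> * of_int 1 * expi 1 x0)) (at x0 within period)"
        by (intro tendsto_divide has_vector_derivative_slope d has_vector_derivative_expi) (use nz in auto)
      then have "(h \<longlongrightarrow> d / (\<i> * of_int 1 * expi 1 x0)) (at x0 within period)"
        by (rule Lim_transform_eventually)
           (auto simp: eventually_at_filter h_def intro!: always_eventually)
      then show ?thesis using True by (simp add: h_def)
    next
      case False
      have "((\<lambda>y. (g y - g x0) / (expi 1 y - expi 1 x0)) \<longlongrightarrow> (g x - g x0) / (expi 1 x - expi 1 x0)) (at x within period)"
        using ne[OF x False] g x continuous_on_expi[of period 1]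
        by (intro tendsto_intros) (auto simp: continuous_on_def)
      then have "(h \<longlongrightarrow> (g x - g x0) / (expi 1 x - expi 1 x0)) (at x within period)"
      proof (rule Lim_transform_eventually)
        show "\<forall>\<^sub>F y in at x within period. (g y - g x0) / (expi 1 y - expi 1 x0) = h y"
          using eventually_at_ball'[of "dist x x0" x] False
          unfolding eventually_at by (intro exI[of _ "dist x x0"]) (auto simp: h_def dist_commute)
      qed
      then show ?thesis using False by (simp add: h_def)
    qed
  qed
  then have h: "square_integrable h" by (rule continuous_square_integrable)
  have gs: "square_integrable g" using g by (rule continuous_square_integrable)
  have geq: "g x = g x0 + (expi 1 x * h x - expi 1 x0 * h x)" if "x \<in> period" for x
  proof -
    have "g x - g x0 = h x * (expi 1 x - expi 1 x0)"
      using ne[OF that] by (cases "x = x0") (auto simp: h_def)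
    then show ?thesis by (simp add: algebra_simps)
  qed
  have "L2_class g = L2_class (\<lambda>x. g x0 * expi 0 x + (expi 1 x * h x - expi 1 x0 * h x))"
    using geq by (subst L2_class_eq_iff)
      (auto intro!: AE_I2 gs square_integrable_add square_integrable_diff square_integrable_scale square_integrable_expi_mult h square_integrable_expi square_integrable_const)
  also have "\<dots> = g x0 *\<^sub>C fourier_basis 0 + (L2_class (\<lambda>x. expi 1 x * h x) - expi 1 x0 *\<^sub>C L2_class h)"
    unfolding fourier_basis_def
    by (simp add: L2_class_add L2_class_diff L2_class_scale h square_integrable_expi square_integrable_scale
       square_integrable_expi_mult square_integrable_diff del: expi_0)
  finally have Lg: "L2_class g = g x0 *\<^sub>C fourier_basis 0 + (L2_class (\<lambda>x. expi 1 x * h x) - expi 1 x0 *\<^sub>C L2_class h)" .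
  let ?h = "\<lambda>p. fc p (L2_class h)"
  have rec: "0 = (if p = 0 then g x0 else 0) + (?h (p - 1) - expi 1 x0 * ?h p)" for p
    using z[of p] unfolding Lg
    by (simp add: fc_add fc_diff fc_scaleC fc_fourier_basis fc_expi_mult h split: if_splits)
  have step: "cmod (?h (p - 1)) = cmod (?h p)" if "p \<noteq> 0" for p
    using rec[of p] that by (simp add: norm_mult)
  have up: "cmod (?h (int n)) = cmod (?h 0)" for n
  proof (induction n)
    case (Suc n)
    then show ?case using step[of "int (Suc n)"] by simp
  qed simp
  have down: "cmod (?h (- 1 - int n)) = cmod (?h (- 1))" for n
  proof (induction n)
    case (Suc n)
    have "- 1 - int n - 1 = - 1 - int (Suc n)" by simp
    then show ?case using step[of "- 1 - int n"] Suc by (metis add_diff_cancel diff_0 neg_equal_0_iff_equal of_nat_Suc of_nat_neq_0 uminus_add_conv_diff diff_minus_eq_add)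
  qed simp
  have "cmod (?h 0) = 0"
    by (rule constant_modulus_fc_imp_zero[of "range int" "L2_class h"]) (auto simp: up range_inj_infinite)
  moreover have "cmod (?h (- 1)) = 0"
    by (rule constant_modulus_fc_imp_zero[of "range (\<lambda>n. - 1 - int n)" "L2_class h"])
       (auto simp: down intro!: range_inj_infinite inj_onI)
  ultimately show ?thesis using rec[of 0] by simp
qed

section \<open>The periodic operator in terms of Fourier coefficients\<close>

lemma vector_derivative_period:
  assumes "x \<in> period" "(f has_vector_derivative d) (at x within period)"
  shows "derivative_on period f x = (d::complex)"
  using assms by (intro vector_derivative_within_closed_interval) auto

lemma has_vector_derivative_cong_period:
  assumes "x \<in> period" "\<And>t. t \<in> period \<Longrightarrow> f t = g t"
  shows "(f has_vector_derivative d) (at x within period) \<longleftrightarrow> (g has_vector_derivative d) (at x within period)"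
  by (intro has_vector_derivative_cong_ev always_eventually) (use assms in auto)

lemma AE_leb_period_negligible:
  "(AE x in leb_period. P x) \<longleftrightarrow> negligible {x \<in> period. \<not> P x}"
proof -
  have "(AE x in leb_period. P x) \<longleftrightarrow> (AE x in lebesgue. x \<in> period \<longrightarrow> P x)"
    by (simp add: AE_restrict_space_iff)
  also have "\<dots> \<longleftrightarrow> (AE x in lebesgue. x \<notin> {x \<in> period. \<not> P x})"
    by (rule AE_cong) auto
  also have "\<dots> \<longleftrightarrow> negligible {x \<in> period. \<not> P x}"
    unfolding negligible_iff_null_sets completion.AE_iff_null_sets by (simp del: atLeastAtMost_iff)
  finally show ?thesis .
qed

text \<open>Lebesgue measure is complete, so measurability passes to \<open>g\<close>.\<close>

lemma square_integrable_AE: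
  assumes f: "square_integrable f" and ae: "AE x in leb_period. f x = g x"
  shows "square_integrable g"
proof -
  have "(\<lambda>x. if x \<in> period then f x else 0) \<in> borel_measurable lebesgue"
    using f by (subst borel_measurable_if_I) (auto simp: square_integrable_def)
  moreover have "AE x in lebesgue. (if x \<in> period then f x else 0) = (if x \<in> period then g x else 0)"
    using ae by (simp add: AE_restrict_space_iff eventually_mono)
  ultimately have "(\<lambda>x. if x \<in> period then g x else 0) \<in> borel_measurable lebesgue"
    by (rule borel_measurable_AE)
  then have [measurable]: "g \<in> borel_measurable leb_period"
    by (rule borel_measurable_if_D)
  have "integrable leb_period (\<lambda>x. (cmod (g x))\<^sup>2)"
    by (rule integrable_cong_AE_imp[of _ "\<lambda>x. (cmod (f x))\<^sup>2"])
       (use f ae in \<open>auto simp: square_integrable_def\<close>)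
  then show ?thesis by (simp add: square_integrable_def)
qed

lemma has_vector_derivative_bound:
  fixes f :: "real \<Rightarrow> complex"
  assumes "convex S" "\<And>x. x \<in> S \<Longrightarrow> (f has_vector_derivative f' x) (at x within S)"
    "\<And>x. x \<in> S \<Longrightarrow> norm (f' x) \<le> B" "x \<in> S" "y \<in> S"
  shows "norm (f y - f x) \<le> B * norm (y - x)"
proof (rule differentiable_bound[of S f "\<lambda>x h. h *\<^sub>R f' x"])
  show "onorm (\<lambda>h. h *\<^sub>R f' x) \<le> B" if "x \<in> S" for x
    by (rule onorm_le) (use mult_right_mono[OF assms(3)[OF that] abs_ge_zero] in \<open>simp add: mult.commute\<close>)
qed (use assms in \<open>auto simp: has_vector_derivative_def\<close>)

text \<open>Integration by parts twice, in one step: \<open>(g' + ipg) exp(-ipx)\<close> is absolutely continuous and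
  periodic and has the derivative \<open>(g'' + p\<^sup>2 g) exp(-ipx)\<close> almost everywhere.\<close>

lemma periodic_fun_dom_fc:
  assumes g: "g \<in> periodic_fun_dom"
  shows "fc p (L2_class (derivative_on period (derivative_on period g))) = - (of_int p)\<^sup>2 * fc p (L2_class g)"
proof -
  define g1 where "g1 = derivative_on period g"
  define g2 where "g2 = derivative_on period g1"
  have sq: "square_integrable g" "square_integrable g2"
    using g by (auto simp: periodic_fun_dom_def g2_def g1_def)
  have dg: "(g has_vector_derivative g1 x) (at x within period)" if "x \<in> period" for x
    using g that unfolding g1_def vector_derivative_works[symmetric] by (auto simp: periodic_fun_dom_def)
  have ac: "ac_on 0 (2*pi) g" "ac_on 0 (2*pi) g1" and per: "g 0 = g (2*pi)" "g1 0 = g1 (2*pi)"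
    using g by (auto simp: periodic_fun_dom_def g1_def)
  define N where "N = {x \<in> period. \<not> g1 differentiable (at x within period)}"
  have N: "negligible N"
    using g unfolding N_def AE_leb_period_negligible[symmetric] by (auto simp: periodic_fun_dom_def g1_def)
  have dg1: "(g1 has_vector_derivative g2 x) (at x within period)" if "x \<in> period - N" for x
    using that unfolding g2_def vector_derivative_works[symmetric] by (auto simp: N_def)
  define q where "q = \<i> * complex_of_int p"
  define \<Phi> where "\<Phi> x = (g1 x + q * g x) * expi (- p) x" for x
  define \<phi> where "\<phi> x = (g2 x + (of_int p)\<^sup>2 * g x) * expi (- p) x" for x
  have acm: "ac_on 0 (2*pi) (\<lambda>x. g1 x + q * g x)"
  proof (rule ac_on_bounded_combination[OF ac(2) _ _ ac(1), where M = 1 and M' = "cmod q"])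
    fix x y
    have "g1 y + q * g y - (g1 x + q * g x) = (g1 y - g1 x) + q * (g y - g x)" by (simp add: algebra_simps)
    then show "cmod (g1 y + q * g y - (g1 x + q * g x)) \<le> 1 * cmod (g1 y - g1 x) + cmod q * cmod (g y - g x)"
      by (metis mult_1 norm_mult norm_triangle_ineq)
  qed auto
  have ace: "ac_on 0 (2*pi) (expi (- p))"
  proof (rule ac_on_lipschitz)
    fix x y assume "x \<in> {0..2*pi}" "y \<in> {0..2*pi}"
    have "norm (expi (- p) y - expi (- p) x) \<le> \<bar>of_int p\<bar> * norm (y - x)"
      by (rule has_vector_derivative_bound[of UNIV "expi (- p)" "\<lambda>x. \<i> * of_int (- p) * expi (- p) x"])
         (use has_vector_derivative_expi[of "- p"] in \<open>auto simp: norm_mult\<close>)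
    then show "cmod (expi (- p) y - expi (- p) x) \<le> \<bar>of_int p\<bar> * \<bar>y - x\<bar>" by simp
  qed
  obtain M where M: "\<And>x. x \<in> period \<Longrightarrow> cmod (g1 x + q * g x) \<le> M"
    using compact_imp_bounded[OF compact_continuous_image[OF ac_on_continuous[OF acm] compact_Icc]]
    unfolding bounded_iff by blast
  have M0: "M \<ge> 0" using M[of 0] norm_ge_zero order_trans by (metis atLeastAtMost_iff order_refl pi_ge_zero mult_nonneg_nonneg zero_le_numeral)
  have ac\<Phi>: "ac_on 0 (2*pi) \<Phi>"
  proof (rule ac_on_bounded_combination[OF acm _ M0 ace, where M = 1])
    fix x y assume x: "x \<in> period" and "y \<in> period"
    have "\<Phi> y - \<Phi> x = ((g1 y + q * g y) - (g1 x + q * g x)) * expi (- p) y + (g1 x + q * g x) * (expi (- p) y - expi (- p) x)"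
      by (simp add: \<Phi>_def algebra_simps)
    also have "cmod \<dots> \<le> cmod ((g1 y + q * g y) - (g1 x + q * g x)) + cmod (g1 x + q * g x) * cmod (expi (- p) y - expi (- p) x)"
      by (rule order_trans[OF norm_triangle_ineq]) (simp add: norm_mult)
    also have "\<dots> \<le> 1 * cmod ((g1 y + q * g y) - (g1 x + q * g x)) + M * cmod (expi (- p) y - expi (- p) x)"
      using M[OF x] by (simp add: mult_right_mono)
    finally show "cmod (\<Phi> y - \<Phi> x) \<le> 1 * cmod ((g1 y + q * g y) - (g1 x + q * g x)) + M * cmod (expi (- p) y - expi (- p) x)" .
  qed auto
  have "(\<phi> has_integral (\<Phi> (2*pi) - \<Phi> 0)) {0..2*pi}"
  proof (rule ac_on_fundamental_theorem[OF ac\<Phi> _ N])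
    fix x assume x: "x \<in> period - N"
    have "((\<lambda>x. (g1 x + q * g x) * expi (- p) x) has_vector_derivative
        (g1 x + q * g x) * (\<i> * of_int (- p) * expi (- p) x) + (g2 x + q * g1 x) * expi (- p) x) (at x within period)"
      using x by (intro derivative_intros has_vector_derivative_mult has_vector_derivative_expi dg dg1 has_vector_derivative_add has_vector_derivative_mult_right) auto
    moreover have "(g1 x + q * g x) * (\<i> * of_int (- p) * expi (- p) x) + (g2 x + q * g1 x) * expi (- p) x = \<phi> x"
      by (simp add: \<phi>_def q_def algebra_simps power2_eq_square)
    ultimately show "(\<Phi> has_vector_derivative \<phi> x) (at x within period)"
      unfolding \<Phi>_def[abs_def] by simp
  qed auto
  moreover have "\<Phi> (2*pi) = \<Phi> 0" using per by (simp add: \<Phi>_def)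
  ultimately have "integral period \<phi> = 0" by (simp add: integral_unique)
  moreover have "fc p (L2_class g2 + (of_int p)\<^sup>2 *\<^sub>C L2_class g) = integral period \<phi> / (2 * pi)"
    unfolding \<phi>_def[abs_def] using sq
    by (subst fc_integral[symmetric]) (auto simp: L2_class_add L2_class_scale square_integrable_scale square_integrable_add)
  ultimately show ?thesis
    by (simp add: fc_add fc_scaleC g2_def g1_def eq_neg_iff_add_eq_0)
qed

text \<open>Integrate twice. The vanishing mean of \<open>g\<close> makes the first integral periodic, and the constants
  of integration are used up by the periodicity of \<open>W\<close> and by the prescribed mean of \<open>W\<close>.\<close>

lemma periodic_antiderivative:
  assumes g: "square_integrable g" and g0: "fc 0 (L2_class g) = 0"
  obtains W where "W \<in> periodic_fun_dom" "fc 0 (L2_class W) = c"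
    "AE x in leb_period. derivative_on period (derivative_on period W) x = g x"
proof -
  have gi: "integrable leb_period g" by (rule square_integrable_imp_integrable[OF g])
  have gint: "g integrable_on period" using gi by (simp add: integrable_on_lebesgue_on)
  have gabs: "g absolutely_integrable_on period"
    using gi by (simp add: integrable_restrict_space set_integrable_def)
  have g2: "(\<lambda>x. (cmod (g x))\<^sup>2) integrable_on period"
    using g by (intro integrable_on_lebesgue_on) (auto simp: square_integrable_def)
  define G where "G x = integral {0..x} g" for x
  have acG: "ac_on 0 (2*pi) G" unfolding G_def by (rule ac_on_indefinite_integral[OF gabs g2])
  have G0: "G 0 = 0" "G (2*pi) = 0"
    using g0 by (simp_all add: G_def fc_integral[OF g])
  have Gd: "negligible {x\<in>period. \<not> (G has_vector_derivative g x) (at x within period)}"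
    unfolding G_def by (rule lebesgue_differentiation[OF gint])
  \<comment> \<open>The constant that gives \<open>G + k\<close> mean zero, so that its integral is periodic.\<close>
  define k where "k = - integral period G / (2 * pi)"
  define V where "V x = integral {0..x} (\<lambda>t. G t + k)" for x
  have cG: "continuous_on period (\<lambda>t. G t + k)"
    by (intro continuous_intros ac_on_continuous[OF acG])
  have dV: "(V has_vector_derivative G x + k) (at x within period)" if "x \<in> period" for x
    unfolding V_def using integral_has_vector_derivative[OF cG that] .
  have cV: "continuous_on period V"
    using dV by (meson continuous_on_eq_continuous_within has_vector_derivative_continuous)
  have V2: "V (2*pi) = 0"
  proof -
    have "integral period (\<lambda>t. G t + k) = integral period G + k * (2*pi)"
      using ac_on_continuous[OF acG] by (subst Henstock_Kurzweil_Integration.integral_add)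
        (auto intro!: integrable_continuous_real simp: scaleR_conv_of_real mult.commute)
    then show ?thesis by (simp add: V_def k_def)
  qed
  define c' where "c' = c - fc 0 (L2_class V)"
  define W where "W x = V x + c'" for x
  have dW: "(W has_vector_derivative G x + k) (at x within period)" if "x \<in> period" for x
    unfolding W_def[abs_def] by (rule has_vector_derivative_eq_rhs[OF has_vector_derivative_add[OF dV[OF that] has_vector_derivative_const]]) simp
  have W1: "derivative_on period W x = G x + k" if "x \<in> period" for x
    by (rule vector_derivative_period[OF that dW[OF that]])
  have W2h: "(derivative_on period W has_vector_derivative g x) (at x within period)"
    if "x \<in> period" "(G has_vector_derivative g x) (at x within period)" for x
  proof -
    have "((\<lambda>x. G x + k) has_vector_derivative g x) (at x within period)"
      by (rule has_vector_derivative_eq_rhs[OF has_vector_derivative_add[OF that(2) has_vector_derivative_const]]) simp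
    then show ?thesis
      by (subst has_vector_derivative_cong_period[OF that(1) W1]) auto
  qed
  have aeG: "AE x in leb_period. (G has_vector_derivative g x) (at x within period)"
    using Gd by (simp add: AE_leb_period_negligible)
  have ae2: "AE x in leb_period. x \<in> period \<and> (G has_vector_derivative g x) (at x within period)"
    using aeG AE_space[of leb_period] by eventually_elim auto
  have aed: "AE x in leb_period. derivative_on period (derivative_on period W) x = g x"
    using ae2 by eventually_elim (metis W2h vector_derivative_period)
  have cW: "continuous_on period W" unfolding W_def by (intro continuous_intros cV)
  have sW: "square_integrable W" by (rule continuous_square_integrable[OF cW])
  have s2: "square_integrable (derivative_on period (derivative_on period W))"
    by (rule square_integrable_AE[OF g]) (use aed in eventually_elim, simp)
  obtain L where L: "\<And>x. x \<in> period \<Longrightarrow> cmod (G x + k) \<le> L"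
    using compact_imp_bounded[OF compact_continuous_image[OF cG compact_Icc]]
    unfolding bounded_iff by blast
  have acW: "ac_on 0 (2*pi) W"
  proof (rule ac_on_lipschitz)
    fix x y assume "x \<in> {0..2*pi}" "y \<in> {0..2*pi}"
    then have "norm (W y - W x) \<le> L * norm (y - x)"
      by (intro has_vector_derivative_bound[of period W "\<lambda>x. G x + k"]) (auto intro!: dW L)
    then show "cmod (W y - W x) \<le> L * \<bar>y - x\<bar>" by simp
  qed
  have acW1: "ac_on 0 (2*pi) (derivative_on period W)"
    by (rule ac_on_bounded_combination[OF acG _ _ acG, where M = 1 and M' = 0]) (auto simp: W1)
  have "W \<in> periodic_fun_dom"
    unfolding periodic_fun_dom_def mem_Collect_eq
  proof (intro conjI ballI)
    show "W differentiable at x within period" if "x \<in> period" for x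
      using dW[OF that] by (rule differentiableI_vector)
    show "W 0 = W (2*pi)" by (simp add: W_def V2) (simp add: V_def)
    show "derivative_on period W 0 = derivative_on period W (2*pi)" using G0 by (simp add: W1)
    show "AE x in leb_period. derivative_on period W differentiable at x within period"
      using ae2 by eventually_elim (use W2h differentiableI_vector in blast)
  qed (fact sW acW acW1 s2)+
  moreover have "fc 0 (L2_class W) = c"
  proof -
    have "L2_class W = L2_class V + c' *\<^sub>C fourier_basis 0"
      using continuous_square_integrable[OF cV] square_integrable_expi[of 0]
      by (simp add: W_def[abs_def] fourier_basis_def L2_class_add L2_class_scale square_integrable_scale square_integrable_const)
    then show ?thesis by (simp add: fc_add fc_scaleC fc_fourier_basis c'_def)
  qed
  ultimately show thesis using that aed by blast
qed

text \<open>Let \<open>W\<close> be the periodic function of mean zero with \<open>W'' = u\<close>. Its coefficients vanish too, and \<open>W\<close> is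
  differentiable, so it vanishes at every interior point, and with it \<open>W''\<close>.\<close>

theorem fourier_completeness:
  assumes "\<And>p. fc p u = 0"
  shows "u = 0"
proof -
  obtain f where f: "square_integrable f" "u = L2_class f" by (rule L2_cases)
  obtain W where W: "W \<in> periodic_fun_dom" "fc 0 (L2_class W) = 0"
    and W2: "AE x in leb_period. derivative_on period (derivative_on period W) x = f x"
    using periodic_antiderivative[OF f(1), of 0] assms f(2) by blast
  have eq: "L2_class (derivative_on period (derivative_on period W)) = u"
    using W W2 f by (subst f(2), subst L2_class_eq_iff) (auto simp: periodic_fun_dom_def)
  have zero: "fc p (L2_class W) = 0" for p
    using periodic_fun_dom_fc[OF W(1), of p] W(2) assms[of p] unfolding eq by (cases "p = 0") auto
  have W0: "W x = 0" if "0 < x" "x < 2*pi" for x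
  proof -
    have "W differentiable (at x within period)" using W(1) that by (auto simp: periodic_fun_dom_def)
    then show ?thesis
      using W(1) that zero
      by (intro fourier_uniqueness_at_differentiable_point[of W x "derivative_on period W x"])
         (auto simp: periodic_fun_dom_def vector_derivative_works intro: ac_on_continuous)
  qed
  have loc: "derivative_on period h x = 0" if h: "\<And>x. 0 < x \<Longrightarrow> x < 2*pi \<Longrightarrow> h x = 0" and x: "0 < x" "x < 2*pi" for h x
  proof (rule vector_derivative_period)
    show "(h has_vector_derivative 0) (at x within period)"
    proof (rule has_vector_derivative_transform_within[of "\<lambda>_. 0"])
      show "((\<lambda>_. 0) has_vector_derivative 0) (at x within period)" by (rule has_vector_derivative_const)
      show "0 < min x (2*pi - x)" using x by simp
      fix y assume "y \<in> period" "dist y x < min x (2*pi - x)"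
      then show "0 = h y" using h[of y] by (auto simp: dist_real_def abs_if split: if_splits)
    qed (use x in auto)
  qed (use x in auto)
  have "AE x in leb_period. f x = 0"
  proof -
    have "negligible {0, 2*pi}" by simp
    then have "AE x in leb_period. x \<notin> {0, 2*pi}"
      unfolding AE_leb_period_negligible by (rule negligible_subset) auto
    then show ?thesis using W2 AE_space[of leb_period]
    proof eventually_elim
      case (elim x)
      then have x: "0 < x" "x < 2*pi" by auto
      have "derivative_on period (derivative_on period W) x = 0"
        by (rule loc[OF loc[OF W0]]) (assumption | rule x)+
      then show ?case using elim by simp
    qed
  qed
  then show ?thesis
    using L2_class_eq_iff[OF f(1) square_integrable_zero] f(2) by (simp add: L2_class_zero)
qed

corollary fourier_ext: "(\<And>p. fc p u = fc p v) \<Longrightarrow> u = v"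
  using fourier_completeness[of "u - v"] by (simp add: fc_diff)

lemma fc_tau:
  assumes g: "g \<in> periodic_fun_dom"
  shows "fc p (L2_class (tau \<alpha> period g)) = (of_int p)\<^sup>2 * fc p (L2_class g) + \<alpha>\<^sup>2 * fc (p - 1) (L2_class g)"
proof -
  have sq: "square_integrable g" "square_integrable (derivative_on period (derivative_on period g))"
    using g by (auto simp: periodic_fun_dom_def)
  have "tau \<alpha> period g = (\<lambda>x. \<alpha>\<^sup>2 * (expi 1 x * g x) - derivative_on period (derivative_on period g) x)"
    by (auto simp: tau_def expi_def)
  then have "L2_class (tau \<alpha> period g) = \<alpha>\<^sup>2 *\<^sub>C L2_class (\<lambda>x. expi 1 x * g x) - L2_class (derivative_on period (derivative_on period g))"
    using sq by (simp add: L2_class_diff L2_class_scale square_integrable_scale square_integrable_expi_mult)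
  then show ?thesis
    using sq by (simp add: fc_diff fc_scaleC fc_expi_mult periodic_fun_dom_fc[OF g])
qed

text \<open>Membership in the graph, including all regularity and boundary conditions, is a recursion between
  Fourier coefficients. For the converse direction the function \<open>\<alpha>\<^sup>2 exp(ix) u - v\<close> has mean zero, and
  its periodic second antiderivative with the mean of \<open>u\<close> has the same coefficients as \<open>u\<close>.\<close>

theorem Hp_iff_fourier:
  "(u, v) \<in> Hp \<alpha> \<longleftrightarrow> (\<forall>p. fc p v = (of_int p)\<^sup>2 * fc p u + \<alpha>\<^sup>2 * fc (p - 1) u)"
proof
  assume "(u, v) \<in> Hp \<alpha>"
  then show "\<forall>p. fc p v = (of_int p)\<^sup>2 * fc p u + \<alpha>\<^sup>2 * fc (p - 1) u"
    by (auto simp: Hp_def fc_tau)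
next
  assume *: "\<forall>p. fc p v = (of_int p)\<^sup>2 * fc p u + \<alpha>\<^sup>2 * fc (p - 1) u"
  obtain f where f: "square_integrable f" "u = L2_class f" by (rule L2_cases)
  obtain k where k: "square_integrable k" "v = L2_class k" by (rule L2_cases)
  define g where "g x = \<alpha>\<^sup>2 * (expi 1 x * f x) - k x" for x
  have g: "square_integrable g" "L2_class g = \<alpha>\<^sup>2 *\<^sub>C L2_class (\<lambda>x. expi 1 x * f x) - v"
    unfolding g_def[abs_def] using f k
    by (simp_all add: L2_class_diff L2_class_scale square_integrable_diff square_integrable_scale square_integrable_expi_mult)
  have fcg: "fc p (L2_class g) = - (of_int p)\<^sup>2 * fc p u" for p
    using *[rule_format, of p] f by (simp add: g(2) fc_diff fc_scaleC fc_expi_mult)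
  obtain W where W: "W \<in> periodic_fun_dom" "fc 0 (L2_class W) = fc 0 u"
    and W2: "AE x in leb_period. derivative_on period (derivative_on period W) x = g x"
    using periodic_antiderivative[OF g(1), of "fc 0 u"] fcg[of 0] by auto
  have sW: "square_integrable W" "square_integrable (derivative_on period (derivative_on period W))"
    using W(1) by (auto simp: periodic_fun_dom_def)
  have "L2_class (derivative_on period (derivative_on period W)) = L2_class g"
    using W2 g sW by (subst L2_class_eq_iff) auto
  then have "fc p (L2_class W) = fc p u" for p
    using periodic_fun_dom_fc[OF W(1), of p] W(2) fcg[of p] by (cases "p = 0") auto
  then have uW: "u = L2_class W" using fourier_ext by metis
  then have "AE x in leb_period. W x = f x"
    using L2_class_eq_iff[OF sW(1) f(1)] f by simp
  with W2 have "AE x in leb_period. tau \<alpha> period W x = k x"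
    by eventually_elim (simp add: tau_def g_def expi_def)
  then have "v = L2_class (tau \<alpha> period W)"
    using L2_class_eq_iff[OF square_integrable_tau[OF W(1)] k(1), of \<alpha>] k(2) by simp
  then show "(u, v) \<in> Hp \<alpha>" using uW W(1) by (auto simp: Hp_def)
qed

section \<open>The resolvent\<close>

lemma op_minus_Hp_iff:
  "(u, v) \<in> op_minus (Hp \<alpha>) l \<longleftrightarrow> (\<forall>p. fc p v = ((of_int p)\<^sup>2 - l) * fc p u + \<alpha>\<^sup>2 * fc (p - 1) u)"
proof -
  have "(u, v) \<in> op_minus (Hp \<alpha>) l \<longleftrightarrow> (u, v + l *\<^sub>C u) \<in> Hp \<alpha>"
    unfolding op_minus_def by (force simp: algebra_simps)
  also have "\<dots> \<longleftrightarrow> (\<forall>p. fc p v = ((of_int p)\<^sup>2 - l) * fc p u + \<alpha>\<^sup>2 * fc (p - 1) u)"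
    unfolding Hp_iff_fourier by (intro all_cong1) (auto simp: fc_add fc_scaleC algebra_simps)
  finally show ?thesis .
qed

lemma op_ker_op_minus_Hp_iff:
  "u \<in> op_ker (op_minus (Hp \<alpha>) l) \<longleftrightarrow> (\<forall>p. ((of_int p)\<^sup>2 - l) * fc p u + \<alpha>\<^sup>2 * fc (p - 1) u = 0)"
  by (auto simp: op_ker_def op_minus_Hp_iff)

lemma op_minus_shift:
  "(u, v) \<in> op_minus A l \<Longrightarrow> (u, v + (l - z) *\<^sub>C u) \<in> op_minus A z"
  unfolding op_minus_def by (auto simp: cvec.scale_left_diff_distrib)

lemma op_minus_Hp_scaleC:
  "(u, v) \<in> op_minus (Hp \<alpha>) l \<Longrightarrow> (c *\<^sub>C u, c *\<^sub>C v) \<in> op_minus (Hp \<alpha>) l"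
  by (simp add: op_minus_Hp_iff fc_scaleC distrib_left mult.left_commute)

lemma is_resolvent_iff: "is_resolvent A l R \<longleftrightarrow> (\<forall>u v. (u, v) \<in> op_minus A l \<longleftrightarrow> u = R v)"
  unfolding is_resolvent_def by (auto simp: set_eq_iff)

lemma is_resolvent_resolvent:
  assumes "l \<notin> spectrum A" shows "is_resolvent A l (resolvent A l)"
proof -
  obtain R where R: "is_resolvent A l R" using assms by (auto simp: spectrum_def)
  have "R' = R" if "is_resolvent A l R'" for R'
    using R that by (intro blinfun_eqI) (metis is_resolvent_iff)
  then show ?thesis unfolding resolvent_def using R by (metis theI)
qed

lemma resolvent_eq_iff:
  "l \<notin> spectrum A \<Longrightarrow> resolvent A l v = u \<longleftrightarrow> (u, v) \<in> op_minus A l"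
  using is_resolvent_resolvent[of l A] by (auto simp: is_resolvent_iff)

lemma resolvent_scaleC:
  assumes "l \<notin> spectrum (Hp \<alpha>)"
  shows "resolvent (Hp \<alpha>) l (c *\<^sub>C v) = c *\<^sub>C resolvent (Hp \<alpha>) l v"
  using resolvent_eq_iff[OF assms] op_minus_Hp_scaleC by metis

lemma resolvent_identity:
  assumes z: "z \<notin> spectrum (Hp \<alpha>)" and w: "w \<notin> spectrum (Hp \<alpha>)"
  shows "resolvent (Hp \<alpha>) z v - resolvent (Hp \<alpha>) w v
    = (z - w) *\<^sub>C resolvent (Hp \<alpha>) z (resolvent (Hp \<alpha>) w v)"
proof -
  let ?u = "resolvent (Hp \<alpha>) w v"
  have "(?u, v) \<in> op_minus (Hp \<alpha>) w" using resolvent_eq_iff[OF w] by blast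
  then have "(?u, v + (w - z) *\<^sub>C ?u) \<in> op_minus (Hp \<alpha>) z" by (rule op_minus_shift)
  then have "resolvent (Hp \<alpha>) z (v + (w - z) *\<^sub>C ?u) = ?u" using resolvent_eq_iff[OF z] by blast
  then have "resolvent (Hp \<alpha>) z v + (w - z) *\<^sub>C resolvent (Hp \<alpha>) z ?u = ?u"
    by (simp add: blinfun.add_right resolvent_scaleC[OF z])
  moreover have "(z - w) *\<^sub>C resolvent (Hp \<alpha>) z ?u = - ((w - z) *\<^sub>C resolvent (Hp \<alpha>) z ?u)"
    by (simp flip: cvec.scale_minus_left)
  moreover from calculation have "resolvent (Hp \<alpha>) z v = ?u - (w - z) *\<^sub>C resolvent (Hp \<alpha>) z ?u"
    by (simp add: eq_diff_eq)
  ultimately show ?thesis by simp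
qed

text \<open>From the resolvent identity, \<open>norm (R w) \<le> norm (R z) + \<bar>w - z\<bar> norm (R z) norm (R w)\<close>, so
  that \<open>R w\<close> is bounded by twice the norm of \<open>R z\<close> for \<open>w\<close> near \<open>z\<close>; the identity then gives a
  Lipschitz estimate.\<close>

lemma continuous_on_resolvent:
  "continuous_on (- spectrum (Hp \<alpha>)) (resolvent (Hp \<alpha>))"
  unfolding continuous_on_iff
proof (intro ballI allI impI)
  fix z and e :: real assume z: "z \<in> - spectrum (Hp \<alpha>)" and e: "e > 0"
  let ?R = "resolvent (Hp \<alpha>)"
  define N where "N = norm (?R z) + 1"
  have N: "N > 0" "norm (?R z) \<le> N" by (auto simp: N_def add_nonneg_pos)
  have diff: "norm (?R w - ?R z) \<le> cmod (w - z) * N * norm (?R w)" if w: "w \<in> - spectrum (Hp \<alpha>)" for w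
  proof (rule norm_blinfun_bound)
    fix v
    have "norm (blinfun_apply (?R w - ?R z) v) = norm (?R z v - ?R w v)"
      by (simp add: blinfun.diff_left norm_minus_commute)
    also have "\<dots> = cmod (z - w) * norm (?R z (?R w v))"
      using z w by (simp add: resolvent_identity norm_scaleC)
    also have "\<dots> \<le> cmod (z - w) * (norm (?R z) * (norm (?R w) * norm v))"
      by (intro mult_left_mono order_trans[OF norm_blinfun] norm_blinfun) auto
    also have "\<dots> \<le> cmod (z - w) * (N * (norm (?R w) * norm v))"
      using N by (intro mult_left_mono mult_right_mono) auto
    finally show "norm (blinfun_apply (?R w - ?R z) v) \<le> cmod (w - z) * N * norm (?R w) * norm v"
      by (simp add: norm_minus_commute mult.assoc)
  qed (use N in auto)
  show "\<exists>d>0. \<forall>w\<in>- spectrum (Hp \<alpha>). dist w z < d \<longrightarrow> dist (?R w) (?R z) < e"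
  proof (intro exI[of _ "min (1 / (2 * N)) (e / (2 * N * N))"] conjI ballI impI)
    show "0 < min (1 / (2 * N)) (e / (2 * N * N))" using N e by simp
    fix w assume w: "w \<in> - spectrum (Hp \<alpha>)" and d: "dist w z < min (1 / (2 * N)) (e / (2 * N * N))"
    then have d1: "cmod (w - z) * N \<le> 1 / 2" and d2: "cmod (w - z) * N * (2 * N) < e"
      using N by (auto simp: dist_norm field_simps)
    have "norm (?R w) \<le> norm (?R z) + norm (?R w - ?R z)"
      using norm_triangle_sub by blast
    also have "\<dots> \<le> N + 1 / 2 * norm (?R w)"
      using N(2) order_trans[OF diff[OF w] mult_right_mono[OF d1 norm_ge_zero]] by linarith
    finally have "norm (?R w) \<le> 2 * N" by simp
    then have "cmod (w - z) * N * norm (?R w) \<le> cmod (w - z) * N * (2 * N)"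
      using N by (intro mult_left_mono) auto
    then show "dist (?R w) (?R z) < e"
      using diff[OF w] d2 by (simp add: dist_norm)
  qed
qed

lemma int_square_minus_large:
  obtains N :: nat where "\<And>p. \<bar>p\<bar> \<ge> int N \<Longrightarrow> cmod ((of_int p)\<^sup>2 - z) \<ge> b"
proof -
  obtain N :: nat where N: "real N \<ge> max 1 (b + cmod z)" using real_arch_simple by blast
  have "cmod ((of_int p)\<^sup>2 - z) \<ge> b" if "\<bar>p\<bar> \<ge> int N" for p
  proof -
    have "1 \<le> real N" "real N \<le> \<bar>real_of_int p\<bar>" using that N by auto
    then have "real N * 1 \<le> \<bar>real_of_int p\<bar> * \<bar>real_of_int p\<bar>" by (intro mult_mono) auto
    moreover have "cmod ((of_int p)\<^sup>2) = (real_of_int p)\<^sup>2" by (simp add: norm_power)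
    ultimately have "real N \<le> cmod ((of_int p)\<^sup>2)" by (simp add: power2_eq_square)
    then show ?thesis using N norm_triangle_ineq2[of "(of_int p)\<^sup>2" z] by simp
  qed
  then show thesis using that by blast
qed

text \<open>Read downwards for \<open>\<beta> \<noteq> 0\<close>, the recursion multiplies \<open>w p\<close> by \<open>(z - p\<^sup>2) / \<beta>\<close>, whose modulus is at least
  \<open>2\<close> for \<open>p\<close> near minus infinity. A bounded solution therefore vanishes there, and it stays zero upwards as long as
  the diagonal entry \<open>p\<^sup>2 - z\<close> does not vanish.\<close>

lemma fourier_recursion_zero_below:
  fixes w :: "int \<Rightarrow> complex"
  assumes bdd: "\<And>p. cmod (w p) \<le> B"
    and rec: "\<And>p. p \<le> q \<Longrightarrow> ((of_int p)\<^sup>2 - z) * w p + \<beta> * w (p - 1) = 0"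
    and ne: "\<And>p. p \<le> q \<Longrightarrow> (of_int p)\<^sup>2 \<noteq> z"
  shows "p \<le> q \<Longrightarrow> w p = 0"
proof -
  obtain N :: nat where N: "\<And>p. \<bar>p\<bar> \<ge> int N \<Longrightarrow> cmod ((of_int p)\<^sup>2 - z) \<ge> 2 * cmod \<beta>"
    using int_square_minus_large[where b = "2 * cmod \<beta>" and z = z] by blast
  define p1 where "p1 = min q (- int N)"
  have big: "cmod ((of_int p)\<^sup>2 - z) \<ge> 2 * cmod \<beta>" if "p \<le> p1" for p
    using that by (intro N) (auto simp: p1_def)
  have low: "w p = 0" if p: "p \<le> p1" for p
  proof (cases "\<beta> = 0")
    case True
    then show ?thesis using rec[of p] ne[of p] p by (auto simp: p1_def)
  next
    case False
    have step: "2 * cmod (w r) \<le> cmod (w (r - 1))" if "r \<le> p1" for r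
    proof -
      have "((of_int r)\<^sup>2 - z) * w r = - (\<beta> * w (r - 1))"
        using rec[of r] that by (simp add: p1_def eq_neg_iff_add_eq_0)
      then have "cmod ((of_int r)\<^sup>2 - z) * cmod (w r) = cmod \<beta> * cmod (w (r - 1))"
        by (metis norm_minus_cancel norm_mult)
      moreover have "2 * cmod \<beta> * cmod (w r) \<le> cmod ((of_int r)\<^sup>2 - z) * cmod (w r)"
        by (intro mult_right_mono big that) auto
      ultimately have "cmod \<beta> * (2 * cmod (w r)) \<le> cmod \<beta> * cmod (w (r - 1))" by simp
      then show ?thesis using False by (subst (asm) mult_le_cancel_left_pos) auto
    qed
    have grow: "2 ^ n * cmod (w p) \<le> cmod (w (p - int n))" for n
    proof (induction n)
      case (Suc n)
      have "2 * cmod (w (p - int n)) \<le> cmod (w (p - int n - 1))" using p by (intro step) simp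
      then show ?case using Suc by (simp add: algebra_simps)
    qed simp
    show ?thesis
    proof (rule ccontr)
      assume "w p \<noteq> 0"
      then have pos: "cmod (w p) > 0" by simp
      obtain n where "B / cmod (w p) < 2 ^ n" using real_arch_pow[of 2 "B / cmod (w p)"] by auto
      then have "B < 2 ^ n * cmod (w p)" using pos by (simp add: pos_divide_less_eq)
      then show False using grow[of n] bdd[of "p - int n"] by linarith
    qed
  qed
  have "r \<le> q \<longrightarrow> w r = 0" if "r \<ge> p1" for r
    using that
  proof (induction r rule: int_ge_induct)
    case base then show ?case using low by simp
  next
    case (step r)
    then show ?case using rec[of "r + 1"] ne[of "r + 1"] by auto
  qed
  then show "p \<le> q \<Longrightarrow> w p = 0" using low[of p] by (cases "p \<ge> p1") auto
qed

definition squares :: "complex set" where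
  "squares = range (\<lambda>m::nat. (of_nat m)\<^sup>2)"

lemma int_square_in_squares: "(of_int p)\<^sup>2 \<in> squares"
proof -
  have "(complex_of_int p)\<^sup>2 = (of_nat (nat \<bar>p\<bar>))\<^sup>2"
    by (cases "p \<ge> 0") auto
  then show ?thesis unfolding squares_def by (rule image_eqI) simp
qed

lemma Hp_minus_injective:
  assumes z: "z \<notin> squares" and u: "(u, 0) \<in> op_minus (Hp \<alpha>) z"
  shows "u = 0"
proof (rule fourier_completeness)
  fix p
  show "fc p u = 0"
    by (rule fourier_recursion_zero_below[of "\<lambda>p. fc p u" "norm u" p z "\<alpha>\<^sup>2"])
       (use u z int_square_in_squares in \<open>auto simp: norm_fc_le op_minus_Hp_iff\<close>)
qed

text \<open>Entry \<open>(n + k, n)\<close> of the inverse of the lower triangular matrix with diagonal \<open>p\<^sup>2 - z\<close> and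
  subdiagonal \<open>\<alpha>\<^sup>2\<close>.\<close>

definition column_coeff :: "complex \<Rightarrow> complex \<Rightarrow> int \<Rightarrow> nat \<Rightarrow> complex" where
  "column_coeff \<alpha> z n k = (- \<alpha>\<^sup>2) ^ k / (\<Prod>j\<le>k. ((of_int (n + int j))\<^sup>2 - z))"

lemma column_coeff_rec:
  assumes "z \<notin> squares"
  shows "((of_int n)\<^sup>2 - z) * column_coeff \<alpha> z n 0 = 1"
    "((of_int (n + int (Suc k)))\<^sup>2 - z) * column_coeff \<alpha> z n (Suc k) = - \<alpha>\<^sup>2 * column_coeff \<alpha> z n k"
proof -
  have ne: "(of_int p)\<^sup>2 - z \<noteq> 0" for p using assms int_square_in_squares[of p] by auto
  show "((of_int n)\<^sup>2 - z) * column_coeff \<alpha> z n 0 = 1"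
    using ne[of n] by (simp add: column_coeff_def)
  have "(\<Prod>j\<le>k. ((of_int (n + int j))\<^sup>2 - z)) \<noteq> 0" using ne by (simp del: of_int_add)
  then show "((of_int (n + int (Suc k)))\<^sup>2 - z) * column_coeff \<alpha> z n (Suc k) = - \<alpha>\<^sup>2 * column_coeff \<alpha> z n k"
    using ne[of "n + int (Suc k)"] by (simp add: column_coeff_def prod.atMost_Suc del: of_int_add of_nat_Suc)
qed

lemma summable_on_inverse_square_int: "(\<lambda>p::int. 1 / (1 + (real_of_int p)\<^sup>2)) summable_on UNIV"
proof -
  have "summable (\<lambda>n::nat. 1 / (1 + (real n)\<^sup>2))"
  proof (rule summable_comparison_test')
    show "summable (\<lambda>n. 2 * inverse (real (Suc n)) ^ 2)"
      using inverse_power_summable[of 2, where 'a = real] summable_Suc_iff[of "\<lambda>n. inverse (real n ^ 2)"]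
      by (intro summable_mult) (simp add: power_inverse)
    fix n :: nat
    have "(1 + real n)\<^sup>2 \<le> 2 * (1 + (real n)\<^sup>2)"
      using sum_squares_bound[of 1 "real n"] by (simp add: power2_sum)
    then show "norm (1 / (1 + (real n)\<^sup>2)) \<le> 2 * inverse (real (Suc n)) ^ 2"
      by (simp add: field_simps add_pos_nonneg power_inverse)
  qed
  then have s: "(\<lambda>n::nat. 1 / (1 + (real n)\<^sup>2)) summable_on UNIV"
    by (intro summable_nonneg_imp_summable_on) auto
  have 1: "(\<lambda>p::int. 1 / (1 + (real_of_int p)\<^sup>2)) summable_on range int"
    by (subst summable_on_reindex) (auto simp: o_def s)
  have 2: "(\<lambda>p::int. 1 / (1 + (real_of_int p)\<^sup>2)) summable_on range (\<lambda>n. - int n)"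
    by (subst summable_on_reindex) (auto simp: o_def s inj_on_def)
  have U: "(UNIV :: int set) = range int \<union> (range (\<lambda>n. - int n) - range int)"
    by (auto simp: image_iff) (metis int_cases2)
  show ?thesis
    by (subst U, intro summable_on_Un_disjoint 1 summable_on_subset_banach[OF 2]) auto
qed

lemma summable_on_inverse_shifted_square_int:
  assumes "z \<notin> squares"
  shows "(\<lambda>p::int. 1 / cmod ((of_int p)\<^sup>2 - z)) summable_on UNIV"
proof -
  define N :: nat where "N = nat \<lceil>2 * cmod z + 1\<rceil>"
  have N: "real N \<ge> 2 * cmod z + 1" unfolding N_def by linarith
  define F where "F = {- int N..int N}"
  have out: "1 / cmod ((of_int p)\<^sup>2 - z) \<le> 2 * (1 / (1 + (real_of_int p)\<^sup>2))" if "p \<notin> F" for p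
  proof -
    have "real N \<le> \<bar>real_of_int p\<bar>" using that by (auto simp: F_def)
    moreover have "real N \<ge> 1" using N norm_ge_zero[of z] by linarith
    ultimately have "real N * 1 \<le> \<bar>real_of_int p\<bar> * \<bar>real_of_int p\<bar>" by (intro mult_mono) auto
    then have "2 * cmod z + 1 \<le> (real_of_int p)\<^sup>2" using N by (simp add: power2_eq_square)
    moreover have "cmod ((of_int p)\<^sup>2) = (real_of_int p)\<^sup>2" by (simp add: norm_power)
    ultimately have "1 + (real_of_int p)\<^sup>2 \<le> 2 * cmod ((of_int p)\<^sup>2 - z)"
      using norm_triangle_ineq2[of "(of_int p)\<^sup>2" z] by linarith
    moreover have "0 < 1 + (real_of_int p)\<^sup>2" by (simp add: add_pos_nonneg)
    ultimately show ?thesis by (simp add: divide_simps)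
  qed
  have 1: "(\<lambda>p::int. 1 / cmod ((of_int p)\<^sup>2 - z)) summable_on (- F)"
    by (rule summable_on_comparison_test[OF summable_on_subset_banach[OF summable_on_cmult_right[OF summable_on_inverse_square_int, of 2]]])
       (use out in auto)
  have 2: "(\<lambda>p::int. 1 / cmod ((of_int p)\<^sup>2 - z)) summable_on F"
    by (rule summable_on_finite) (simp add: F_def)
  show ?thesis using summable_on_Un_disjoint[OF 1 2] by simp
qed


lemma norm_column_coeff:
  assumes "z \<notin> squares"
  shows "cmod (column_coeff \<alpha> z n k)
    = (\<Prod>j<k. (cmod \<alpha>)\<^sup>2 / cmod ((of_int (n + int (Suc j)))\<^sup>2 - z)) / cmod ((of_int n)\<^sup>2 - z)"
proof (induction k)
  case 0
  show ?case by (simp add: column_coeff_def norm_divide)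
next
  case (Suc k)
  have ne: "(of_int (n + int (Suc k)))\<^sup>2 - z \<noteq> 0" using assms int_square_in_squares[of "n + int (Suc k)"] by auto
  have "cmod ((of_int (n + int (Suc k)))\<^sup>2 - z) * cmod (column_coeff \<alpha> z n (Suc k)) = (cmod \<alpha>)\<^sup>2 * cmod (column_coeff \<alpha> z n k)"
    unfolding norm_mult[symmetric] column_coeff_rec(2)[OF assms] by (simp add: norm_mult norm_power)
  then have "cmod (column_coeff \<alpha> z n (Suc k)) = (cmod \<alpha>)\<^sup>2 / cmod ((of_int (n + int (Suc k)))\<^sup>2 - z) * cmod (column_coeff \<alpha> z n k)"
    using ne by (simp add: eq_divide_eq mult.commute del: of_int_add of_nat_Suc)
  then show ?case unfolding Suc by (simp del: of_int_add of_nat_Suc)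
qed

text \<open>Apart from finitely many integers \<open>p\<close> the factor \<open>\<bar>\<alpha>\<bar>\<^sup>2 / \<bar>p\<^sup>2 - z\<bar>\<close> is at most \<open>1/2\<close>. The indices \<open>n + j\<close>
  are distinct, so each exceptional factor occurs at most once, which bounds their product
  uniformly in \<open>n\<close>.\<close>

lemma column_coeff_bound:
  assumes z: "z \<notin> squares"
  obtains C where "C \<ge> 0" "\<And>n k. cmod (column_coeff \<alpha> z n k) \<le> C * (1 / 2) ^ k * (1 / cmod ((of_int n)\<^sup>2 - z))"
proof -
  define A where "A p = (cmod \<alpha>)\<^sup>2 / cmod ((of_int p)\<^sup>2 - z)" for p
  obtain N :: nat where N: "\<And>p. \<bar>p\<bar> \<ge> int N \<Longrightarrow> cmod ((of_int p)\<^sup>2 - z) \<ge> 2 * (cmod \<alpha>)\<^sup>2"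
    using int_square_minus_large[where b = "2 * (cmod \<alpha>)\<^sup>2" and z = z] by blast
  define F where "F = {- int N..int N}"
  have fF: "finite F" by (simp add: F_def)
  define K where "K = max 1 (2 * (\<Sum>p\<in>F. A p))"
  have K1: "K \<ge> 1" by (simp add: K_def)
  \<comment> \<open>With \<open>K\<close> at least twice every exceptional factor, \<open>A p \<le> D p / 2\<close> holds for all \<open>p\<close>.\<close>
  define D where "D p = (if p \<in> F then K else 1)" for p
  have A0: "A p \<ge> 0" for p by (simp add: A_def)
  have AD: "A p \<le> 1 / 2 * D p" for p
  proof (cases "p \<in> F")
    case True
    then have "A p \<le> (\<Sum>p\<in>F. A p)" using fF A0 by (intro member_le_sum) auto
    then show ?thesis using True by (simp add: D_def K_def)
  next
    case False
    then have le: "2 * (cmod \<alpha>)\<^sup>2 \<le> cmod ((of_int p)\<^sup>2 - z)" by (intro N) (auto simp: F_def)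
    moreover have "cmod ((of_int p)\<^sup>2 - z) > 0" using z int_square_in_squares[of p] by auto
    ultimately show ?thesis using False by (simp add: D_def A_def divide_le_eq)
  qed
  have bound: "(\<Prod>j<k. A (n + int (Suc j))) \<le> (1 / 2) ^ k * K ^ card F" for n k
  proof -
    have "(\<Prod>j<k. A (n + int (Suc j))) \<le> (\<Prod>j<k. 1 / 2 * D (n + int (Suc j)))"
      by (intro prod_mono conjI A0 AD)
    also have "\<dots> = (1 / 2) ^ k * (\<Prod>j<k. D (n + int (Suc j)))"
      by (simp add: prod.distrib prod_dividef power_one_over)
    also have "(\<Prod>j<k. D (n + int (Suc j))) = (\<Prod>p\<in>(\<lambda>j. n + int (Suc j)) ` {..<k}. D p)"
      by (subst prod.reindex) (auto simp: inj_on_def)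
    also have "\<dots> = (\<Prod>p\<in>((\<lambda>j. n + int (Suc j)) ` {..<k}) \<inter> F. K)"
      unfolding D_def by (rule prod.inter_restrict[symmetric]) simp
    also have "\<dots> = K ^ card (((\<lambda>j. n + int (Suc j)) ` {..<k}) \<inter> F)" by simp
    also have "\<dots> \<le> K ^ card F"
      using fF K1 by (intro power_increasing card_mono) auto
    finally show ?thesis by simp
  qed
  show thesis
  proof (rule that[of "K ^ card F"])
    show "K ^ card F \<ge> 0" using K1 by simp
    fix n k
    show "cmod (column_coeff \<alpha> z n k) \<le> K ^ card F * (1 / 2) ^ k * (1 / cmod ((of_int n)\<^sup>2 - z))"
      unfolding norm_column_coeff[OF z] A_def[symmetric]
      using divide_right_mono[OF bound[of n k] norm_ge_zero, of "(of_int n)\<^sup>2 - z"]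
      by (simp only: mult.commute[of "K ^ card F"] times_divide_eq_right mult_1_right)
  qed
qed

definition resolvent_column :: "complex \<Rightarrow> complex \<Rightarrow> int \<Rightarrow> L2" where
  "resolvent_column \<alpha> z n = (\<Sum>k. column_coeff \<alpha> z n k *\<^sub>C fourier_basis (n + int k))"

lemma resolvent_column_bound:
  assumes z: "z \<notin> squares"
  obtains C where "\<And>n. summable (\<lambda>k. norm (column_coeff \<alpha> z n k *\<^sub>C fourier_basis (n + int k)))"
    "\<And>n. norm (resolvent_column \<alpha> z n) \<le> C * (1 / cmod ((of_int n)\<^sup>2 - z))"
proof -
  obtain C where C: "C \<ge> 0" "\<And>n k. cmod (column_coeff \<alpha> z n k) \<le> C * (1 / 2) ^ k * (1 / cmod ((of_int n)\<^sup>2 - z))"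
    using column_coeff_bound[OF z, where \<alpha> = \<alpha>] by blast
  let ?b = "\<lambda>n k. (2 * pi * C * (1 / cmod ((of_int n)\<^sup>2 - z))) * (1 / 2) ^ k"
  have le: "norm (column_coeff \<alpha> z n k *\<^sub>C fourier_basis (n + int k)) \<le> ?b n k" for n k
  proof -
    have "norm (column_coeff \<alpha> z n k *\<^sub>C fourier_basis (n + int k))
        \<le> (C * (1 / 2) ^ k * (1 / cmod ((of_int n)\<^sup>2 - z))) * (2 * pi)"
      unfolding norm_scaleC by (intro mult_mono C(2) norm_fourier_basis_le mult_nonneg_nonneg C(1)) auto
    then show ?thesis by (simp add: ac_simps)
  qed
  have sb: "summable (?b n)" for n by (intro summable_mult summable_geometric) auto
  have 1: "summable (\<lambda>k. norm (column_coeff \<alpha> z n k *\<^sub>C fourier_basis (n + int k)))" for n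
    by (rule summable_comparison_test'[OF sb[of n]]) (use le in simp)
  have 2: "norm (resolvent_column \<alpha> z n) \<le> (4 * pi * C) * (1 / cmod ((of_int n)\<^sup>2 - z))" for n
  proof -
    have "norm (resolvent_column \<alpha> z n) \<le> (\<Sum>k. norm (column_coeff \<alpha> z n k *\<^sub>C fourier_basis (n + int k)))"
      unfolding resolvent_column_def by (rule summable_norm[OF 1])
    also have "\<dots> \<le> suminf (?b n)" by (rule suminf_le[OF le 1 sb])
    also have "\<dots> = (2 * pi * C * (1 / cmod ((of_int n)\<^sup>2 - z))) * 2"
      by (subst suminf_mult) (auto intro!: summable_geometric simp: suminf_geometric)
    finally show ?thesis by (simp add: ac_simps)
  qed
  from 1 2 show thesis by (rule that)
qed

lemma bounded_linear_scaleC_left: "bounded_linear (\<lambda>c. c *\<^sub>C (w::L2))"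
  by (rule bounded_linear_intro[of _ "norm w"])
     (auto simp: scaleC_add_left scaleR_eq_scaleC scaleC_scaleC norm_scaleC scaleR_conv_of_real)

lemma fc_resolvent_column:
  assumes z: "z \<notin> squares"
  shows "fc p (resolvent_column \<alpha> z n) = (if p \<ge> n then column_coeff \<alpha> z n (nat (p - n)) else 0)"
proof -
  have sm: "summable (\<lambda>k. norm (column_coeff \<alpha> z n k *\<^sub>C fourier_basis (n + int k)))"
    by (rule resolvent_column_bound[OF z, where \<alpha> = \<alpha>]) blast
  have 1: "(\<lambda>k. fc p (column_coeff \<alpha> z n k *\<^sub>C fourier_basis (n + int k))) sums fc p (resolvent_column \<alpha> z n)"
    unfolding resolvent_column_def
    by (rule bounded_linear.sums[OF bounded_linear_fc summable_sums[OF summable_norm_cancel[OF sm]]])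
  have 2: "fc p (column_coeff \<alpha> z n k *\<^sub>C fourier_basis (n + int k))
      = (if k = nat (p - n) then if p \<ge> n then column_coeff \<alpha> z n k else 0 else 0)" for k
    unfolding fc_scaleC fc_fourier_basis by auto
  show ?thesis
    using sums_unique2[OF 1[unfolded 2] sums_single[of "nat (p - n)" "\<lambda>k. if p \<ge> n then column_coeff \<alpha> z n k else 0"]]
    by simp
qed

lemma resolvent_column_eq:
  assumes z: "z \<notin> squares"
  shows "(resolvent_column \<alpha> z n, fourier_basis n) \<in> op_minus (Hp \<alpha>) z"
  unfolding op_minus_Hp_iff
proof
  fix p
  consider "p < n" | "p = n" | k where "p = n + int (Suc k)"
    by (metis zless_iff_Suc_zadd linorder_less_linear)
  then show "fc p (fourier_basis n) = ((of_int p)\<^sup>2 - z) * fc p (resolvent_column \<alpha> z n) + \<alpha>\<^sup>2 * fc (p - 1) (resolvent_column \<alpha> z n)"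
  proof cases
    case 1
    then show ?thesis by (simp add: fc_resolvent_column[OF z] fc_fourier_basis)
  next
    case 2
    then show ?thesis by (simp add: fc_resolvent_column[OF z] fc_fourier_basis column_coeff_rec(1)[OF z])
  next
    case 3
    then have nat: "nat (p - n) = Suc k" "nat (p - 1 - n) = k" and le: "n \<le> p" "n \<le> p - 1" "p \<noteq> n" by auto
    have a: "fc p (resolvent_column \<alpha> z n) = column_coeff \<alpha> z n (Suc k)"
      by (simp only: fc_resolvent_column[OF z] le nat if_True)
    have b: "fc (p - 1) (resolvent_column \<alpha> z n) = column_coeff \<alpha> z n k"
      by (simp only: fc_resolvent_column[OF z] le nat if_True)
    have c: "((of_int p)\<^sup>2 - z) * column_coeff \<alpha> z n (Suc k) = - \<alpha>\<^sup>2 * column_coeff \<alpha> z n k"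
      unfolding 3 by (rule column_coeff_rec(2)[OF z])
    show ?thesis unfolding a b c fc_fourier_basis using le by simp
  qed
qed

text \<open>The resolvent is the sum over \<open>n\<close> of the rank-one operators sending \<open>v\<close> to its \<open>n\<close>-th
  coefficient times the \<open>n\<close>-th column. It converges absolutely in operator norm because the columns
  are at most a constant times \<open>1 / \<bar>n\<^sup>2 - z\<bar>\<close>.\<close>

lemma resolvent_exists:
  assumes z: "z \<notin> squares"
  shows "\<exists>R. is_resolvent (Hp \<alpha>) z R"
proof -
  obtain C where C: "\<And>n. norm (resolvent_column \<alpha> z n) \<le> C * (1 / cmod ((of_int n)\<^sup>2 - z))"
    by (rule resolvent_column_bound[OF z, where \<alpha> = \<alpha>]) blast
  define T where "T n = Blinfun (\<lambda>u. fc n u *\<^sub>C resolvent_column \<alpha> z n)" for n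
  have T: "blinfun_apply (T n) u = fc n u *\<^sub>C resolvent_column \<alpha> z n" for n u
    unfolding T_def
    by (subst bounded_linear_Blinfun_apply[OF bounded_linear_compose[OF bounded_linear_scaleC_left bounded_linear_fc]]) simp
  have nT: "norm (T n) \<le> C * (1 / cmod ((of_int n)\<^sup>2 - z))" for n
  proof (rule order_trans[OF _ C])
    show "norm (T n) \<le> norm (resolvent_column \<alpha> z n)"
      by (rule norm_blinfun_bound) (auto simp: T norm_scaleC mult.commute[of "norm (resolvent_column \<alpha> z n)"] intro!: mult_right_mono norm_fc_le)
  qed
  have "T abs_summable_on UNIV"
  proof (rule summable_on_comparison_test)
    show "(\<lambda>n::int. C * (1 / cmod ((of_int n)\<^sup>2 - z))) summable_on UNIV"
      by (rule summable_on_cmult_right[OF summable_on_inverse_shifted_square_int[OF z]])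
  qed (rule nT, rule norm_ge_zero)
  then have sT: "T summable_on UNIV" by (rule abs_summable_summable)
  define R where "R = infsum T UNIV"
  have main: "(R v, v) \<in> op_minus (Hp \<alpha>) z" for v
    unfolding op_minus_Hp_iff
  proof
    fix p
    \<comment> \<open>The \<open>p\<close>-th equation of the triangular system, as a bounded functional of the operator, may be summed term by term.\<close>
    define \<Phi> where "\<Phi> B = ((of_int p)\<^sup>2 - z) * fc p (blinfun_apply B v) + \<alpha>\<^sup>2 * fc (p - 1) (blinfun_apply B v)" for B :: "L2 \<Rightarrow>\<^sub>L L2"
    have "bounded_linear (\<lambda>B::L2 \<Rightarrow>\<^sub>L L2. fc p (blinfun_apply B v))" for p
      by (intro bounded_linear_compose[OF bounded_linear_fc] blinfun.bounded_linear_left)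
    then have "bounded_linear \<Phi>"
      unfolding \<Phi>_def by (intro bounded_linear_add bounded_linear_const_mult)
    then have "((\<lambda>n. \<Phi> (T n)) has_sum \<Phi> R) UNIV"
      unfolding R_def by (rule has_sum_bounded_linear) (rule has_sum_infsum[OF sT])
    moreover have "\<Phi> (T n) = (if n = p then fc p v else 0)" for n
    proof -
      have "\<Phi> (T n) = fc n v * (((of_int p)\<^sup>2 - z) * fc p (resolvent_column \<alpha> z n) + \<alpha>\<^sup>2 * fc (p - 1) (resolvent_column \<alpha> z n))"
        unfolding \<Phi>_def T fc_scaleC by (simp only: distrib_left mult.left_commute)
      also have "\<dots> = fc n v * fc p (fourier_basis n)"
        using resolvent_column_eq[OF z, of \<alpha> n] by (simp add: op_minus_Hp_iff)
      finally show ?thesis by (auto simp: fc_fourier_basis)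
    qed
    moreover have "((\<lambda>n. if n = p then fc p v else 0) has_sum fc p v) UNIV"
      by (rule has_sum_finite_neutralI[of "{p}"]) auto
    ultimately have "\<Phi> R = fc p v" by (simp add: has_sum_unique)
    then show "fc p v = ((of_int p)\<^sup>2 - z) * fc p (blinfun_apply R v) + \<alpha>\<^sup>2 * fc (p - 1) (blinfun_apply R v)"
      by (simp add: \<Phi>_def)
  qed
  have "is_resolvent (Hp \<alpha>) z R"
    unfolding is_resolvent_iff
  proof (intro allI iffI)
    fix u v assume uv: "(u, v) \<in> op_minus (Hp \<alpha>) z"
    have "(u - R v, 0) \<in> op_minus (Hp \<alpha>) z"
      using uv main[of v] unfolding op_minus_Hp_iff fc_diff fc_0 right_diff_distrib
      by (simp add: algebra_simps)
    then have "u - R v = 0" by (rule Hp_minus_injective[OF z])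
    then show "u = R v" by simp
  next
    fix u v assume "u = R v"
    then show "(u, v) \<in> op_minus (Hp \<alpha>) z" using main by simp
  qed
  then show ?thesis by blast
qed

section \<open>Riesz projections\<close>

lemma Hp_spectrum_subset: "spectrum (Hp \<alpha>) \<subseteq> squares"
  using resolvent_exists by (auto simp: spectrum_def)

lemma eigenvalue_in_spectrum:
  assumes "(u, 0) \<in> op_minus A l" "u \<noteq> 0"
  shows "l \<in> spectrum A"
proof (rule ccontr)
  assume "l \<notin> spectrum A"
  then have "resolvent A l 0 = u" using assms resolvent_eq_iff by metis
  then show False using assms by (simp add: blinfun.zero_right)
qed

text \<open>The partial sums are a Cauchy sequence by Bessel's inequality, and their limit has the same
  coefficients as \<open>u\<close>.\<close>

lemma fourier_series_tendsto:
  "(\<lambda>N. \<Sum>p\<in>{- int N..int N}. fc p u *\<^sub>C fourier_basis p) \<longlonglongrightarrow> u"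
proof -
  define I where "I N = {- int N..int N}" for N
  define S where "S N = (\<Sum>p\<in>I N. fc p u *\<^sub>C fourier_basis p)" for N
  define t where "t N = (\<Sum>p\<in>I N. (cmod (fc p u))\<^sup>2)" for N
  have fI: "finite (I N)" for N by (simp add: I_def)
  have mono: "I M \<subseteq> I N" if "M \<le> N" for M N using that by (auto simp: I_def)
  have "incseq t"
    unfolding t_def by (intro incseq_SucI sum_mono2 fI mono) auto
  moreover have "t N \<le> (norm u)\<^sup>2 / (2 * pi)" for N
    using bessel_inequality[OF fI[of N], of u] unfolding t_def by (simp add: pos_le_divide_eq mult.commute)
  ultimately have "convergent t" using incseq_convergent[of t] by (meson convergentI)
  then have Ct: "Cauchy t" by (rule convergent_Cauchy)
  have diff: "(norm (S N - S M))\<^sup>2 = 2 * pi * (t N - t M)" if "M \<le> N" for M N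
  proof -
    have "S N - S M = (\<Sum>p\<in>I N - I M. fc p u *\<^sub>C fourier_basis p)"
      unfolding S_def by (subst sum_diff[OF fI mono[OF that]]) simp
    moreover have "t N - t M = (\<Sum>p\<in>I N - I M. (cmod (fc p u))\<^sup>2)"
      unfolding t_def by (subst sum_diff[OF fI mono[OF that]]) simp
    ultimately show ?thesis using norm_trig_sum[of "I N - I M"] fI by simp
  qed
  have "Cauchy S"
  proof (rule CauchyI')
    fix e :: real assume e: "e > 0"
    then have "e\<^sup>2 / (2 * pi) > 0" by simp
    then obtain K where K: "\<And>m n. m \<ge> K \<Longrightarrow> n \<ge> K \<Longrightarrow> norm (t m - t n) < e\<^sup>2 / (2 * pi)"
      using CauchyD[OF Ct] by metis
    show "\<exists>M. \<forall>m\<ge>M. \<forall>n>m. dist (S m) (S n) < e"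
    proof (intro exI[of _ K] allI impI)
      fix m n assume mn: "K \<le> m" "m < n"
      then have "t n - t m < e\<^sup>2 / (2 * pi)" using K[of n m] by simp
      then have "2 * pi * (t n - t m) < e\<^sup>2" by (simp add: pos_less_divide_eq mult.commute)
      then have "(norm (S n - S m))\<^sup>2 < e\<^sup>2" using diff[of m n] mn by simp
      then have "norm (S n - S m) < e" using e by (simp add: power_less_imp_less_base)
      then show "dist (S m) (S n) < e" by (simp add: dist_norm norm_minus_commute)
    qed
  qed
  then obtain s where s: "S \<longlonglongrightarrow> s" using Cauchy_convergent convergent_def by blast
  have "fc p s = fc p u" for p
  proof -
    have lim: "(\<lambda>N. fc p (S N)) \<longlonglongrightarrow> fc p s"
      by (rule bounded_linear.tendsto[OF bounded_linear_fc s])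
    have "\<forall>\<^sub>F N in sequentially. fc p (S N) = fc p u"
      using eventually_ge_at_top[of "nat \<bar>p\<bar>"]
    proof eventually_elim
      case (elim N)
      then have pI: "p \<in> I N" by (auto simp: I_def)
      have "fc p (S N) = (\<Sum>q\<in>I N. if p = q then fc q u else 0)"
        unfolding S_def fc_sum fc_scaleC fc_fourier_basis by (intro sum.cong) auto
      then show ?case using pI fI by simp
    qed
    then have "(\<lambda>N. fc p (S N)) \<longlonglongrightarrow> fc p u" by (rule tendsto_eventually)
    then show ?thesis using lim LIMSEQ_unique by blast
  qed
  then have "s = u" by (rule fourier_ext)
  then show ?thesis using s unfolding S_def I_def by simp
qed

lemma blinfun_zero_if_zero_on_fourier_basis:
  fixes S :: "L2 \<Rightarrow>\<^sub>L L2"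
  assumes "\<And>c n. S (c *\<^sub>C fourier_basis n) = 0"
  shows "S u = 0"
proof -
  have "(\<lambda>N. S (\<Sum>p\<in>{- int N..int N}. fc p u *\<^sub>C fourier_basis p)) \<longlonglongrightarrow> S u"
    by (intro blinfun.tendsto tendsto_const fourier_series_tendsto)
  moreover have "S (\<Sum>p\<in>{- int N..int N}. fc p u *\<^sub>C fourier_basis p) = 0" for N
    by (simp add: blinfun.sum_right assms)
  ultimately show ?thesis by (simp add: LIMSEQ_const_iff)
qed

lemma resolvent_fourier_basis:
  assumes "z \<notin> squares"
  shows "resolvent (Hp \<alpha>) z (fourier_basis n) = resolvent_column \<alpha> z n"
  using assms Hp_spectrum_subset by (subst resolvent_eq_iff) (auto intro: resolvent_column_eq)

lemma int_square_eq_subset: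
  "{p. (of_int p :: complex)\<^sup>2 = (of_nat m)\<^sup>2} \<subseteq> {int m, - int m}"
proof
  fix p assume "p \<in> {p. (of_int p :: complex)\<^sup>2 = (of_nat m)\<^sup>2}"
  then have "(of_int p :: complex) = of_int (int m) \<or> (of_int p :: complex) = of_int (- int m)"
    by (simp add: power2_eq_iff)
  then show "p \<in> {int m, - int m}" unfolding of_int_eq_iff by blast
qed

text \<open>A circle of radius \<open>e\<close> around the eigenvalue \<open>l = m\<^sup>2\<close> that excludes all other squares, with \<open>\<zeta>\<close> running
  through it and \<open>R\<close> the resolvent along it; the moment of order \<open>j\<close> is
  \<open>- 1 / (2\<pi>i)\<close> times the contour integral of \<open>(\<zeta> - l)\<^sup>j R(\<zeta>)\<close>.\<close>

locale isolated_square =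
  fixes \<alpha> :: complex and m :: nat and e :: real
  assumes e: "e > 0" and iso: "squares \<inter> cball ((of_nat m)\<^sup>2) e = {(of_nat m)\<^sup>2}"
begin

definition "l = (complex_of_nat m)\<^sup>2"
definition "\<zeta> t = l + complex_of_real e * cis t"
definition "R t = resolvent (Hp \<alpha>) (\<zeta> t)"
definition moment :: "nat \<Rightarrow> L2 \<Rightarrow>\<^sub>L L2" where
  "moment j = (- 1 / (2 * complex_of_real pi * \<i>)) *\<^sub>C
      integral {0..2 * pi} (\<lambda>t. ((\<i> * complex_of_real e * cis t) * (complex_of_real e * cis t) ^ j) *\<^sub>C R t)"

lemma squares_cball: "z \<in> squares \<Longrightarrow> z \<in> cball l e \<Longrightarrow> z = l"
  using iso unfolding l_def by blast

lemma \<zeta>_nonsquare: "\<zeta> t \<notin> squares"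
proof
  assume "\<zeta> t \<in> squares"
  moreover have "\<zeta> t \<in> cball l e" using e by (simp add: \<zeta>_def dist_norm norm_mult)
  ultimately have "\<zeta> t = l" using squares_cball by blast
  then show False using e by (simp add: \<zeta>_def)
qed

lemma \<zeta>_resolvent_set: "\<zeta> t \<notin> spectrum (Hp \<alpha>)"
  using \<zeta>_nonsquare Hp_spectrum_subset by blast

lemma R_apply_eq_iff: "blinfun_apply (R t) v = u \<longleftrightarrow> (u, v) \<in> op_minus (Hp \<alpha>) (\<zeta> t)"
  unfolding R_def by (rule resolvent_eq_iff[OF \<zeta>_resolvent_set])

lemma continuous_R: "continuous_on S R"
proof -
  have "continuous_on S \<zeta>" unfolding \<zeta>_def by (intro continuous_intros)
  moreover have "\<zeta> ` S \<subseteq> - spectrum (Hp \<alpha>)" using \<zeta>_resolvent_set by blast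
  ultimately have "continuous_on S (\<lambda>t. resolvent (Hp \<alpha>) (\<zeta> t))"
    by (rule continuous_on_compose2[OF continuous_on_resolvent])
  then show ?thesis by (simp add: R_def[abs_def])
qed

lemma continuous_on_scaleC:
  fixes F :: "real \<Rightarrow> L2 \<Rightarrow>\<^sub>L L2"
  assumes "continuous_on S c" "continuous_on S F"
  shows "continuous_on S (\<lambda>t. c t *\<^sub>C F t)"
proof -
  have eq: "c t *\<^sub>C F t = Re (c t) *\<^sub>R F t + Im (c t) *\<^sub>R (\<i> *\<^sub>C F t)" for t
    by (simp add: scaleR_eq_scaleC scaleC_scaleC scaleC_add_left[symmetric] complex_eq[symmetric] mult.commute)
  show ?thesis unfolding eq
    by (intro continuous_intros assms bounded_linear.continuous_on[OF bounded_linear_scaleC_right])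
qed

lemma moment_functional:
  assumes "bounded_linear \<Lambda>" and c: "\<And>c B. \<Lambda> (c *\<^sub>C B) = c * \<Lambda> B"
  shows "\<Lambda> (moment j) = (- 1 / (2 * complex_of_real pi * \<i>)) *
      integral {0..2 * pi} (\<lambda>t. ((\<i> * complex_of_real e * cis t) * (complex_of_real e * cis t) ^ j) * \<Lambda> (R t))"
    "(\<lambda>t. ((\<i> * complex_of_real e * cis t) * (complex_of_real e * cis t) ^ j) * \<Lambda> (R t)) integrable_on {0..2*pi}"
proof -
  have i: "(\<lambda>t. ((\<i> * complex_of_real e * cis t) * (complex_of_real e * cis t) ^ j) *\<^sub>C R t) integrable_on {0..2 * pi}"
    by (intro integrable_continuous_real continuous_on_scaleC continuous_R continuous_intros)
  have "\<Lambda> (moment j) = (- 1 / (2 * complex_of_real pi * \<i>)) *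
      integral {0..2 * pi} (\<Lambda> \<circ> (\<lambda>t. ((\<i> * complex_of_real e * cis t) * (complex_of_real e * cis t) ^ j) *\<^sub>C R t))"
    unfolding moment_def c by (subst integral_linear[OF i assms(1)]) simp
  then show "\<Lambda> (moment j) = (- 1 / (2 * complex_of_real pi * \<i>)) *
      integral {0..2 * pi} (\<lambda>t. ((\<i> * complex_of_real e * cis t) * (complex_of_real e * cis t) ^ j) * \<Lambda> (R t))"
    by (simp add: o_def c)
  show "(\<lambda>t. ((\<i> * complex_of_real e * cis t) * (complex_of_real e * cis t) ^ j) * \<Lambda> (R t)) integrable_on {0..2*pi}"
    using integrable_linear[OF i assms(1)] by (simp add: o_def c)
qed

lemma bounded_linear_fc_apply: "bounded_linear (\<lambda>B. fc p (blinfun_apply B u))"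
  by (intro bounded_linear_compose[OF bounded_linear_fc] blinfun.bounded_linear_left)

lemma scaleC_blinfun_apply: "blinfun_apply (c *\<^sub>C B) u = c *\<^sub>C blinfun_apply (B :: L2 \<Rightarrow>\<^sub>L L2) u"
  by (simp add: scaleC_blinfun.rep_eq)

lemma fc_moment:
  "fc p (moment j u) = (- 1 / (2 * complex_of_real pi * \<i>)) *
      integral {0..2 * pi} (\<lambda>t. ((\<i> * complex_of_real e * cis t) * (complex_of_real e * cis t) ^ j) * fc p (R t u))"
  "(\<lambda>t. ((\<i> * complex_of_real e * cis t) * (complex_of_real e * cis t) ^ j) * fc p (R t u)) integrable_on {0..2 * pi}"
  by (rule moment_functional[OF bounded_linear_fc_apply], simp add: scaleC_blinfun_apply fc_scaleC)+

lemma has_integral_cis_int: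
  assumes "k \<noteq> 0"
  shows "((\<lambda>t. cis (of_int k * t)) has_integral 0) {0..2 * pi}"
proof -
  have "expi k = (\<lambda>t. cis (of_int k * t))" by (auto simp: expi_def cis_conv_exp mult.assoc)
  moreover have "(expi k has_integral integral period (expi k)) period"
    by (intro integrable_integral integrable_continuous_real continuous_intros)
  ultimately show ?thesis using integral_expi[of k] assms by simp
qed

lemma has_integral_power_circle:
  "((\<lambda>t. ((\<i> * complex_of_real e * cis t) * (complex_of_real e * cis t) ^ j)) has_integral 0) {0..2 * pi}"
proof -
  have "cis (of_int (int (Suc j)) * t) = cis t * cis t ^ j" for t
    using Complex.DeMoivre[of t "Suc j"] unfolding power_Suc of_int_of_nat_eq by (rule sym)
  then have eq: "(\<i> * complex_of_real e * cis t) * (complex_of_real e * cis t) ^ j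
      = \<i> * complex_of_real e ^ Suc j * cis (of_int (int (Suc j)) * t)" for t
    by (simp only: power_mult_distrib power_Suc mult_ac)
  show ?thesis unfolding eq
    using has_integral_mult_right[OF has_integral_cis_int[of "int (Suc j)"], of "\<i> * complex_of_real e ^ Suc j"] by simp
qed

text \<open>Since \<open>(Hp \<alpha> - l) R(\<zeta>) = I + (\<zeta> - l) R(\<zeta>)\<close> and the powers of \<open>\<zeta> - l\<close> have zero integral over the circle,
  the operator \<open>Hp \<alpha> - l\<close> maps each moment to the next one.\<close>

lemma moment_step: "(moment j u, moment (Suc j) u) \<in> op_minus (Hp \<alpha>) l"
  unfolding op_minus_Hp_iff
proof
  fix p
  let ?w = "\<lambda>j t. (\<i> * complex_of_real e * cis t) * (complex_of_real e * cis t) ^ j"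
  have rec: "((of_int p)\<^sup>2 - l) * fc p (R t u) + \<alpha>\<^sup>2 * fc (p - 1) (R t u) = fc p u + (complex_of_real e * cis t) * fc p (R t u)" for t
  proof -
    have "(R t u, u) \<in> op_minus (Hp \<alpha>) (\<zeta> t)" using R_apply_eq_iff by blast
    then have "fc p u = ((of_int p)\<^sup>2 - \<zeta> t) * fc p (R t u) + \<alpha>\<^sup>2 * fc (p - 1) (R t u)"
      by (simp add: op_minus_Hp_iff)
    then show ?thesis by (simp add: \<zeta>_def algebra_simps)
  qed
  have "integral {0..2*pi} (\<lambda>t. ((of_int p)\<^sup>2 - l) * (?w j t * fc p (R t u)) + \<alpha>\<^sup>2 * (?w j t * fc (p - 1) (R t u)))
      = integral {0..2*pi} (\<lambda>t. ?w j t * fc p u + ?w (Suc j) t * fc p (R t u))"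
  proof (intro Henstock_Kurzweil_Integration.integral_cong)
    fix t
    have "((of_int p)\<^sup>2 - l) * (?w j t * fc p (R t u)) + \<alpha>\<^sup>2 * (?w j t * fc (p - 1) (R t u))
      = ?w j t * (((of_int p)\<^sup>2 - l) * fc p (R t u) + \<alpha>\<^sup>2 * fc (p - 1) (R t u))" by (simp add: algebra_simps)
    also have "\<dots> = ?w j t * fc p u + ?w (Suc j) t * fc p (R t u)" unfolding rec by (simp add: algebra_simps)
    finally show "((of_int p)\<^sup>2 - l) * (?w j t * fc p (R t u)) + \<alpha>\<^sup>2 * (?w j t * fc (p - 1) (R t u)) = ?w j t * fc p u + ?w (Suc j) t * fc p (R t u)" .
  qed
  also have "\<dots> = integral {0..2*pi} (\<lambda>t. ?w (Suc j) t * fc p (R t u))"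
  proof -
    have "((\<lambda>t. ?w j t * fc p u) has_integral 0 * fc p u) {0..2*pi}"
      by (rule has_integral_mult_left[OF has_integral_power_circle])
    from has_integral_add[OF this integrable_integral[OF fc_moment(2)[of "Suc j" p u]]]
    show ?thesis by (simp add: integral_unique)
  qed
  also have "integral {0..2*pi} (\<lambda>t. ((of_int p)\<^sup>2 - l) * (?w j t * fc p (R t u)) + \<alpha>\<^sup>2 * (?w j t * fc (p - 1) (R t u)))
     = ((of_int p)\<^sup>2 - l) * integral {0..2*pi} (\<lambda>t. ?w j t * fc p (R t u)) + \<alpha>\<^sup>2 * integral {0..2*pi} (\<lambda>t. ?w j t * fc (p - 1) (R t u))"
    using has_integral_add[OF has_integral_mult_right[OF integrable_integral[OF fc_moment(2)[of j p u]], of "(of_int p)\<^sup>2 - l"]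
        has_integral_mult_right[OF integrable_integral[OF fc_moment(2)[of j "p - 1" u]], of "\<alpha>\<^sup>2"]]
    by (rule integral_unique)
  finally have fin: "((of_int p)\<^sup>2 - l) * integral {0..2*pi} (\<lambda>t. ?w j t * fc p (R t u)) + \<alpha>\<^sup>2 * integral {0..2*pi} (\<lambda>t. ?w j t * fc (p - 1) (R t u))
      = integral {0..2*pi} (\<lambda>t. ?w (Suc j) t * fc p (R t u))" .
  have lin: "a * X + b * Y = Z \<Longrightarrow> c * Z = a * (c * X) + b * (c * Y)" for a b c X Y Z :: complex
    by (auto simp: algebra_simps)
  show "fc p (moment (Suc j) u) = ((of_int p)\<^sup>2 - l) * fc p (moment j u) + \<alpha>\<^sup>2 * fc (p - 1) (moment j u)"
    unfolding fc_moment(1) by (rule lin[OF fin])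
qed

text \<open>On such \<open>u\<close> the resolvent is \<open>u / (l - \<zeta>) - v / (l - \<zeta>)\<^sup>2\<close>, and only the first term has a residue.\<close>

lemma moment_0_on_ker2:
  assumes uv: "(u, v) \<in> op_minus (Hp \<alpha>) l" and v: "(v, 0) \<in> op_minus (Hp \<alpha>) l"
  shows "moment 0 u = u"
proof (rule fourier_ext)
  fix p
  have Ru: "fc p (R t u) = - fc p u / (complex_of_real e * cis t) - fc p v / (complex_of_real e * cis t)\<^sup>2" for t
  proof -
    define q where "q = l - \<zeta> t"
    have q: "q = - (complex_of_real e * cis t)" "q \<noteq> 0" using e by (auto simp: q_def \<zeta>_def)
    have "(v, q *\<^sub>C v) \<in> op_minus (Hp \<alpha>) (\<zeta> t)" using op_minus_shift[OF v] by (simp add: q_def)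
    then have "R t (q *\<^sub>C v) = v" by (simp add: R_apply_eq_iff)
    then have 1: "q * fc p (R t v) = fc p v"
      unfolding R_def resolvent_scaleC[OF \<zeta>_resolvent_set] by (metis fc_scaleC)
    have "(u, v + q *\<^sub>C u) \<in> op_minus (Hp \<alpha>) (\<zeta> t)" using op_minus_shift[OF uv] by (simp add: q_def)
    then have "R t (v + q *\<^sub>C u) = u" by (simp add: R_apply_eq_iff)
    then have "R t v + q *\<^sub>C R t u = u"
      unfolding R_def blinfun.add_right resolvent_scaleC[OF \<zeta>_resolvent_set] .
    then have 2: "fc p (R t v) + q * fc p (R t u) = fc p u" by (metis fc_add fc_scaleC)
    have "q * (q * fc p (R t u)) = q * fc p u - fc p v"
      by (simp add: 1[symmetric] 2[symmetric] distrib_left)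
    then have "fc p (R t u) = (q * fc p u - fc p v) / (q * q)"
      using q(2) by (simp add: eq_divide_eq mult_ac)
    also have "\<dots> = - fc p u / (- q) - fc p v / (- q)\<^sup>2"
      using q(2) by (simp add: diff_divide_distrib power2_eq_square)
    finally show ?thesis unfolding q(1) by simp
  qed
  have "((\<i> * complex_of_real e * cis t) * (complex_of_real e * cis t) ^ 0) * fc p (R t u) =
      - \<i> * fc p u - (\<i> * fc p v / complex_of_real e) * cis (of_int (- 1) * t)" for t
  proof -
    have "cis t * cis (of_int (- 1) * t) = 1" by (simp add: cis_mult)
    then have inv: "cis (of_int (- 1) * t) = 1 / cis t" by (simp add: eq_divide_eq mult.commute)
    show ?thesis unfolding Ru inv using e by (simp add: field_simps power2_eq_square)
  qed
  then have fe: "(\<lambda>t. ((\<i> * complex_of_real e * cis t) * (complex_of_real e * cis t) ^ 0) * fc p (R t u)) =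
      (\<lambda>t. - \<i> * fc p u - (\<i> * fc p v / complex_of_real e) * cis (of_int (- 1) * t))" by blast
  have "((\<lambda>t. - \<i> * fc p u - (\<i> * fc p v / complex_of_real e) * cis (of_int (- 1) * t)) has_integral
      ((2 * pi - 0) *\<^sub>R (- \<i> * fc p u) - (\<i> * fc p v / complex_of_real e) * 0)) {0..2*pi}"
    using has_integral_const_real[of "- \<i> * fc p u" 0 "2 * pi"]
    by (intro has_integral_diff has_integral_mult_right has_integral_cis_int) auto
  then have int: "integral {0..2*pi} (\<lambda>t. ((\<i> * complex_of_real e * cis t) * (complex_of_real e * cis t) ^ 0) * fc p (R t u))
      = (2 * pi - 0) *\<^sub>R (- \<i> * fc p u) - (\<i> * fc p v / complex_of_real e) * 0"
    unfolding fe by (rule integral_unique)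
  show "fc p (moment 0 u) = fc p u"
    unfolding fc_moment(1) int
  proof -
    have "(- 1 / (2 * complex_of_real pi * \<i>)) * ((2 * complex_of_real pi) * (- \<i> * w)) = w" for w
      by simp
    then show "- 1 / (2 * complex_of_real pi * \<i>) * ((2 * pi - 0) *\<^sub>R (- \<i> * fc p u) - \<i> * fc p v / complex_of_real e * 0) = fc p u"
      by (simp only: scaleR_conv_of_real diff_zero mult_zero_right of_real_mult of_real_numeral)
  qed
qed

text \<open>The coefficients of the resolvent applied to a basis vector are constants times products of factors
  \<open>1 / (q\<^sup>2 - \<zeta>)\<close> with distinct integers \<open>q\<close>. At most two of these, \<open>q = m\<close> and \<open>q = -m\<close>, are
  singular at \<open>l\<close>, so the factor \<open>(\<zeta> - l)\<^sup>2\<close> removes the pole and Cauchy's theorem applies.\<close>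

lemma moment_2_fourier_basis: "moment 2 (c *\<^sub>C fourier_basis n) = 0"
proof (rule fourier_completeness)
  fix p
  show "fc p (moment 2 (c *\<^sub>C fourier_basis n)) = 0"
  proof (cases "p \<ge> n")
    case False
    then show ?thesis
      by (simp add: fc_moment(1) R_def resolvent_scaleC[OF \<zeta>_resolvent_set] fc_scaleC
         resolvent_fourier_basis[OF \<zeta>_nonsquare] fc_resolvent_column[OF \<zeta>_nonsquare])
  next
    case True
    define k where "k = nat (p - n)"
    define B where "B = {j. j \<le> k \<and> (complex_of_int (n + int j))\<^sup>2 = l}"
    define B' where "B' = {j. j \<le> k \<and> (complex_of_int (n + int j))\<^sup>2 \<noteq> l}"
    have fin: "finite B" "finite B'" by (auto simp: B_def B'_def)
    have BB: "{..k} = B \<union> B'" "B \<inter> B' = {}" by (auto simp: B_def B'_def)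
    have "(\<lambda>j. n + int j) ` B \<subseteq> {p. (of_int p :: complex)\<^sup>2 = (of_nat m)\<^sup>2}"
      unfolding B_def l_def by blast
    then have "(\<lambda>j. n + int j) ` B \<subseteq> {int m, - int m}"
      using int_square_eq_subset[of m] by (rule order_trans)
    then have "card B \<le> card {int m, - int m}"
      by (intro card_inj_on_le[of "\<lambda>j. n + int j"]) (auto simp: inj_on_def)
    also have "\<dots> \<le> 2" by (simp add: card_insert_if)
    finally have cB: "card B \<le> 2" .
    \<comment> \<open>The integrand, with the singular factors cancelled against \<open>(\<zeta> - l)\<^sup>2\<close>.\<close>
    define G where "G z = c * (- \<alpha>\<^sup>2) ^ k * (l - z) ^ (2 - card B) / (\<Prod>j\<in>B'. ((of_int (n + int j))\<^sup>2 - z))" for z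
    have Gc: "fc p (R t (c *\<^sub>C fourier_basis n)) * (complex_of_real e * cis t)\<^sup>2 = G (\<zeta> t)" for t
    proof -
      have "fc p (R t (c *\<^sub>C fourier_basis n)) = c * column_coeff \<alpha> (\<zeta> t) n k"
        using True by (simp add: R_def resolvent_scaleC[OF \<zeta>_resolvent_set] fc_scaleC k_def
          resolvent_fourier_basis[OF \<zeta>_nonsquare] fc_resolvent_column[OF \<zeta>_nonsquare])
      moreover have "(\<Prod>j\<le>k. ((complex_of_int (n + int j))\<^sup>2 - \<zeta> t))
         = (l - \<zeta> t) ^ card B * (\<Prod>j\<in>B'. ((of_int (n + int j))\<^sup>2 - \<zeta> t))"
      proof -
        have "(\<Prod>j\<in>B. ((complex_of_int (n + int j))\<^sup>2 - \<zeta> t)) = (\<Prod>j\<in>B. (l - \<zeta> t))"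
          by (intro prod.cong) (auto simp: B_def)
        then show ?thesis unfolding BB(1) by (simp only: prod.union_disjoint[OF fin BB(2)] prod_constant)
      qed
      moreover have "(complex_of_real e * cis t)\<^sup>2 = (l - \<zeta> t) ^ card B * (l - \<zeta> t) ^ (2 - card B)"
        using cB by (simp add: \<zeta>_def flip: power_add)
      moreover have "l - \<zeta> t \<noteq> 0" using e by (simp add: \<zeta>_def)
      ultimately show ?thesis by (simp add: column_coeff_def G_def)
    qed
    have "(G has_contour_integral 0) (circlepath l e)"
    proof (rule Cauchy_theorem_convex_simple)
      show "G holomorphic_on cball l e"
        unfolding G_def
      proof (intro holomorphic_intros)
        fix z assume z: "z \<in> cball l e"
        have "(complex_of_int (n + int j))\<^sup>2 \<noteq> z" if "j \<in> B'" for j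
          using squares_cball[OF int_square_in_squares[of "n + int j"]] z that by (auto simp: B'_def simp del: of_int_add mem_cball)
        then show "(\<Prod>j\<in>B'. ((of_int (n + int j))\<^sup>2 - z)) \<noteq> 0"
          using fin by (simp del: of_int_add)
      qed
    qed (use e in auto)
    then have "((\<lambda>t. G (l + of_real e * cis t) * of_real e * \<i> * cis t) has_integral 0) {0..2*pi}"
      unfolding circlepath_def by (subst (asm) has_contour_integral_part_circlepath_iff) auto
    moreover have "((\<i> * complex_of_real e * cis t) * (complex_of_real e * cis t) ^ 2) * fc p (R t (c *\<^sub>C fourier_basis n))
        = G (l + of_real e * cis t) * of_real e * \<i> * cis t" for t
      unfolding Gc[of t, unfolded \<zeta>_def, symmetric] by (simp only: mult_ac)
    ultimately have "integral {0..2*pi} (\<lambda>t. ((\<i> * complex_of_real e * cis t) * (complex_of_real e * cis t) ^ 2) * fc p (R t (c *\<^sub>C fourier_basis n))) = 0"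
      by (simp only: integral_unique)
    then show ?thesis unfolding fc_moment(1) by simp
  qed
qed

lemma moment_2: "moment 2 u = 0"
  by (rule blinfun_zero_if_zero_on_fourier_basis[OF moment_2_fourier_basis])

text \<open>The moment of order \<open>0\<close> is the Riesz projection; as the moment of order \<open>2\<close> vanishes, its range
  consists of vectors annihilated by \<open>(Hp \<alpha> - l)\<^sup>2\<close>, and it fixes all of these.\<close>

lemma range_moment_0:
  "range (blinfun_apply (moment 0)) = {u. \<exists>v. (u, v) \<in> op_minus (Hp \<alpha>) l \<and> (v, 0) \<in> op_minus (Hp \<alpha>) l}"
proof (intro set_eqI iffI)
  fix u assume "u \<in> range (blinfun_apply (moment 0))"
  then obtain x where x: "u = moment 0 x" by auto
  have "(moment 0 x, moment 1 x) \<in> op_minus (Hp \<alpha>) l"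
    using moment_step[of 0 x] by (simp only: One_nat_def)
  moreover have "(moment 1 x, 0) \<in> op_minus (Hp \<alpha>) l"
    using moment_step[of 1 x] by (simp only: Suc_1 moment_2)
  ultimately show "u \<in> {u. \<exists>v. (u, v) \<in> op_minus (Hp \<alpha>) l \<and> (v, 0) \<in> op_minus (Hp \<alpha>) l}"
    unfolding x by blast
next
  fix u assume "u \<in> {u. \<exists>v. (u, v) \<in> op_minus (Hp \<alpha>) l \<and> (v, 0) \<in> op_minus (Hp \<alpha>) l}"
  then have "moment 0 u = u" using moment_0_on_ker2 by blast
  then show "u \<in> range (blinfun_apply (moment 0))" by (metis rangeI)
qed

end

section \<open>Eigenfunctions\<close>

lemma trig_series_L2:
  fixes a :: "nat \<Rightarrow> complex" and s :: int
  assumes a: "summable (\<lambda>k. norm (a k))"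
  defines "f \<equiv> (\<lambda>x. \<Sum>k. a k * expi (s + int k) x)"
  shows "square_integrable f" "fc p (L2_class f) = (if p \<ge> s then a (nat (p - s)) else 0)"
proof -
  define S where "S N x = (\<Sum>k<N. a k * expi (s + int k) x)" for N x
  define t where "t N = (\<Sum>k. norm (a (k + N)))" for N
  have na: "norm (a k * expi (s + int k) x) = norm (a k)" for k x by (simp add: norm_mult)
  have sm: "summable (\<lambda>k. norm (a k * expi (s + int k) x))" for x unfolding na by (rule a)
  have tail: "norm (f x - S N x) \<le> t N" for x N
  proof -
    have "f x - S N x = (\<Sum>k. a (k + N) * expi (s + int (k + N)) x)"
      unfolding f_def S_def using suminf_minus_initial_segment[OF summable_norm_cancel[OF sm[of x]], of N] by simp
    also have "norm \<dots> \<le> (\<Sum>k. norm (a (k + N) * expi (s + int (k + N)) x))"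
      using summable_ignore_initial_segment[OF sm[of x], of N] by (rule summable_norm)
    also have "\<dots> = t N" unfolding na t_def ..
    finally show ?thesis .
  qed
  have "(\<lambda>N. suminf (\<lambda>k. norm (a k)) - (\<Sum>k<N. norm (a k))) \<longlonglongrightarrow> suminf (\<lambda>k. norm (a k)) - suminf (\<lambda>k. norm (a k))"
    by (intro tendsto_diff tendsto_const summable_LIMSEQ a)
  then have t0: "t \<longlonglongrightarrow> 0"
    unfolding t_def using suminf_minus_initial_segment[OF a] by simp
  have cS: "continuous_on period (S N)" for N
    unfolding S_def by (intro continuous_intros)
  have "uniform_limit period S f sequentially"
  proof (rule uniform_limitI)
    fix e :: real assume "e > 0"
    with t0 have "\<forall>\<^sub>F N in sequentially. t N < e" by (rule order_tendstoD)
    then show "\<forall>\<^sub>F N in sequentially. \<forall>x\<in>period. dist (S N x) (f x) < e"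
    proof eventually_elim
      case (elim N)
      show ?case
      proof
        fix x
        have "dist (S N x) (f x) \<le> t N" using tail[of x N] by (simp only: dist_norm norm_minus_commute)
        then show "dist (S N x) (f x) < e" using elim by simp
      qed
    qed
  qed
  then have cf: "continuous_on period f"
    by (rule uniform_limit_theorem[rotated]) (auto simp: cS)
  then show sf: "square_integrable f" by (rule continuous_square_integrable)
  have SN: "square_integrable (S N)" for N by (rule continuous_square_integrable[OF cS])
  have SL: "L2_class (S N) = (\<Sum>k<N. a k *\<^sub>C fourier_basis (s + int k))" for N
  proof -
    have "(\<Sum>k<N. a k *\<^sub>C fourier_basis (s + int k)) = (\<Sum>k<N. L2_class (\<lambda>x. a k * expi (s + int k) x))"
      by (simp add: fourier_basis_def L2_class_scale square_integrable_expi)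
    also have "\<dots> = L2_class (S N)"
      unfolding S_def[abs_def] using L2_class_sum[of "{..<N}" "\<lambda>k x. a k * expi (s + int k) x"]
      by (simp add: square_integrable_scale square_integrable_expi)
    finally show ?thesis by simp
  qed
  have "norm (L2_class f - L2_class (S N)) \<le> sqrt (2 * pi) * t N" for N
    unfolding L2_class_diff[OF sf SN]
    by (rule bounded_square_integrable(2)[OF square_integrable_measurable[OF square_integrable_diff[OF sf SN]] tail])
  then have "\<forall>\<^sub>F N in sequentially. norm (L2_class f - L2_class (S N)) \<le> sqrt (2 * pi) * t N"
    by (intro always_eventually allI)
  moreover have "(\<lambda>N. sqrt (2 * pi) * t N) \<longlonglongrightarrow> 0" using tendsto_mult_right_zero[OF t0] .
  ultimately have "(\<lambda>N. L2_class f - L2_class (S N)) \<longlonglongrightarrow> 0"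
    by (rule Lim_null_comparison)
  then have "(\<lambda>N. fc p (L2_class f - L2_class (S N))) \<longlonglongrightarrow> 0"
    using bounded_linear.tendsto[OF bounded_linear_fc[of p], of "\<lambda>N. L2_class f - L2_class (S N)" 0] by simp
  then have "(\<lambda>N. fc p (L2_class f) - fc p (L2_class (S N))) \<longlonglongrightarrow> 0" by (simp add: fc_diff)
  from tendsto_diff[OF tendsto_const[of "fc p (L2_class f)"] this]
  have lim: "(\<lambda>N. fc p (L2_class (S N))) \<longlonglongrightarrow> fc p (L2_class f)" by simp
  have "\<forall>\<^sub>F N in sequentially. fc p (L2_class (S N)) = (if p \<ge> s then a (nat (p - s)) else 0)"
    using eventually_gt_at_top[of "nat (p - s)"]
  proof eventually_elim
    case (elim N)
    have "fc p (L2_class (S N)) = (\<Sum>k<N. if k = nat (p - s) then if p \<ge> s then a k else 0 else 0)"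
      unfolding SL fc_sum fc_scaleC fc_fourier_basis by (intro sum.cong) auto
    then show ?case using elim by simp
  qed
  then have "(\<lambda>N. fc p (L2_class (S N))) \<longlonglongrightarrow> (if p \<ge> s then a (nat (p - s)) else 0)" by (rule tendsto_eventually)
  then show "fc p (L2_class f) = (if p \<ge> s then a (nat (p - s)) else 0)"
    using LIMSEQ_unique lim by blast
qed

lemma summable_bessel:
  "summable (\<lambda>k. norm ((- 1) ^ k / (fact k * fact (n + k)) * b ^ k :: complex))"
proof (rule summable_comparison_test')
  show "summable (\<lambda>k. norm b ^ k / fact k)" using summable_exp_generic[of "norm b"] by (simp add: divide_inverse_commute scaleR_conv_of_real)
  fix k :: nat
  have "fact k * 1 \<le> fact k * (fact (n + k) :: real)" by (intro mult_left_mono) (auto simp: fact_ge_1)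
  then have "norm b ^ k / (fact k * fact (n + k)) \<le> norm b ^ k / fact k"
    by (intro divide_left_mono) auto
  then show "norm (norm ((- 1) ^ k / (fact k * fact (n + k)) * b ^ k)) \<le> norm b ^ k / fact k"
    by (simp add: norm_mult norm_divide norm_power)
qed

lemma bessel_J_double:
  "bessel_J n (2 * w) = (\<Sum>k. ((- 1) ^ k / (fact k * fact (n + k))) * (w ^ (2 * k + n)))"
  by (simp add: bessel_J_def)

lemma half_exp_power: "exp (\<i> * complex_of_real x / 2) ^ (2 * k) = expi (int k) x"
  by (simp add: expi_def exp_of_nat_mult[symmetric] mult_ac)

lemma half_exp_powi: "exp (\<i> * complex_of_real x / 2) powi (2 * k) = expi k x"
  by (simp add: expi_def exp_power_int mult_ac)

definition y_coeff :: "complex \<Rightarrow> nat \<Rightarrow> nat \<Rightarrow> complex" where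
  "y_coeff \<alpha> m k = ((- 1) ^ k / (fact k * fact (2 * m + k))) * \<alpha> ^ (2 * (k + m))"

lemma summable_y_coeff: "summable (\<lambda>k. norm (y_coeff \<alpha> m k))"
proof -
  have "\<alpha> ^ (2 * (k + m)) = (\<alpha>\<^sup>2) ^ k * \<alpha> ^ (2 * m)" for k
    by (simp only: power_mult[symmetric] power_add[symmetric] distrib_left)
  then have "norm (y_coeff \<alpha> m k) = norm ((- 1) ^ k / (fact k * fact (2 * m + k)) * (\<alpha>\<^sup>2) ^ k) * norm (\<alpha> ^ (2 * m))" for k
    by (simp only: y_coeff_def norm_mult mult.assoc)
  then show ?thesis using summable_mult2[OF summable_bessel[of "2 * m" "\<alpha>\<^sup>2"]] by simp
qed

lemma y_fun_series: "y_fun \<alpha> m = (\<lambda>x. \<Sum>k. y_coeff \<alpha> m k * expi (int m + int k) x)"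
proof
  fix x
  let ?h = "exp (\<i> * complex_of_real x / 2)"
  have "(\<alpha> * ?h) ^ (2 * k + 2 * m) = \<alpha> ^ (2 * (k + m)) * expi (int m + int k) x" for k
    using half_exp_power[of x "k + m"] by (simp add: power_mult_distrib add.commute)
  then show "y_fun \<alpha> m x = (\<Sum>k. y_coeff \<alpha> m k * expi (int m + int k) x)"
    unfolding y_fun_def mult.assoc[of 2 \<alpha>] bessel_J_double y_coeff_def by (simp add: mult.assoc)
qed

lemma fc_y_fun: "fc p (L2_class (y_fun \<alpha> m)) = (if p \<ge> int m then y_coeff \<alpha> m (nat (p - int m)) else 0)"
  unfolding y_fun_series by (rule trig_series_L2(2)[OF summable_y_coeff])

text \<open>In terms of \<open>\<alpha>\<^sup>2 exp(ix)\<close> the Bessel function of even order is a power series starting at exponent \<open>m\<close>,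
  and its coefficients satisfy \<open>k (2m + k) c k = - \<alpha>\<^sup>2 c (k - 1)\<close>.\<close>

lemma y_fun_in_kernel: "(L2_class (y_fun \<alpha> m), 0) \<in> op_minus (Hp \<alpha>) ((of_nat m)\<^sup>2)"
  unfolding op_minus_Hp_iff
proof
  fix p
  consider "p < int m" | "p = int m" | k where "p = int m + int (Suc k)"
    by (metis zless_iff_Suc_zadd linorder_less_linear)
  then show "fc p 0 = ((of_int p)\<^sup>2 - (of_nat m)\<^sup>2) * fc p (L2_class (y_fun \<alpha> m)) + \<alpha>\<^sup>2 * fc (p - 1) (L2_class (y_fun \<alpha> m))"
  proof cases
    case 3
    have "fc p (L2_class (y_fun \<alpha> m)) = y_coeff \<alpha> m (Suc k)" "fc (p - 1) (L2_class (y_fun \<alpha> m)) = y_coeff \<alpha> m k"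
      unfolding fc_y_fun 3 by (simp_all add: nat_add_distrib)
    moreover have "((of_int p)\<^sup>2 - (of_nat m)\<^sup>2) = (of_nat (Suc k) * of_nat (2 * m + Suc k) :: complex)"
      unfolding 3 by (simp add: algebra_simps power2_eq_square)
    moreover have "of_nat (Suc k) * of_nat (2 * m + Suc k) * y_coeff \<alpha> m (Suc k) = - \<alpha>\<^sup>2 * y_coeff \<alpha> m k"
    proof -
      have f: "(fact (Suc k) :: complex) = of_nat (Suc k) * fact k" "(fact (2 * m + Suc k) :: complex) = of_nat (2 * m + Suc k) * fact (2 * m + k)"
        by (simp_all del: of_nat_Suc)
      have nz: "of_nat (Suc k) \<noteq> (0::complex)" "of_nat (2 * m + Suc k) \<noteq> (0::complex)" by (simp_all del: of_nat_Suc of_nat_add)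
      have pw: "\<alpha> ^ (2 * (Suc k + m)) = \<alpha>\<^sup>2 * \<alpha> ^ (2 * (k + m))" by (simp add: power2_eq_square)
      show ?thesis unfolding y_coeff_def f pw using nz by (simp add: field_simps del: of_nat_Suc of_nat_add)
    qed
    ultimately show ?thesis by simp
  qed (simp_all add: fc_y_fun)
qed

lemma fc_y_fun_lowest_nonzero: "\<alpha> \<noteq> 0 \<Longrightarrow> fc (int m) (L2_class (y_fun \<alpha> m)) \<noteq> 0"
  by (simp add: fc_y_fun y_coeff_def)

text \<open>In the recursion \<open>(p\<^sup>2 - m\<^sup>2) u p + \<alpha>\<^sup>2 u (p-1) = 0\<close> one can always go down because \<open>\<alpha> \<noteq> 0\<close>, and one can
  go up beyond \<open>m\<close> because \<open>p\<^sup>2 \<noteq> m\<^sup>2\<close> for \<open>p > m\<close>.\<close>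

lemma kernel_determined_by_coefficient:
  assumes \<alpha>: "\<alpha> \<noteq> 0" and u: "(u, 0) \<in> op_minus (Hp \<alpha>) ((of_nat m)\<^sup>2)" and m: "fc (int m) u = 0"
  shows "u = 0"
proof (rule fourier_completeness)
  have rec: "((of_int p)\<^sup>2 - (of_nat m)\<^sup>2) * fc p u + \<alpha>\<^sup>2 * fc (p - 1) u = 0" for p
    using u by (auto simp: op_minus_Hp_iff)
  have down: "fc (int m - int k) u = 0" for k
  proof (induction k)
    case (Suc k)
    then have "\<alpha>\<^sup>2 * fc (int m - int k - 1) u = 0" using rec[of "int m - int k"] by simp
    then show ?case using \<alpha> by (simp add: algebra_simps)
  qed (simp add: m)
  have up: "fc (int m + int k) u = 0" for k
  proof (induction k)
    case (Suc k)
    define p where "p = int m + int (Suc k)"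
    have "(of_int p)\<^sup>2 - (of_nat m)\<^sup>2 = (of_nat (Suc k) * of_nat (2 * m + Suc k) :: complex)"
      by (simp add: p_def algebra_simps power2_eq_square)
    moreover have "of_nat (Suc k) * of_nat (2 * m + Suc k) \<noteq> (0::complex)" by (simp del: of_nat_Suc of_nat_add)
    ultimately have "(of_int p)\<^sup>2 - (of_nat m)\<^sup>2 \<noteq> (0::complex)" by metis
    moreover have "p - 1 = int m + int k" by (simp add: p_def)
    ultimately have "fc p u = 0" using rec[of p] Suc by simp
    then show ?case by (simp only: p_def)
  qed (simp add: m)
  show "fc p u = 0" for p
    using up[of "nat (p - int m)"] down[of "nat (int m - p)"] by (cases "p \<ge> int m") auto
qed

lemma kernel_eq_y_fun:
  assumes \<alpha>: "\<alpha> \<noteq> 0"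
  shows "op_ker (op_minus (Hp \<alpha>) ((of_nat m)\<^sup>2)) = {c *\<^sub>C L2_class (y_fun \<alpha> m) | c. True}"
proof (intro set_eqI iffI)
  let ?Y = "L2_class (y_fun \<alpha> m)"
  fix u assume "u \<in> op_ker (op_minus (Hp \<alpha>) ((of_nat m)\<^sup>2))"
  then have u: "(u, 0) \<in> op_minus (Hp \<alpha>) ((of_nat m)\<^sup>2)" by (simp add: op_ker_def)
  define c where "c = fc (int m) u / fc (int m) ?Y"
  have "(u - c *\<^sub>C ?Y, 0) \<in> op_minus (Hp \<alpha>) ((of_nat m)\<^sup>2)"
    using u op_minus_Hp_scaleC[OF y_fun_in_kernel[of \<alpha> m], of c] unfolding op_minus_Hp_iff fc_diff
    by (simp add: algebra_simps)
  moreover have "fc (int m) (u - c *\<^sub>C ?Y) = 0"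
    using fc_y_fun_lowest_nonzero[OF \<alpha>, of m] by (simp add: fc_diff fc_scaleC c_def)
  ultimately have "u - c *\<^sub>C ?Y = 0" by (rule kernel_determined_by_coefficient[OF \<alpha>])
  then show "u \<in> {c *\<^sub>C ?Y | c. True}" by auto
next
  fix u assume "u \<in> {c *\<^sub>C L2_class (y_fun \<alpha> m) | c. True}"
  then show "u \<in> op_ker (op_minus (Hp \<alpha>) ((of_nat m)\<^sup>2))"
    using op_minus_Hp_scaleC[OF y_fun_in_kernel[of \<alpha> m]] by (auto simp: op_ker_def)
qed

section \<open>Generalized eigenfunctions\<close>

lemma alternating_partial_binomial_sum:
  "(\<Sum>k\<le>M. (- 1) ^ k * of_nat (Suc P choose k)) = (- 1) ^ M * (of_nat (P choose M) :: complex)"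
  by (induction M) (simp_all add: algebra_simps)

text \<open>The coefficient of \<open>(\<alpha>\<^sup>2)\<^sup>q exp(iqx)\<close> in \<^const>\<open>ydot_fun\<close> is this weight for \<open>n = 2m\<close> and \<open>P = q + m\<close>; the
  sum over \<open>k\<close> collects the contributions of the Bessel functions of order \<open>k\<close>.\<close>

definition ydot_weight :: "nat \<Rightarrow> nat \<Rightarrow> complex" where
  "ydot_weight n P = fact (n - 1) * (\<Sum>k=0..n - 1. if k \<le> P
      then (- 1) ^ (P - k) / (of_nat (n - k) * fact k * (fact (P - k) * fact P)) else 0)"

text \<open>For each \<open>k\<close> the left-hand side collapses to a multiple of \<open>(-1)\<^sup>k (Suc P choose k)\<close>, so the sum over
  \<open>k\<close> is a partial alternating sum of binomial coefficients. It is nonzero only from \<open>Suc P = n\<close>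
  on: for \<open>n = 2m\<close> the right-hand side is, up to powers of \<open>\<alpha>\<close>, the coefficient sequence of \<^const>\<open>y_fun\<close>.\<close>

lemma ydot_weight_rec:
  assumes n: "n \<ge> 1"
  shows "of_nat (Suc P) * (of_nat (Suc P) - of_nat n) * ydot_weight n (Suc P) + ydot_weight n P
    = (if Suc P \<ge> n then (- 1) ^ (Suc P - n) / (fact (Suc P - n) * fact (Suc P)) else 0)"
proof -
  define T where "T P k = (if k \<le> P then (- 1) ^ (P - k) / (of_nat (n - k) * fact k * (fact (P - k) * fact P)) else (0::complex))" for P k
  have trm: "of_nat (Suc P) * (of_nat (Suc P) - of_nat n) * T (Suc P) k + T P k
      = (- 1) ^ P / (fact (Suc P) * fact P) * ((- 1) ^ k * of_nat (Suc P choose k))" if k: "k \<le> n - 1" for k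
  proof -
    have nk: "of_nat (n - k) = (of_nat n - of_nat k :: complex)" using k n by (simp add: of_nat_diff)
    have nk0: "of_nat n - of_nat k \<noteq> (0::complex)" using k n by simp
    have fP: "fact (Suc P) = of_nat (Suc P) * (fact P :: complex)" by (rule fact_Suc)
    have sP: "of_nat (Suc P) \<noteq> (0::complex)" by (rule of_nat_neq_0)
    consider "k \<le> P" | "k = Suc P" | "k > Suc P" by linarith
    then show ?thesis
    proof cases
      case 1
      define r where "r = P - k"
      have P: "P = k + r" using 1 by (simp add: r_def)
      have e1: "Suc P - k = Suc r" "P - k = r" using P by auto
      have fr: "fact (Suc r) = of_nat (Suc r) * (fact r :: complex)" by (rule fact_Suc)
      have sr: "of_nat (Suc r) \<noteq> (0::complex)" by (rule of_nat_neq_0)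
      have sg: "(- 1) ^ P * (- 1) ^ k = ((- 1) ^ r :: complex)" by (simp add: P power_add[symmetric] power_mult_distrib[symmetric]) (simp add: power_add flip: power_mult_distrib)
      have bin: "of_nat (Suc P choose k) = (fact (Suc P) / (fact k * fact (Suc r)) :: complex)"
        using binomial_fact[of k "Suc P", where 'a = complex] 1 e1 by simp
      have T1: "T (Suc P) k = - ((- 1) ^ r) / ((of_nat n - of_nat k) * fact k * (of_nat (Suc r) * fact r * (of_nat (Suc P) * fact P)))"
        using 1 by (simp only: T_def e1 nk fr fP) simp
      have T2: "T P k = (- 1) ^ r / ((of_nat n - of_nat k) * fact k * (fact r * fact P))"
        using 1 by (simp only: T_def e1 nk) simp
      have SPr: "of_nat (Suc P) = (of_nat k + of_nat (Suc r) :: complex)"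
        using arg_cong[OF P, of Suc] by (simp only: of_nat_add[symmetric] add_Suc_right)
      define s where "s = ((- 1) ^ r :: complex)"
      define S where "S = (of_nat (Suc P) :: complex)"
      define R where "R = (of_nat (Suc r) :: complex)"
      define d where "d = (of_nat n - of_nat k :: complex)"
      have nn: "(of_nat n :: complex) = d + (S - R)" unfolding d_def S_def R_def SPr by simp
      have ne: "S \<noteq> 0" "R \<noteq> 0" "d \<noteq> 0" using sP sr nk0 by (auto simp: S_def R_def d_def)
      have aux1: "S * (S - (d + (S - R))) * (- s / (d * f * (R * g * (S * q)))) + s / (d * f * (g * q)) = s / (f * (R * g) * q)"
        if "f \<noteq> 0" "g \<noteq> 0" "q \<noteq> 0" for f g q
      proof -
        have "S * (S - (d + (S - R))) * (- s / (d * f * (R * g * (S * q)))) = (d - R) * (s / (d * f * R * g * q))"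
          using ne that by (simp add: divide_simps) (simp add: algebra_simps)
        moreover have "s / (d * f * (g * q)) = R * (s / (d * f * R * g * q))"
          using ne that by (simp add: divide_simps)
        moreover have "s / (f * (R * g) * q) = d * (s / (d * f * R * g * q))"
          using ne that by (simp add: divide_simps)
        ultimately show ?thesis by (simp only: distrib_right[symmetric]) simp
      qed
      have aux2: "a / (x * q) * (b * (x / h)) = (a * b) / (h * q)" if "x \<noteq> 0" for a b x q h :: complex
        using that by simp
      have "S * (S - of_nat n) * T (Suc P) k + T P k = s / (fact k * (R * fact r) * fact P)"
        unfolding T1 T2 d_def[symmetric] s_def[symmetric] S_def[symmetric] R_def[symmetric]
        by (simp only: nn aux1[OF fact_nonzero fact_nonzero fact_nonzero])
      also have "\<dots> = (- 1) ^ P / (fact (Suc P) * fact P) * ((- 1) ^ k * of_nat (Suc P choose k))"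
        unfolding bin fr by (subst aux2) (simp_all only: fact_nonzero sg s_def R_def not_False_eq_True simp_thms)
      finally show ?thesis unfolding S_def .
    next
      case 2
      have T1: "T (Suc P) k = 1 / ((of_nat n - of_nat (Suc P)) * fact (Suc P) * fact (Suc P))" "T P k = 0"
        using nk unfolding T_def 2 by (simp_all del: fact_Suc of_nat_Suc)
      have "of_nat (Suc P) * (of_nat (Suc P) - of_nat n) * T (Suc P) k = - of_nat (Suc P) / (fact (Suc P) * (fact (Suc P) :: complex))"
        unfolding T1 using nk0 2 by (simp add: divide_simps del: fact_Suc of_nat_Suc) (simp add: algebra_simps del: fact_Suc of_nat_Suc)
      also have "\<dots> = - 1 / (fact (Suc P) * fact P)"
        unfolding fP using sP by (simp add: divide_simps del: fact_Suc of_nat_Suc)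
      also have "\<dots> = (- 1) ^ P / (fact (Suc P) * fact P) * ((- 1) ^ k * of_nat (Suc P choose k))"
        unfolding 2 by (simp add: power_mult_distrib[symmetric] del: fact_Suc of_nat_Suc)
      finally show ?thesis using T1 by simp
    next
      case 3
      then show ?thesis by (simp add: T_def)
    qed
  qed
  have W: "ydot_weight n P = fact (n - 1) * (\<Sum>k\<le>n - 1. T P k)" for P
    unfolding ydot_weight_def T_def by (simp add: atLeast0AtMost)
  have "of_nat (Suc P) * (of_nat (Suc P) - of_nat n) * ydot_weight n (Suc P) + ydot_weight n P
     = fact (n - 1) * (\<Sum>k\<le>n - 1. of_nat (Suc P) * (of_nat (Suc P) - of_nat n) * T (Suc P) k + T P k)"
    unfolding W sum.distrib sum_distrib_left[symmetric] by (simp only: distrib_left mult.left_commute)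
  also have "(\<Sum>k\<le>n - 1. of_nat (Suc P) * (of_nat (Suc P) - of_nat n) * T (Suc P) k + T P k)
     = (\<Sum>k\<le>n - 1. (- 1) ^ P / (fact (Suc P) * fact P) * ((- 1) ^ k * of_nat (Suc P choose k)))"
    by (intro sum.cong refl trm) simp
  also have "\<dots> = (- 1) ^ P / (fact (Suc P) * fact P) * ((- 1) ^ (n - 1) * of_nat (P choose (n - 1)))"
    unfolding sum_distrib_left[symmetric] alternating_partial_binomial_sum ..
  also have "fact (n - 1) * \<dots> = (if Suc P \<ge> n then (- 1) ^ (Suc P - n) / (fact (Suc P - n) * fact (Suc P)) else 0)"
  proof (cases "Suc P \<ge> n")
    case True
    define r where "r = Suc P - n"
    have P: "P = (n - 1) + r" and r: "P - (n - 1) = r" using True n by (auto simp: r_def)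
    have bin: "of_nat (P choose (n - 1)) = (fact P / (fact (n - 1) * fact r) :: complex)"
      using binomial_fact[of "n - 1" P, where 'a = complex] r P by simp
    have sg: "(- 1) ^ P * (- 1) ^ (n - 1) = ((- 1) ^ r :: complex)"
      unfolding P power_add by (simp flip: power_mult_distrib)
    have "fact (n - 1) * ((- 1) ^ P / (fact (Suc P) * fact P) * ((- 1) ^ (n - 1) * (fact P / (fact (n - 1) * fact r))))
       = ((- 1) ^ P * (- 1) ^ (n - 1)) / (fact r * (fact (Suc P) :: complex))"
      by (simp add: field_simps del: fact_Suc)
    then show ?thesis using True unfolding bin sg r_def[symmetric] by simp
  next
    case False
    then have "P choose (n - 1) = 0" by (intro binomial_eq_0) simp
    then show ?thesis using False by simp
  qed
  finally show ?thesis .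
qed

text \<open>In each summand the powers of \<open>w = \<alpha> exp(ix/2)\<close> combine to the even exponents \<open>2 (k + j - m)\<close>, so that it is
  a trigonometric series with integer frequencies.\<close>

lemma fc_ydot_fun:
  assumes \<alpha>: "\<alpha> \<noteq> 0" and m: "m \<ge> 1"
  shows "square_integrable (ydot_fun \<alpha> m)"
    "fc q (L2_class (ydot_fun \<alpha> m)) =
      (if q \<ge> - int m then ydot_weight (2 * m) (nat (q + int m)) * (\<alpha>\<^sup>2) powi q else 0)"
proof -
  define B where "B k j = (- 1) ^ j / (fact j * fact (k + j)) * (\<alpha>\<^sup>2) powi (int (k + j) - int m)" for k j
  define c where "c k = 1 / (of_nat (2 * m - k) * fact k :: complex)" for k
  have sB: "summable (\<lambda>j. norm (B k j))" for k
  proof -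
    have "norm (B k j) = norm ((- 1) ^ j / (fact j * fact (k + j)) * (\<alpha>\<^sup>2) ^ j) * norm ((\<alpha>\<^sup>2) powi (int k - int m))" for j
    proof -
      have "int (k + j) - int m = int j + (int k - int m)" by simp
      then have "(\<alpha>\<^sup>2) powi (int (k + j) - int m) = (\<alpha>\<^sup>2) ^ j * (\<alpha>\<^sup>2) powi (int k - int m)"
        using \<alpha> by (simp only: power_int_add power_int_of_nat power2_eq_square) (simp add: power_int_add)
      then show ?thesis by (simp only: B_def norm_mult mult.assoc)
    qed
    then show ?thesis using summable_mult2[OF summable_bessel[of k "\<alpha>\<^sup>2"]] by simp
  qed
  define f where "f k x = (\<Sum>j. B k j * expi (int k - int m + int j) x)" for k x
  have f: "square_integrable (f k)" "fc q (L2_class (f k)) = (if q \<ge> int k - int m then B k (nat (q - (int k - int m))) else 0)" for k q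
    unfolding f_def[abs_def] by (rule trig_series_L2[OF sB])+
  have trm: "(\<alpha> * exp (\<i> * complex_of_real x / 2)) powi (int k - int (2 * m)) * bessel_J k (2 * \<alpha> * exp (\<i> * complex_of_real x / 2)) = f k x" for k x
  proof -
    define h where "h = exp (\<i> * complex_of_real x / 2)"
    define w where "w = \<alpha> * h"
    have w: "w \<noteq> 0" "h \<noteq> 0" using \<alpha> by (auto simp: w_def h_def)
    have sj: "summable (\<lambda>j. (- 1) ^ j / (fact j * fact (k + j)) * (w\<^sup>2) ^ j)"
      by (rule summable_norm_cancel[OF summable_bessel])
    have pw: "w powi (int k - int (2 * m)) * w ^ (2 * j + k) = (\<alpha>\<^sup>2) powi (int (k + j) - int m) * expi (int k - int m + int j) x" for j
    proof -
      have "w powi (int k - int (2 * m)) * w ^ (2 * j + k) = w powi (int k - int (2 * m) + int (2 * j + k))"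
        using w by (simp add: power_int_add power_int_of_nat del: of_nat_add of_nat_mult)
      also have "int k - int (2 * m) + int (2 * j + k) = 2 * (int (k + j) - int m)" by simp
      also have "w powi (2 * (int (k + j) - int m)) = \<alpha> powi (2 * (int (k + j) - int m)) * h powi (2 * (int (k + j) - int m))"
        unfolding w_def by (rule power_int_mult_distrib)
      also have "h powi (2 * (int (k + j) - int m)) = expi (int k - int m + int j) x"
        unfolding h_def half_exp_powi by (simp add: algebra_simps)
      also have "\<alpha> powi (2 * (int (k + j) - int m)) = (\<alpha>\<^sup>2) powi (int (k + j) - int m)"
        unfolding power_int_mult by simp
      finally show ?thesis .
    qed
    have "summable (\<lambda>j. (- 1) ^ j / (fact j * fact (k + j)) * w ^ (2 * j + k))"
      using summable_mult2[OF sj, of "w ^ k"] by (simp add: power_add power_mult mult.assoc)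
    then have "w powi (int k - int (2 * m)) * bessel_J k (2 * w)
        = (\<Sum>j. w powi (int k - int (2 * m)) * ((- 1) ^ j / (fact j * fact (k + j)) * w ^ (2 * j + k)))"
      unfolding bessel_J_double by (rule suminf_mult[symmetric])
    also have "\<dots> = f k x"
      unfolding f_def B_def
    proof (intro suminf_cong)
      fix j
      show "w powi (int k - int (2 * m)) * ((- 1) ^ j / (fact j * fact (k + j)) * w ^ (2 * j + k)) =
         (- 1) ^ j / (fact j * fact (k + j)) * (\<alpha>\<^sup>2) powi (int (k + j) - int m) * expi (int k - int m + int j) x"
        using pw[of j] by (simp only: mult.assoc mult.left_commute[of "w powi _"])
    qed
    finally show ?thesis by (simp add: w_def h_def mult.assoc)
  qed
  have yd: "ydot_fun \<alpha> m = (\<lambda>x. fact (2 * m - 1) * (\<Sum>k=0..2 * m - 1. c k * f k x))"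
    unfolding ydot_fun_def[abs_def] mult.assoc[of "1 / _"] trm[symmetric] c_def by (simp only: mult.assoc)
  have sum: "square_integrable (\<lambda>x. \<Sum>k=0..2 * m - 1. c k * f k x)"
    "(\<Sum>k=0..2 * m - 1. L2_class (\<lambda>x. c k * f k x)) = L2_class (\<lambda>x. \<Sum>k=0..2 * m - 1. c k * f k x)"
    using L2_class_sum[of "{0..2 * m - 1}" "\<lambda>k x. c k * f k x"] square_integrable_scale[OF f(1)] by auto
  show "square_integrable (ydot_fun \<alpha> m)" unfolding yd by (rule square_integrable_scale[OF sum(1)])
  have "L2_class (ydot_fun \<alpha> m) = fact (2 * m - 1) *\<^sub>C (\<Sum>k=0..2 * m - 1. c k *\<^sub>C L2_class (f k))"
    unfolding yd L2_class_scale[OF sum(1), symmetric] sum(2)[symmetric] L2_class_scale[OF f(1)] ..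
  then have *: "fc q (L2_class (ydot_fun \<alpha> m)) = fact (2 * m - 1) * (\<Sum>k=0..2 * m - 1. c k * (if q \<ge> int k - int m then B k (nat (q - (int k - int m))) else 0))"
    by (simp only: fc_scaleC fc_sum f(2))
  show "fc q (L2_class (ydot_fun \<alpha> m)) =
      (if q \<ge> - int m then ydot_weight (2 * m) (nat (q + int m)) * (\<alpha>\<^sup>2) powi q else 0)"
  proof (cases "q \<ge> - int m")
    case False
    then show ?thesis unfolding * by (auto intro!: sum.neutral)
  next
    case True
    define P where "P = nat (q + int m)"
    have q: "q = int P - int m" using True by (simp add: P_def)
    have "c k * (if q \<ge> int k - int m then B k (nat (q - (int k - int m))) else 0)
       = (if k \<le> P then (- 1) ^ (P - k) / (of_nat (2 * m - k) * fact k * (fact (P - k) * fact P)) else 0) * (\<alpha>\<^sup>2) powi q" for k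
    proof (cases "k \<le> P")
      case True
      then have "nat (q - (int k - int m)) = P - k" "q \<ge> int k - int m" "k + (P - k) = P" by (auto simp: q)
      then show ?thesis using True by (simp add: B_def c_def q)
    qed (simp add: q)
    then have "fc q (L2_class (ydot_fun \<alpha> m)) = ydot_weight (2 * m) P * (\<alpha>\<^sup>2) powi q"
      unfolding * ydot_weight_def by (simp only: sum_distrib_right[symmetric] mult.assoc)
    then show ?thesis using True by (simp add: P_def)
  qed
qed

text \<open>With \<open>p = P + 1 - m\<close> one has \<open>p\<^sup>2 - m\<^sup>2 = (P + 1) (P + 1 - 2m)\<close>, which is the factor in the recursion for the
  weights.\<close>

lemma ydot_fun_generalized:
  assumes \<alpha>: "\<alpha> \<noteq> 0" and m: "m \<ge> 1"
  shows "(L2_class (ydot_fun \<alpha> m), L2_class (y_fun \<alpha> m)) \<in> op_minus (Hp \<alpha>) ((of_nat m)\<^sup>2)"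
  unfolding op_minus_Hp_iff
proof
  fix p
  let ?d = "\<lambda>p. fc p (L2_class (ydot_fun \<alpha> m))"
  consider "p < - int m" | "p = - int m" | P where "p = - int m + int (Suc P)"
    by (metis zless_iff_Suc_zadd linorder_less_linear)
  then show "fc p (L2_class (y_fun \<alpha> m)) = ((of_int p)\<^sup>2 - (of_nat m)\<^sup>2) * ?d p + \<alpha>\<^sup>2 * ?d (p - 1)"
  proof cases
    case 1
    then show ?thesis by (simp add: fc_ydot_fun(2)[OF \<alpha> m] fc_y_fun)
  next
    case 2
    then show ?thesis using m by (simp add: fc_ydot_fun(2)[OF \<alpha> m] fc_y_fun)
  next
    case 3
    have n: "nat (p + int m) = Suc P" "nat (p - 1 + int m) = P" using 3 by auto
    have d: "?d p = ydot_weight (2 * m) (Suc P) * (\<alpha>\<^sup>2) powi p" "?d (p - 1) = ydot_weight (2 * m) P * (\<alpha>\<^sup>2) powi (p - 1)"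
      unfolding fc_ydot_fun(2)[OF \<alpha> m] n using 3 by simp_all
    have pw: "\<alpha>\<^sup>2 * (\<alpha>\<^sup>2) powi (p - 1) = (\<alpha>\<^sup>2) powi p"
      using \<alpha> power_int_add[of "\<alpha>\<^sup>2" 1 "p - 1"] by simp
    have fac: "(of_int p)\<^sup>2 - (of_nat m)\<^sup>2 = (of_nat (Suc P) * (of_nat (Suc P) - of_nat (2 * m)) :: complex)"
      unfolding 3 by (simp add: algebra_simps power2_eq_square)
    have "((of_int p)\<^sup>2 - (of_nat m)\<^sup>2) * ?d p + \<alpha>\<^sup>2 * ?d (p - 1)
      = (of_nat (Suc P) * (of_nat (Suc P) - of_nat (2 * m)) * ydot_weight (2 * m) (Suc P) + ydot_weight (2 * m) P) * (\<alpha>\<^sup>2) powi p"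
      unfolding d fac pw[symmetric] by (simp only: distrib_right mult.assoc mult.left_commute[of "\<alpha>\<^sup>2"])
    also have "\<dots> = (if Suc P \<ge> 2 * m then (- 1) ^ (Suc P - 2 * m) / (fact (Suc P - 2 * m) * fact (Suc P)) else 0) * (\<alpha>\<^sup>2) powi p"
      using m by (subst ydot_weight_rec) auto
    also have "\<dots> = fc p (L2_class (y_fun \<alpha> m))"
    proof (cases "Suc P \<ge> 2 * m")
      case True
      define k where "k = Suc P - 2 * m"
      have p: "p = int (m + k)" "Suc P = 2 * m + k" "nat (p - int m) = k" using True 3 by (auto simp: k_def)
      have "(\<alpha>\<^sup>2) powi p = \<alpha> ^ (2 * (k + m))"
        unfolding p(1) power_int_of_nat by (simp add: power_mult[symmetric] add.commute)
      then show ?thesis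
        unfolding fc_y_fun p(3) y_coeff_def using True p(1) by (simp only: k_def[symmetric] p(2) if_True) simp
    next
      case False
      then show ?thesis using 3 by (simp add: fc_y_fun)
    qed
    finally show ?thesis ..
  qed
qed

section \<open>Spectrum, eigenspaces and multiplicities\<close>

lemma squares_isolated: "squares \<inter> cball ((of_nat m)\<^sup>2) (1 / 2) = {(of_nat m)\<^sup>2}"
proof (intro set_eqI iffI)
  fix z :: complex assume z: "z \<in> squares \<inter> cball ((of_nat m)\<^sup>2) (1 / 2)"
  then obtain n :: nat where n: "z = (of_nat n)\<^sup>2" by (auto simp: squares_def)
  have "dist ((of_nat m)\<^sup>2) z = cmod (of_int (int (m\<^sup>2) - int (n\<^sup>2)))"
    unfolding n dist_norm by simp
  also have "\<dots> = \<bar>real_of_int (int (m\<^sup>2) - int (n\<^sup>2))\<bar>" by (rule norm_of_int)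
  finally have "\<bar>real_of_int (int (m\<^sup>2) - int (n\<^sup>2))\<bar> \<le> 1 / 2" using z by simp
  then have "int (m\<^sup>2) - int (n\<^sup>2) = 0" by linarith
  then have "m\<^sup>2 = n\<^sup>2" by linarith
  then show "z \<in> {(of_nat m)\<^sup>2}" using n by (simp add: power2_eq_iff)
qed (auto simp: squares_def)

lemma op_minus_Hp_add:
  assumes "(u, v) \<in> op_minus (Hp \<alpha>) l" "(u', v') \<in> op_minus (Hp \<alpha>) l"
  shows "(u + u', v + v') \<in> op_minus (Hp \<alpha>) l"
  using assms unfolding op_minus_Hp_iff fc_add by (simp add: distrib_left)

lemma op_minus_Hp_diff:
  assumes "(u, v) \<in> op_minus (Hp \<alpha>) l" "(u', v') \<in> op_minus (Hp \<alpha>) l"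
  shows "(u - u', v - v') \<in> op_minus (Hp \<alpha>) l"
  using op_minus_Hp_add[OF assms(1) op_minus_Hp_scaleC[OF assms(2), of "- 1"]] by simp

lemma fourier_basis_nonzero: "fourier_basis p \<noteq> 0"
  using fc_fourier_basis[of p p] by auto

lemma y_fun_nonzero: "\<alpha> \<noteq> 0 \<Longrightarrow> L2_class (y_fun \<alpha> m) \<noteq> 0"
  using fc_y_fun_lowest_nonzero[of \<alpha> m] by auto

lemma free_kernel:
  "op_ker (op_minus (Hp 0) ((of_nat m)\<^sup>2)) = {c *\<^sub>C fourier_basis (int m) + d *\<^sub>C fourier_basis (- int m) | c d. True}"
proof (intro set_eqI iffI)
  fix u assume "u \<in> op_ker (op_minus (Hp 0) ((of_nat m)\<^sup>2))"
  then have u: "((of_int p)\<^sup>2 - (of_nat m)\<^sup>2) * fc p u = 0" for p by (auto simp: op_ker_op_minus_Hp_iff)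
  have z: "fc p u = 0" if "p \<noteq> int m" "p \<noteq> - int m" for p
    using u[of p] int_square_eq_subset[of m] that by auto
  define d where "d = (if m = 0 then 0 else fc (- int m) u)"
  have "u = fc (int m) u *\<^sub>C fourier_basis (int m) + d *\<^sub>C fourier_basis (- int m)"
    by (rule fourier_ext) (auto simp: fc_add fc_scaleC fc_fourier_basis d_def z)
  then show "u \<in> {c *\<^sub>C fourier_basis (int m) + d *\<^sub>C fourier_basis (- int m) | c d. True}" by blast
next
  fix u assume "u \<in> {c *\<^sub>C fourier_basis (int m) + d *\<^sub>C fourier_basis (- int m) | c d. True}"
  then show "u \<in> op_ker (op_minus (Hp 0) ((of_nat m)\<^sup>2))"
    by (auto simp: op_ker_op_minus_Hp_iff fc_add fc_scaleC fc_fourier_basis split: if_splits)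
qed

lemma Hp_eigenvector_exists: "\<exists>u. eigenvector (Hp \<alpha>) ((of_nat m)\<^sup>2) u"
proof (cases "\<alpha> = 0")
  case True
  have "fourier_basis (int m) = 1 *\<^sub>C fourier_basis (int m) + 0 *\<^sub>C fourier_basis (- int m)" by simp
  then have "fourier_basis (int m) \<in> op_ker (op_minus (Hp 0) ((of_nat m)\<^sup>2))"
    unfolding free_kernel by blast
  then show ?thesis unfolding True eigenvector_def using fourier_basis_nonzero by blast
next
  case False
  then show ?thesis unfolding eigenvector_def op_ker_def using y_fun_in_kernel y_fun_nonzero by blast
qed

theorem spectrum_Hp: "spectrum (Hp \<alpha>) = squares"
proof
  show "squares \<subseteq> spectrum (Hp \<alpha>)"
    using Hp_eigenvector_exists[of \<alpha>] eigenvalue_in_spectrum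
    unfolding eigenvector_def op_ker_def squares_def by blast
qed (rule Hp_spectrum_subset)

text \<open>The radius in the definition of the Riesz projection is an unspecified admissible one, so the
  computation of the range is applied to whatever radius has been chosen.\<close>

lemma alg_eigenspace_eq_ker2:
  "alg_eigenspace (Hp \<alpha>) ((of_nat m)\<^sup>2) =
    {u. \<exists>v. (u, v) \<in> op_minus (Hp \<alpha>) ((of_nat m)\<^sup>2) \<and> (v, 0) \<in> op_minus (Hp \<alpha>) ((of_nat m)\<^sup>2)}"
proof -
  define e where "e = riesz_radius (Hp \<alpha>) ((of_nat m)\<^sup>2)"
  have "0 < e \<and> spectrum (Hp \<alpha>) \<inter> cball ((of_nat m)\<^sup>2) e = {(of_nat m)\<^sup>2}"
    unfolding e_def riesz_radius_def
    by (rule someI[of _ "1/2"]) (simp add: spectrum_Hp squares_isolated)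
  then interpret isolated_square \<alpha> m e
    by unfold_locales (auto simp: spectrum_Hp)
  have "riesz_projection (Hp \<alpha>) ((of_nat m)\<^sup>2) = moment 0"
    unfolding riesz_projection_def Let_def moment_def R_def \<zeta>_def l_def e_def[symmetric] by simp
  then show ?thesis
    unfolding alg_eigenspace_def using range_moment_0 by (simp add: l_def)
qed

text \<open>There are no generalized eigenvectors in these cases. For \<open>\<alpha> = 0\<close> the operator is diagonal. For
  \<open>m = 0\<close> and \<open>\<alpha> \<noteq> 0\<close> let \<open>v = (Hp \<alpha>) u\<close> be in the kernel. Its coefficients of negative index vanish, hence
  those of \<open>u\<close> do, and then the recursion at \<open>p = 0\<close> says that the coefficient of \<open>v\<close> at \<open>0\<close>, which
  determines \<open>v\<close>, is zero.\<close>

lemma alg_eigenspace_eq_kernel: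
  assumes "\<alpha> = 0 \<or> m = 0"
  shows "alg_eigenspace (Hp \<alpha>) ((of_nat m)\<^sup>2) = op_ker (op_minus (Hp \<alpha>) ((of_nat m)\<^sup>2))"
proof (intro set_eqI iffI)
  fix u assume "u \<in> alg_eigenspace (Hp \<alpha>) ((of_nat m)\<^sup>2)"
  then obtain v where uv: "(u, v) \<in> op_minus (Hp \<alpha>) ((of_nat m)\<^sup>2)" and v: "(v, 0) \<in> op_minus (Hp \<alpha>) ((of_nat m)\<^sup>2)"
    unfolding alg_eigenspace_eq_ker2 by blast
  have "v = 0"
  proof (cases "\<alpha> = 0")
    case True
    have "fc p v = 0" for p
    proof -
      have "fc p v = ((of_int p)\<^sup>2 - (of_nat m)\<^sup>2) * fc p u" "((of_int p)\<^sup>2 - (of_nat m)\<^sup>2) * fc p v = 0"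
        using uv v True by (auto simp: op_minus_Hp_iff)
      then show ?thesis by auto
    qed
    then show ?thesis by (rule fourier_completeness)
  next
    case False
    then have m: "m = 0" using assms by auto
    obtain c where c: "v = c *\<^sub>C L2_class (y_fun \<alpha> m)"
      using v kernel_eq_y_fun[OF False, of m] unfolding op_ker_def by blast
    have recu: "fc p v = (of_int p)\<^sup>2 * fc p u + \<alpha>\<^sup>2 * fc (p - 1) u" for p
      using uv unfolding op_minus_Hp_iff m by simp
    have v0: "fc p v = 0" if "p \<le> - 1" for p
      using that m by (simp add: c fc_scaleC fc_y_fun)
    have "fc (- 1) u = 0"
      by (rule fourier_recursion_zero_below[of "\<lambda>p. fc p u" "norm u" "- 1" 0 "\<alpha>\<^sup>2"])
         (use recu v0 in \<open>auto simp: norm_fc_le\<close>)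
    then have "fc 0 v = 0" using recu[of 0] by simp
    then have "fc (int m) v = 0" by (simp add: m)
    with False v show ?thesis by (intro kernel_determined_by_coefficient)
  qed
  then show "u \<in> op_ker (op_minus (Hp \<alpha>) ((of_nat m)\<^sup>2))" using uv by (simp add: op_ker_def)
next
  fix u assume "u \<in> op_ker (op_minus (Hp \<alpha>) ((of_nat m)\<^sup>2))"
  moreover have "(0, 0) \<in> op_minus (Hp \<alpha>) ((of_nat m)\<^sup>2)" by (simp add: op_minus_Hp_iff)
  ultimately show "u \<in> alg_eigenspace (Hp \<alpha>) ((of_nat m)\<^sup>2)"
    unfolding alg_eigenspace_eq_ker2 op_ker_def by blast
qed

lemma alg_eigenspace_eq_span_y_ydot:
  assumes \<alpha>: "\<alpha> \<noteq> 0" and m: "m \<ge> 1"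
  shows "alg_eigenspace (Hp \<alpha>) ((of_nat m)\<^sup>2) =
    {c *\<^sub>C L2_class (y_fun \<alpha> m) + d *\<^sub>C L2_class (ydot_fun \<alpha> m) | c d. True}"
proof (intro set_eqI iffI)
  let ?Y = "L2_class (y_fun \<alpha> m)" and ?Z = "L2_class (ydot_fun \<alpha> m)" and ?A = "op_minus (Hp \<alpha>) ((of_nat m)\<^sup>2)"
  fix u assume "u \<in> alg_eigenspace (Hp \<alpha>) ((of_nat m)\<^sup>2)"
  then obtain v where uv: "(u, v) \<in> ?A" and v: "(v, 0) \<in> ?A"
    unfolding alg_eigenspace_eq_ker2 by blast
  then obtain d where d: "v = d *\<^sub>C ?Y"
    using kernel_eq_y_fun[OF \<alpha>, of m] unfolding op_ker_def by blast
  have "(d *\<^sub>C ?Z, v) \<in> ?A" unfolding d by (rule op_minus_Hp_scaleC[OF ydot_fun_generalized[OF \<alpha> m]])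
  then have "(u - d *\<^sub>C ?Z, 0) \<in> ?A"
    using op_minus_Hp_diff[OF uv] by fastforce
  then obtain c where "u - d *\<^sub>C ?Z = c *\<^sub>C ?Y"
    using kernel_eq_y_fun[OF \<alpha>, of m] unfolding op_ker_def by blast
  then have "u = c *\<^sub>C ?Y + d *\<^sub>C ?Z" by (simp add: diff_eq_eq)
  then show "u \<in> {c *\<^sub>C ?Y + d *\<^sub>C ?Z | c d. True}" by blast
next
  let ?Y = "L2_class (y_fun \<alpha> m)" and ?Z = "L2_class (ydot_fun \<alpha> m)" and ?A = "op_minus (Hp \<alpha>) ((of_nat m)\<^sup>2)"
  fix u assume "u \<in> {c *\<^sub>C ?Y + d *\<^sub>C ?Z | c d. True}"
  then obtain c d where u: "u = c *\<^sub>C ?Y + d *\<^sub>C ?Z" by blast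
  have "(c *\<^sub>C ?Y, c *\<^sub>C 0) \<in> ?A" "(d *\<^sub>C ?Z, d *\<^sub>C ?Y) \<in> ?A"
    by (intro op_minus_Hp_scaleC y_fun_in_kernel ydot_fun_generalized[OF \<alpha> m])+
  then have "(u, d *\<^sub>C ?Y) \<in> ?A"
    using op_minus_Hp_add unfolding u by fastforce
  moreover have "(d *\<^sub>C ?Y, d *\<^sub>C 0) \<in> ?A" by (intro op_minus_Hp_scaleC y_fun_in_kernel)
  then have "(d *\<^sub>C ?Y, 0) \<in> ?A" by simp
  ultimately show "u \<in> alg_eigenspace (Hp \<alpha>) ((of_nat m)\<^sup>2)"
    unfolding alg_eigenspace_eq_ker2 by blast
qed

lemma span_single: "cvec.span {a :: L2} = {c *\<^sub>C a | c. True}"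
  by (auto simp: cvec.span_singleton)

lemma span_pair: "cvec.span {a, b :: L2} = {c *\<^sub>C a + d *\<^sub>C b | c d. True}"
  by (auto simp: cvec.span_insert cvec.span_singleton diff_eq_eq) (metis add.commute)+

lemma dim_line:
  assumes "(a :: L2) \<noteq> 0" shows "cvec.dim {c *\<^sub>C a | c. True} = 1"
proof -
  have "cvec.independent {a}" using assms by simp
  then have "cvec.dim (cvec.span {a}) = card {a}" by (rule cvec.dim_span_eq_card_independent)
  then show ?thesis by (simp add: span_single)
qed

lemma dim_plane:
  assumes "\<And>c d. c *\<^sub>C (a :: L2) + d *\<^sub>C b = 0 \<Longrightarrow> c = 0 \<and> d = 0"
  shows "cvec.dim {c *\<^sub>C a + d *\<^sub>C b | c d. True} = 2"
proof -
  have b: "b \<noteq> 0" using assms[of 0 1] by auto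
  have a: "a \<notin> cvec.span {b}"
  proof
    assume "a \<in> cvec.span {b}"
    then obtain d where "a = d *\<^sub>C b" by (auto simp: span_single)
    then have "1 *\<^sub>C a + (- d) *\<^sub>C b = 0" by simp
    then show False using assms by fastforce
  qed
  then have "a \<noteq> b" using cvec.span_base[of b "{b}"] by auto
  have "cvec.independent {a, b}"
    using a b \<open>a \<noteq> b\<close> by (simp add: cvec.independent_insert)
  then have "cvec.dim (cvec.span {a, b}) = card {a, b}" by (rule cvec.dim_span_eq_card_independent)
  then show ?thesis using \<open>a \<noteq> b\<close> by (simp add: span_pair)
qed

lemma y_ydot_independent:
  assumes \<alpha>: "\<alpha> \<noteq> 0" and m: "m \<ge> 1"
    and z: "c *\<^sub>C L2_class (y_fun \<alpha> m) + d *\<^sub>C L2_class (ydot_fun \<alpha> m) = 0"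
  shows "c = 0 \<and> d = 0"
proof -
  let ?Y = "L2_class (y_fun \<alpha> m)" and ?Z = "L2_class (ydot_fun \<alpha> m)" and ?A = "op_minus (Hp \<alpha>) ((of_nat m)\<^sup>2)"
  have "(c *\<^sub>C ?Y, c *\<^sub>C 0) \<in> ?A" "(d *\<^sub>C ?Z, d *\<^sub>C ?Y) \<in> ?A"
    by (intro op_minus_Hp_scaleC y_fun_in_kernel ydot_fun_generalized[OF \<alpha> m])+
  then have "(c *\<^sub>C ?Y + d *\<^sub>C ?Z, d *\<^sub>C ?Y) \<in> ?A"
    using op_minus_Hp_add by fastforce
  then have "fc p (d *\<^sub>C ?Y) = 0" for p unfolding z op_minus_Hp_iff by simp
  then have "d *\<^sub>C ?Y = 0" by (rule fourier_completeness)
  then have "d = 0" using y_fun_nonzero[OF \<alpha>, of m] by simp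
  then have "c *\<^sub>C ?Y = 0" using z by simp
  then show ?thesis using y_fun_nonzero[OF \<alpha>, of m] \<open>d = 0\<close> by simp
qed

lemma fourier_basis_pair_independent:
  assumes "p \<noteq> q" "c *\<^sub>C fourier_basis p + d *\<^sub>C fourier_basis q = 0"
  shows "c = 0 \<and> d = 0"
  using arg_cong[OF assms(2), of "fc p"] arg_cong[OF assms(2), of "fc q"] assms(1)
  by (simp add: fc_add fc_scaleC fc_fourier_basis)

lemma free_kernel_functions:
  "op_ker (op_minus (Hp 0) ((of_nat m)\<^sup>2)) =
    {L2_class (\<lambda>x. c * exp (\<i> * of_nat m * complex_of_real x) + d * exp (- \<i> * of_nat m * complex_of_real x)) | c d. True}"
proof -
  have "c *\<^sub>C fourier_basis (int m) + d *\<^sub>C fourier_basis (- int m) =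
     L2_class (\<lambda>x. c * exp (\<i> * of_nat m * complex_of_real x) + d * exp (- \<i> * of_nat m * complex_of_real x))" for c d
    unfolding fourier_basis_def
    by (simp add: L2_class_scale L2_class_add square_integrable_scale square_integrable_expi) (simp add: expi_def)
  then show ?thesis unfolding free_kernel by simp
qed

lemma free_kernel_dim: "cvec.dim (op_ker (op_minus (Hp 0) ((of_nat m)\<^sup>2))) = (if m = 0 then 1 else 2)"
proof (cases "m = 0")
  case True
  have "{c *\<^sub>C fourier_basis (int m) + d *\<^sub>C fourier_basis (- int m) | c d. True} = {c *\<^sub>C fourier_basis 0 | c. True}"
    using True by (auto simp flip: cvec.scale_left_distrib) (metis add.right_neutral)
  then show ?thesis unfolding free_kernel using True dim_line[OF fourier_basis_nonzero] by simp
next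
  case False
  then have "cvec.dim {c *\<^sub>C fourier_basis (int m) + d *\<^sub>C fourier_basis (- int m) | c d. True} = 2"
    by (intro dim_plane fourier_basis_pair_independent[of "int m" "- int m"]) auto
  then show ?thesis unfolding free_kernel using False by simp
qed

lemma kernel_dim: "\<alpha> \<noteq> 0 \<Longrightarrow> cvec.dim (op_ker (op_minus (Hp \<alpha>) ((of_nat m)\<^sup>2))) = 1"
  unfolding kernel_eq_y_fun by (intro dim_line y_fun_nonzero)

lemma alg_eigenspace_dim:
  "cvec.dim (alg_eigenspace (Hp \<alpha>) ((of_nat m)\<^sup>2)) = (if m = 0 then 1 else 2)"
proof (cases "\<alpha> = 0 \<or> m = 0")
  case True
  then show ?thesis unfolding alg_eigenspace_eq_kernel[OF True]
    using free_kernel_dim[of m] kernel_dim[of \<alpha> m] by (cases "\<alpha> = 0") auto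
next
  case False
  then have "cvec.dim {c *\<^sub>C L2_class (y_fun \<alpha> m) + d *\<^sub>C L2_class (ydot_fun \<alpha> m) | c d. True} = 2"
    by (intro dim_plane y_ydot_independent) auto
  then show ?thesis using False by (simp add: alg_eigenspace_eq_span_y_ydot)
qed

lemma alg_eigenspace_finite_dim: "\<exists>B. finite B \<and> alg_eigenspace (Hp \<alpha>) ((of_nat m)\<^sup>2) \<subseteq> cvec.span B"
proof -
  consider "\<alpha> = 0" | "\<alpha> \<noteq> 0" "m = 0" | "\<alpha> \<noteq> 0" "m \<ge> 1" by linarith
  then show ?thesis
  proof cases
    case 1
    then have "alg_eigenspace (Hp \<alpha>) ((of_nat m)\<^sup>2) = cvec.span {fourier_basis (int m), fourier_basis (- int m)}"
      by (simp only: alg_eigenspace_eq_kernel free_kernel span_pair simp_thms)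
    then show ?thesis by (metis finite.emptyI finite.insertI order_refl)
  next
    case 2
    then have "alg_eigenspace (Hp \<alpha>) ((of_nat m)\<^sup>2) = cvec.span {L2_class (y_fun \<alpha> m)}"
      by (simp only: alg_eigenspace_eq_kernel kernel_eq_y_fun span_single simp_thms)
    then show ?thesis by (metis finite.emptyI finite.insertI order_refl)
  next
    case 3
    then have "alg_eigenspace (Hp \<alpha>) ((of_nat m)\<^sup>2) = cvec.span {L2_class (y_fun \<alpha> m), L2_class (ydot_fun \<alpha> m)}"
      unfolding span_pair by (rule alg_eigenspace_eq_span_y_ydot)
    then show ?thesis by (metis finite.emptyI finite.insertI order_refl)
  qed
qed

theorem discrete_spectrum_Hp: "discrete_spectrum (Hp \<alpha>) = squares"
proof
  show "discrete_spectrum (Hp \<alpha>) \<subseteq> squares"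
    unfolding discrete_spectrum_def spectrum_Hp by (auto simp: isolated_in_def)
  show "squares \<subseteq> discrete_spectrum (Hp \<alpha>)"
  proof
    fix z assume "z \<in> squares"
    then obtain m :: nat where z: "z = (of_nat m)\<^sup>2" by (auto simp: squares_def)
    have "\<exists>u. eigenvector (Hp \<alpha>) z u" unfolding z by (rule Hp_eigenvector_exists)
    moreover have "z isolated_in spectrum (Hp \<alpha>)"
      unfolding isolated_in_def spectrum_Hp
    proof (intro conjI exI[of _ "ball z (1/2)"])
      show "z \<in> squares" by fact
      show "open (ball z (1/2))" by simp
      have "ball z (1/2) \<inter> squares \<subseteq> squares \<inter> cball ((of_nat m)\<^sup>2) (1/2)" unfolding z by auto
      then show "ball z (1/2) \<inter> squares = {z}"
        using \<open>z \<in> squares\<close> squares_isolated[of m] unfolding z[symmetric] by auto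
    qed
    ultimately show "z \<in> discrete_spectrum (Hp \<alpha>)"
      unfolding discrete_spectrum_def using alg_eigenspace_finite_dim[of \<alpha> m] z by blast
  qed
qed

section \<open>The Floquet discriminant\<close>

text \<open>The equation \<open>\<tau> y = z y\<close> in the form \<open>y'' = potential y\<close>.\<close>

definition potential :: "complex \<Rightarrow> complex \<Rightarrow> real \<Rightarrow> complex" where
  "potential \<alpha> z x = \<alpha>\<^sup>2 * exp (\<i> * complex_of_real x) - z"

lemma tau_solutionI:
  assumes 1: "\<And>x. (y has_vector_derivative y' x) (at x)"
    and 2: "\<And>x. (y' has_vector_derivative potential \<alpha> z x * y x) (at x)"
  shows "tau_solution \<alpha> z y" "derivative_on UNIV y x = y' x"
proof -
  have d: "derivative_on UNIV y = y'" by (rule ext) (rule vector_derivative_at[OF 1])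
  then show "derivative_on UNIV y x = y' x" by (rule fun_cong)
  have d2: "derivative_on UNIV y' x = potential \<alpha> z x * y x" for x
    by (rule vector_derivative_at[OF 2])
  show "tau_solution \<alpha> z y"
    unfolding tau_solution_def tau_def d d2
    using differentiableI_vector[OF 1] differentiableI_vector[OF 2]
    by (simp add: potential_def left_diff_distrib)
qed

lemma tau_solutionD:
  assumes "tau_solution \<alpha> z y"
  shows "(y has_vector_derivative derivative_on UNIV y x) (at x)"
    "(derivative_on UNIV y has_vector_derivative potential \<alpha> z x * y x) (at x)"
proof -
  show "(y has_vector_derivative derivative_on UNIV y x) (at x)"
    using assms by (simp add: tau_solution_def vector_derivative_works)
  have "- derivative_on UNIV (derivative_on UNIV y) x + \<alpha>\<^sup>2 * exp (\<i> * complex_of_real x) * y x = z * y x"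
    using assms by (simp add: tau_solution_def tau_def)
  then have "derivative_on UNIV (derivative_on UNIV y) x = potential \<alpha> z x * y x"
    by (simp add: potential_def algebra_simps)
  moreover have "(derivative_on UNIV y has_vector_derivative derivative_on UNIV (derivative_on UNIV y) x) (at x)"
    using assms by (simp add: tau_solution_def vector_derivative_works)
  ultimately show "(derivative_on UNIV y has_vector_derivative potential \<alpha> z x * y x) (at x)" by simp
qed

lemma tau_solution_combination:
  assumes u: "tau_solution \<alpha> z u" and v: "tau_solution \<alpha> z v"
  shows "tau_solution \<alpha> z (\<lambda>x. a * u x + b * v x)"
    "derivative_on UNIV (\<lambda>x. a * u x + b * v x) t = a * derivative_on UNIV u t + b * derivative_on UNIV v t"
proof -
  have 1: "((\<lambda>x. a * u x + b * v x) has_vector_derivative a * derivative_on UNIV u x + b * derivative_on UNIV v x) (at x)" for x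
    by (intro has_vector_derivative_add has_vector_derivative_mult_right tau_solutionD(1)[OF u] tau_solutionD(1)[OF v])
  have 2: "((\<lambda>x. a * derivative_on UNIV u x + b * derivative_on UNIV v x) has_vector_derivative
      potential \<alpha> z x * (a * u x + b * v x)) (at x)" for x
  proof -
    have "((\<lambda>x. a * derivative_on UNIV u x + b * derivative_on UNIV v x) has_vector_derivative
      a * (potential \<alpha> z x * u x) + b * (potential \<alpha> z x * v x)) (at x)"
      by (intro has_vector_derivative_add has_vector_derivative_mult_right tau_solutionD(2)[OF u] tau_solutionD(2)[OF v])
    then show ?thesis by (simp add: algebra_simps)
  qed
  show "tau_solution \<alpha> z (\<lambda>x. a * u x + b * v x)"
    "derivative_on UNIV (\<lambda>x. a * u x + b * v x) t = a * derivative_on UNIV u t + b * derivative_on UNIV v t"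
    by (rule tau_solutionI(1)[OF 1 2]) (rule tau_solutionI(2)[OF 1 2])
qed

lemma wronskian_constant:
  assumes u: "tau_solution \<alpha> z u" and v: "tau_solution \<alpha> z v"
  shows "u x * derivative_on UNIV v x - derivative_on UNIV u x * v x
    = u 0 * derivative_on UNIV v 0 - derivative_on UNIV u 0 * v 0"
proof -
  let ?W = "\<lambda>x. u x * derivative_on UNIV v x - derivative_on UNIV u x * v x"
  have "(?W has_vector_derivative 0) (at x within UNIV)" for x
  proof -
    have "(?W has_vector_derivative (u x * (potential \<alpha> z x * v x) + derivative_on UNIV u x * derivative_on UNIV v x)
       - (derivative_on UNIV u x * derivative_on UNIV v x + (potential \<alpha> z x * u x) * v x)) (at x)"
      by (intro has_vector_derivative_diff has_vector_derivative_mult tau_solutionD[OF u] tau_solutionD[OF v])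
    then show ?thesis by (simp add: algebra_simps)
  qed
  then obtain c where "\<And>x. ?W x = c"
    using has_vector_derivative_zero_constant[of UNIV ?W] by auto
  then show ?thesis by simp
qed

text \<open>Taylor coefficients of the solution of \<open>y'' = q y\<close> with \<open>y 0 = a\<close> and \<open>y' 0 = b\<close>.\<close>

fun ode_coeff :: "(nat \<Rightarrow> complex) \<Rightarrow> complex \<Rightarrow> complex \<Rightarrow> nat \<Rightarrow> complex" where
  "ode_coeff q a b 0 = a"
| "ode_coeff q a b (Suc 0) = b"
| "ode_coeff q a b (Suc (Suc n)) = (\<Sum>j\<le>n. q j * ode_coeff q a b (n - j)) / (of_nat (Suc n) * of_nat (Suc (Suc n)))"

text \<open>The coefficients of a power series solution of \<open>y'' = q y\<close> decay faster than any geometric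
  sequence: once the denominator \<open>(k + 1) (k + 2)\<close> exceeds \<open>C exp(1/r) / r\<^sup>2\<close>, the bound \<open>B r\<^sup>n\<close>
  reproduces itself.\<close>

lemma ode_coeff_bound:
  assumes q: "\<And>j. cmod (q j) \<le> C / fact j" and C: "C \<ge> 0" and r: "r > 0"
  obtains B where "\<And>n. cmod (ode_coeff q a b n) \<le> B * r ^ n"
proof -
  let ?f = "ode_coeff q a b"
  define M where "M = C * exp (1 / r)"
  obtain N :: nat where N: "real N \<ge> M / r\<^sup>2" using real_arch_simple by blast
  define B where "B = (\<Sum>k\<le>N + 1. cmod (?f k) / r ^ k)"
  have B0: "B \<ge> 0" unfolding B_def using r by (intro sum_nonneg) auto
  have "cmod (?f n) \<le> B * r ^ n" for n
  proof (induction n rule: less_induct)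
    case (less n)
    show ?case
    proof (cases "n \<le> N + 1")
      case True
      have "cmod (?f n) / r ^ n \<le> B" unfolding B_def using r True by (intro member_le_sum) auto
      then show ?thesis using r by (simp add: pos_divide_le_eq)
    next
      case False
      then obtain k where k: "n = Suc (Suc k)" "k \<ge> N"
        by (metis Suc_eq_plus1 Suc_leI not_less_eq_eq old.nat.exhaust le_0_eq Suc_le_mono zero_le)
      have "cmod (\<Sum>j\<le>k. q j * ?f (k - j)) \<le> (\<Sum>j\<le>k. B * r ^ k * C * ((1 / r) ^ j / fact j))"
      proof (rule sum_norm_le)
        fix j assume j: "j \<in> {..k}"
        have "cmod (q j * ?f (k - j)) \<le> C / fact j * (B * r ^ (k - j))"
          unfolding norm_mult using less[of "k - j"] k C by (intro mult_mono q) auto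
        also have "r ^ (k - j) = r ^ k * (1 / r) ^ j" using j r by (simp add: power_diff power_one_over)
        finally show "cmod (q j * ?f (k - j)) \<le> B * r ^ k * C * ((1 / r) ^ j / fact j)" by (simp add: mult_ac)
      qed
      also have "\<dots> = B * r ^ k * C * (\<Sum>j\<le>k. (1 / r) ^ j / fact j)" by (simp add: sum_distrib_left)
      also have "\<dots> \<le> B * r ^ k * C * exp (1 / r)"
      proof (intro mult_left_mono)
        have "(\<Sum>j\<le>k. (1 / r) ^ j / fact j) \<le> (\<Sum>j. (1 / r) ^ j / fact j)"
          using summable_exp_generic[of "1 / r"] r by (intro sum_le_suminf) (auto simp: divide_inverse_commute)
        also have "\<dots> = exp (1 / r)" by (simp add: exp_def divide_inverse_commute)
        finally show "(\<Sum>j\<le>k. (1 / r) ^ j / fact j) \<le> exp (1 / r)" .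
      qed (use B0 r C in auto)
      also have "\<dots> = B * r ^ k * M" by (simp add: M_def)
      finally have 1: "cmod (\<Sum>j\<le>k. q j * ?f (k - j)) \<le> B * r ^ k * M" .
      have "M \<le> real N * r\<^sup>2" using N r by (simp add: pos_divide_le_eq)
      also have "\<dots> \<le> (real (Suc k) * real (Suc (Suc k))) * r\<^sup>2"
      proof (intro mult_right_mono)
        have "real N * 1 \<le> real (Suc k) * real (Suc (Suc k))" using k by (intro mult_mono) auto
        then show "real N \<le> real (Suc k) * real (Suc (Suc k))" by simp
      qed auto
      finally have "B * r ^ k * M \<le> B * r ^ k * ((real (Suc k) * real (Suc (Suc k))) * r\<^sup>2)"
        using B0 r by (intro mult_left_mono) auto
      with 1 have "cmod (\<Sum>j\<le>k. q j * ?f (k - j)) \<le> (B * r ^ n) * (real (Suc k) * real (Suc (Suc k)))"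
        by (simp add: k power2_eq_square mult_ac del: of_nat_Suc)
      moreover have "0 < real (Suc k) * real (Suc (Suc k))" by simp
      ultimately show ?thesis
        unfolding k(1) ode_coeff.simps norm_divide norm_mult norm_of_nat by (simp only: pos_divide_le_eq)
    qed
  qed
  then show thesis by (rule that)
qed

lemma linear_ode_entire_solution:
  fixes Q :: "complex fps"
  assumes q: "\<And>j. cmod (Q $ j) \<le> C / fact j" and C: "C \<ge> 0"
  obtains F :: "complex fps" where "fps_conv_radius F = \<infinity>" "fps_deriv (fps_deriv F) = Q * F" "F $ 0 = a" "F $ 1 = b"
proof -
  define F where "F = Abs_fps (ode_coeff (fps_nth Q) a b)"
  have "fps_conv_radius F = \<infinity>"
    unfolding fps_conv_radius_def
  proof (rule conv_radius_inftyI'')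
    fix w :: complex
    \<comment> \<open>With this rate the terms of the series at \<open>w\<close> are at most \<open>B / 2\<^sup>n\<close>.\<close>
    define r where "r = 1 / (2 * (cmod w + 1))"
    have pos: "2 * (cmod w + 1) > 0" by (intro mult_pos_pos add_nonneg_pos) auto
    then have r: "r > 0" "r * cmod w \<le> 1 / 2"
      by (simp_all add: r_def pos_divide_le_eq)
    obtain B where B: "\<And>n. cmod (ode_coeff (fps_nth Q) a b n) \<le> B * r ^ n"
      by (rule ode_coeff_bound[OF q C r(1), where a = a and b = b]) blast
    have B0: "B \<ge> 0" using B[of 0] norm_ge_zero[of "ode_coeff (fps_nth Q) a b 0"] by (simp del: norm_ge_zero)
    show "summable (\<lambda>n. F $ n * w ^ n)"
    proof (rule summable_comparison_test')
      show "summable (\<lambda>n. B * (1 / 2) ^ n)" by (intro summable_mult summable_geometric) auto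
      fix n :: nat
      have "norm (F $ n * w ^ n) \<le> (B * r ^ n) * cmod w ^ n"
        unfolding norm_mult norm_power F_def using B by (intro mult_right_mono) auto
      also have "\<dots> = B * (r * cmod w) ^ n" by (simp add: power_mult_distrib)
      also have "\<dots> \<le> B * (1 / 2) ^ n" using r B0 by (intro mult_left_mono power_mono) auto
      finally show "norm (F $ n * w ^ n) \<le> B * (1 / 2) ^ n" .
    qed
  qed
  moreover have "fps_deriv (fps_deriv F) = Q * F"
  proof (rule fps_ext)
    fix n
    have nz: "of_nat (Suc n) \<noteq> (0::complex)" "of_nat (Suc (Suc n)) \<noteq> (0::complex)" by (simp_all del: of_nat_Suc)
    have "fps_deriv (fps_deriv F) $ n = of_nat (Suc n) * (of_nat (Suc (Suc n)) * ode_coeff (fps_nth Q) a b (Suc (Suc n)))"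
      by (simp add: F_def del: ode_coeff.simps of_nat_Suc)
    also have "\<dots> = (\<Sum>j\<le>n. Q $ j * ode_coeff (fps_nth Q) a b (n - j))"
      using nz by (simp del: of_nat_Suc)
    finally show "fps_deriv (fps_deriv F) $ n = (Q * F) $ n"
      by (simp add: fps_mult_nth F_def atLeast0AtMost)
  qed
  ultimately show thesis by (rule that) (simp_all add: F_def)
qed

lemma tau_solution_exists:
  obtains y where "tau_solution \<alpha> z y" "y 0 = a" "derivative_on UNIV y 0 = b"
proof -
  define Q where "Q = fps_const (\<alpha>\<^sup>2) * fps_exp \<i> - fps_const z"
  have Qb: "cmod (Q $ j) \<le> (cmod (\<alpha>\<^sup>2) + cmod z) / fact j" for j
  proof -
    have "Q $ j = (\<alpha>\<^sup>2 * \<i> ^ j - (if j = 0 then z else 0)) / fact j"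
      by (simp add: Q_def)
    also have "cmod \<dots> \<le> (cmod (\<alpha>\<^sup>2) + cmod z) / fact j"
      unfolding norm_divide using norm_triangle_ineq4[of "\<alpha>\<^sup>2 * \<i> ^ j" "if j = 0 then z else 0"]
      by (auto simp: norm_mult norm_power intro!: divide_right_mono split: if_splits)
    finally show ?thesis .
  qed
  obtain F :: "complex fps" where F: "fps_conv_radius F = \<infinity>" "fps_deriv (fps_deriv F) = Q * F" "F $ 0 = a" "F $ 1 = b"
    by (rule linear_ode_entire_solution[OF Qb add_nonneg_nonneg[OF norm_ge_zero norm_ge_zero]]) (rule that)
  have F': "fps_conv_radius (fps_deriv F) = \<infinity>" using fps_conv_radius_deriv[of F] F(1) by simp
  have QC: "fps_conv_radius Q = \<infinity>"
    using fps_conv_radius_diff[of "fps_const (\<alpha>\<^sup>2) * fps_exp \<i>" "fps_const z"]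
      fps_conv_radius_mult[of "fps_const (\<alpha>\<^sup>2)" "fps_exp \<i> :: complex fps"]
    by (simp add: Q_def)
  have Qe: "eval_fps Q (of_real x) = potential \<alpha> z x" for x
    using fps_conv_radius_mult[of "fps_const (\<alpha>\<^sup>2)" "fps_exp \<i> :: complex fps"]
    by (simp add: Q_def eval_fps_diff eval_fps_mult potential_def)
  define y where "y x = eval_fps F (of_real x)" for x :: real
  define y' where "y' x = eval_fps (fps_deriv F) (of_real x)" for x :: real
  have 1: "(y has_vector_derivative y' x) (at x)" for x
    unfolding y_def y'_def by (intro has_vector_derivative_real_field has_field_derivative_eval_fps) (simp add: F)
  have 2: "(y' has_vector_derivative potential \<alpha> z x * y x) (at x)" for x
  proof -
    have "(y' has_vector_derivative eval_fps (fps_deriv (fps_deriv F)) (of_real x)) (at x)"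
      unfolding y'_def by (intro has_vector_derivative_real_field has_field_derivative_eval_fps) (simp add: F')
    also have "eval_fps (fps_deriv (fps_deriv F)) (of_real x) = potential \<alpha> z x * y x"
      unfolding F(2) y_def using F(1) QC by (simp add: eval_fps_mult Qe)
    finally show ?thesis .
  qed
  have 0: "y 0 = a" "y' 0 = b" using F by (simp_all add: y_def y'_def eval_fps_at_0)
  show thesis by (rule that[OF tau_solutionI(1)[OF 1 2] 0(1)]) (simp only: tau_solutionI(2)[OF 1 2] 0)
qed

text \<open>The difference \<open>y\<close> has zero Wronskian with both solutions \<open>s\<close> and \<open>t\<close> of a fundamental system, and
  the Wronskian of \<open>s\<close> and \<open>t\<close> is \<open>1\<close>.\<close>

lemma tau_solution_unique:
  assumes u: "tau_solution \<alpha> z u" and v: "tau_solution \<alpha> z v"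
    and 0: "u 0 = v 0" "derivative_on UNIV u 0 = derivative_on UNIV v 0"
  shows "u = v"
proof
  fix x
  obtain s where s: "tau_solution \<alpha> z s" "s 0 = 1" "derivative_on UNIV s 0 = 0"
    by (rule tau_solution_exists[where \<alpha> = \<alpha> and z = z and a = 1 and b = 0]) blast
  obtain t where t: "tau_solution \<alpha> z t" "t 0 = 0" "derivative_on UNIV t 0 = 1"
    by (rule tau_solution_exists[where \<alpha> = \<alpha> and z = z and a = 0 and b = 1]) blast
  define y where "y = (\<lambda>x. 1 * u x + (- 1) * v x)"
  have y: "tau_solution \<alpha> z y" unfolding y_def by (rule tau_solution_combination(1)[OF u v])
  have y0: "y 0 = 0" "derivative_on UNIV y 0 = 0"
    unfolding y_def tau_solution_combination(2)[OF u v] using 0 by simp_all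
  let ?d = "derivative_on UNIV"
  have 1: "y x * ?d s x = ?d y x * s x" using wronskian_constant[OF y s(1), of x] y0 by simp
  have 2: "y x * ?d t x = ?d y x * t x" using wronskian_constant[OF y t(1), of x] y0 by simp
  have 3: "s x * ?d t x - ?d s x * t x = 1" using wronskian_constant[OF s(1) t(1), of x] s t by simp
  have "y x = y x * (s x * ?d t x - ?d s x * t x)" using 3 by simp
  also have "\<dots> = s x * (y x * ?d t x) - t x * (y x * ?d s x)" by (simp add: algebra_simps)
  also have "\<dots> = 0" unfolding 1 2 by (simp add: algebra_simps)
  finally show "u x = v x" by (simp add: y_def)
qed

lemma tau_solution_ex1: "\<exists>!y. tau_solution \<alpha> z y \<and> y 0 = a \<and> derivative_on UNIV y 0 = b"
proof -
  obtain y where y: "tau_solution \<alpha> z y" "y 0 = a" "derivative_on UNIV y 0 = b"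
    by (rule tau_solution_exists)
  show ?thesis
  proof (rule ex1I[of _ y])
    fix u assume u: "tau_solution \<alpha> z u \<and> u 0 = a \<and> derivative_on UNIV u 0 = b"
    show "u = y" by (rule tau_solution_unique[of \<alpha> z]) (simp_all only: u y)
  qed (simp add: y)
qed

lemma theta0_props: "tau_solution \<alpha> z (theta0 \<alpha> z)" "theta0 \<alpha> z 0 = 1" "derivative_on UNIV (theta0 \<alpha> z) 0 = 0"
  using theI'[OF tau_solution_ex1[of \<alpha> z 1 0], folded theta0_def] by auto

lemma phi0_props: "tau_solution \<alpha> z (phi0 \<alpha> z)" "phi0 \<alpha> z 0 = 0" "derivative_on UNIV (phi0 \<alpha> z) 0 = 1"
  using theI'[OF tau_solution_ex1[of \<alpha> z 0 1], folded phi0_def] by auto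

definition frobenius_coeff :: "complex \<Rightarrow> complex \<Rightarrow> nat \<Rightarrow> complex" where
  "frobenius_coeff \<alpha> \<nu> k = (- \<alpha>\<^sup>2) ^ k / (fact k * (\<Prod>j<k. (of_nat (Suc j) + 2 * \<nu>)))"

lemma frobenius_coeff_rec:
  assumes "Re \<nu> \<ge> 0"
  shows "((\<nu> + of_nat (Suc k))\<^sup>2 - \<nu>\<^sup>2) * frobenius_coeff \<alpha> \<nu> (Suc k) = - \<alpha>\<^sup>2 * frobenius_coeff \<alpha> \<nu> k"
proof -
  define s where "s = (of_nat (Suc k) :: complex)"
  define t where "t = s + 2 * \<nu>"
  define p where "p = (\<Prod>j<k. (of_nat (Suc j) + 2 * \<nu>))"
  have nz: "of_nat (Suc j) + 2 * \<nu> \<noteq> 0" for j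
  proof
    assume "of_nat (Suc j) + 2 * \<nu> = 0"
    then have "Re (of_nat (Suc j) + 2 * \<nu>) = 0" by simp
    then show False using assms by simp
  qed
  have ne: "s \<noteq> 0" "t \<noteq> 0" "p \<noteq> 0" using nz by (auto simp: s_def t_def p_def simp del: of_nat_Suc)
  have e1: "(\<nu> + s)\<^sup>2 - \<nu>\<^sup>2 = s * t" by (simp add: t_def power2_eq_square algebra_simps)
  have e2: "frobenius_coeff \<alpha> \<nu> (Suc k) = - \<alpha>\<^sup>2 * (- \<alpha>\<^sup>2) ^ k / (s * fact k * (p * t))"
    by (simp add: frobenius_coeff_def s_def t_def p_def del: of_nat_Suc)
  have e3: "frobenius_coeff \<alpha> \<nu> k = (- \<alpha>\<^sup>2) ^ k / (fact k * p)" by (simp add: frobenius_coeff_def p_def)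
  show ?thesis unfolding s_def[symmetric] e1 e2 e3 using ne by simp
qed

lemma frobenius_coeff_bound:
  assumes "Re \<nu> \<ge> 0"
  shows "cmod (frobenius_coeff \<alpha> \<nu> k) \<le> (cmod \<alpha>)\<^sup>2 ^ k / fact k"
proof -
  have "1 \<le> cmod (of_nat (Suc j) + 2 * \<nu>)" for j
    using assms complex_Re_le_cmod[of "of_nat (Suc j) + 2 * \<nu>"] by simp
  then have "1 \<le> cmod (\<Prod>j<k. (of_nat (Suc j) + 2 * \<nu>))"
    unfolding prod_norm[symmetric] by (intro prod_ge_1) auto
  then have "fact k * 1 \<le> fact k * cmod (\<Prod>j<k. (of_nat (Suc j) + 2 * \<nu>))" by (intro mult_left_mono) auto
  then have "((cmod \<alpha>)\<^sup>2) ^ k / (fact k * cmod (\<Prod>j<k. (of_nat (Suc j) + 2 * \<nu>))) \<le> ((cmod \<alpha>)\<^sup>2) ^ k / (fact k * 1)"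
    by (intro frac_le) auto
  then show ?thesis by (simp add: frobenius_coeff_def norm_divide norm_mult norm_power)
qed

text \<open>Frobenius series \<open>\<Sum>k. A k * exp (i (\<nu> + k) x)\<close>. Keeping the entire power series \<open>A\<close> separate from the
  nonperiodic factor turns differentiation into the operation \<open>twisted_deriv\<close> on power series.\<close>

definition twisted_series :: "complex \<Rightarrow> complex fps \<Rightarrow> real \<Rightarrow> complex" where
  "twisted_series \<nu> A x = exp (\<i> * \<nu> * of_real x) * eval_fps A (exp (\<i> * of_real x))"

definition twisted_deriv :: "complex \<Rightarrow> complex fps \<Rightarrow> complex fps" where
  "twisted_deriv \<nu> A = fps_const (\<i> * \<nu>) * A + fps_const \<i> * (fps_X * fps_deriv A)"

lemma twisted_deriv_nth: "twisted_deriv \<nu> A $ k = \<i> * (\<nu> + of_nat k) * A $ k"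
  by (cases k) (simp_all add: twisted_deriv_def algebra_simps)

lemma fps_conv_radius_infinity_mult:
  "fps_conv_radius A = \<infinity> \<Longrightarrow> fps_conv_radius B = \<infinity> \<Longrightarrow> fps_conv_radius (A * B :: complex fps) = \<infinity>"
  using fps_conv_radius_mult[of A B] by simp

lemma fps_conv_radius_infinity_add:
  "fps_conv_radius A = \<infinity> \<Longrightarrow> fps_conv_radius B = \<infinity> \<Longrightarrow> fps_conv_radius (A + B :: complex fps) = \<infinity>"
  using fps_conv_radius_add[of A B] by simp

lemma fps_conv_radius_infinity_deriv:
  "fps_conv_radius A = \<infinity> \<Longrightarrow> fps_conv_radius (fps_deriv A :: complex fps) = \<infinity>"
  using fps_conv_radius_deriv[of A] by simp

lemma twisted_deriv_entire: "fps_conv_radius A = \<infinity> \<Longrightarrow> fps_conv_radius (twisted_deriv \<nu> A) = \<infinity>"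
  unfolding twisted_deriv_def
  by (intro fps_conv_radius_infinity_add fps_conv_radius_infinity_mult fps_conv_radius_infinity_deriv) auto

lemma twisted_series_has_derivative:
  assumes A: "fps_conv_radius A = \<infinity>"
  shows "(twisted_series \<nu> A has_vector_derivative twisted_series \<nu> (twisted_deriv \<nu> A) x) (at x)"
proof -
  have A': "fps_conv_radius (fps_deriv A) = \<infinity>" "fps_conv_radius (fps_X * fps_deriv A) = \<infinity>"
    "fps_conv_radius (fps_const (\<i> * \<nu>) * A) = \<infinity>" "fps_conv_radius (fps_const \<i> * (fps_X * fps_deriv A)) = \<infinity>"
    using A by (auto intro!: fps_conv_radius_infinity_mult fps_conv_radius_infinity_deriv)
  have ev: "eval_fps (twisted_deriv \<nu> A) w = \<i> * \<nu> * eval_fps A w + \<i> * w * eval_fps (fps_deriv A) w" for w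
    using A A' by (simp add: twisted_deriv_def eval_fps_add eval_fps_mult mult.assoc)
  have "((\<lambda>w. exp (\<i> * \<nu> * w) * eval_fps A (exp (\<i> * w))) has_field_derivative
      (exp (\<i> * \<nu> * w) * (\<i> * \<nu>)) * eval_fps A (exp (\<i> * w)) + (eval_fps (fps_deriv A) (exp (\<i> * w)) * (exp (\<i> * w) * \<i>)) * exp (\<i> * \<nu> * w)) (at w)" for w
  proof -
    have "((\<lambda>w. eval_fps A (exp (\<i> * w))) has_field_derivative eval_fps (fps_deriv A) (exp (\<i> * w)) * (exp (\<i> * w) * \<i>)) (at w)"
      by (rule DERIV_chain2[OF has_field_derivative_eval_fps]) (auto simp: A intro!: derivative_eq_intros)
    moreover have "((\<lambda>w. exp (\<i> * \<nu> * w)) has_field_derivative exp (\<i> * \<nu> * w) * (\<i> * \<nu>)) (at w)"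
      by (auto intro!: derivative_eq_intros)
    ultimately show ?thesis using DERIV_mult by blast
  qed
  from has_vector_derivative_real_field[OF this[of "of_real x"]]
  show ?thesis unfolding twisted_series_def[abs_def] ev by (simp add: algebra_simps)
qed

text \<open>As \<open>Re \<nu> \<ge> 0\<close>, the factors \<open>k (k + 2\<nu>)\<close> in the recursion for the coefficients never vanish, so this
  solution exists without exceptional values of \<open>z\<close>. It is \<open>exp(i\<nu>x)\<close> times a function of period \<open>2\<pi>\<close>.\<close>

lemma frobenius_solution:
  assumes \<nu>: "Re \<nu> \<ge> 0" and z: "z = \<nu>\<^sup>2"
  obtains Y \<mu> where "tau_solution \<alpha> z Y" "\<mu> = exp (2 * pi * \<i> * \<nu>)"
    "Y (2 * pi) = \<mu> * Y 0" "derivative_on UNIV Y (2 * pi) = \<mu> * derivative_on UNIV Y 0"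
    "\<exists>x. Y x \<noteq> 0"
proof -
  define A where "A = Abs_fps (frobenius_coeff \<alpha> \<nu>)"
  have sumA: "summable (\<lambda>k. norm (A $ k * w ^ k))" for w
  proof (rule summable_comparison_test')
    show "summable (\<lambda>k. ((cmod \<alpha>)\<^sup>2 * cmod w) ^ k / fact k)"
      using summable_exp_generic[of "(cmod \<alpha>)\<^sup>2 * cmod w"] by (simp add: divide_inverse_commute)
    fix k :: nat
    have "cmod (A $ k * w ^ k) \<le> (cmod \<alpha>)\<^sup>2 ^ k / fact k * cmod w ^ k"
      unfolding norm_mult norm_power A_def using frobenius_coeff_bound[OF \<nu>] by (intro mult_right_mono) auto
    then show "norm (norm (A $ k * w ^ k)) \<le> ((cmod \<alpha>)\<^sup>2 * cmod w) ^ k / fact k"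
      by (simp add: power_mult_distrib)
  qed
  have A: "fps_conv_radius A = \<infinity>"
    unfolding fps_conv_radius_def by (rule conv_radius_inftyI'') (rule summable_norm_cancel[OF sumA])
  define Y where "Y = twisted_series \<nu> A"
  define Y' where "Y' = twisted_series \<nu> (twisted_deriv \<nu> A)"
  note LA = twisted_deriv_entire[OF A, of \<nu>]
  have 1: "(Y has_vector_derivative Y' x) (at x)" for x
    unfolding Y_def Y'_def by (rule twisted_series_has_derivative[OF A])
  have ii: "\<i> * s * (\<i> * s * t) = - (s\<^sup>2 * t)" for s t
  proof -
    have "\<i> * s * (\<i> * s * t) = (\<i> * \<i>) * (s * s * t)" by (simp only: mult_ac)
    then show ?thesis by (simp add: power2_eq_square)
  qed
  have fe: "twisted_deriv \<nu> (twisted_deriv \<nu> A) = fps_const (\<alpha>\<^sup>2) * (fps_X * A) - fps_const z * A"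
  proof (rule fps_ext)
    fix k
    show "twisted_deriv \<nu> (twisted_deriv \<nu> A) $ k = (fps_const (\<alpha>\<^sup>2) * (fps_X * A) - fps_const z * A) $ k"
    proof (cases k)
      case 0
      then show ?thesis by (simp add: twisted_deriv_nth z ii)
    next
      case (Suc j)
      have "(\<nu> + of_nat (Suc j))\<^sup>2 * frobenius_coeff \<alpha> \<nu> (Suc j) = \<nu>\<^sup>2 * frobenius_coeff \<alpha> \<nu> (Suc j) - \<alpha>\<^sup>2 * frobenius_coeff \<alpha> \<nu> j"
        using frobenius_coeff_rec[OF \<nu>, of j \<alpha>] by (simp only: left_diff_distrib) (simp add: diff_eq_eq del: of_nat_Suc)
      then show ?thesis
        unfolding Suc twisted_deriv_nth ii by (simp add: A_def z del: of_nat_Suc)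
    qed
  qed
  have 2: "(Y' has_vector_derivative potential \<alpha> z x * Y x) (at x)" for x
  proof -
    have "(Y' has_vector_derivative twisted_series \<nu> (twisted_deriv \<nu> (twisted_deriv \<nu> A)) x) (at x)"
      unfolding Y'_def by (rule twisted_series_has_derivative[OF LA])
    moreover have "twisted_series \<nu> (twisted_deriv \<nu> (twisted_deriv \<nu> A)) x = potential \<alpha> z x * Y x"
    proof -
      have e: "fps_conv_radius (fps_X * A) = \<infinity>" "fps_conv_radius (fps_const (\<alpha>\<^sup>2) * (fps_X * A)) = \<infinity>" "fps_conv_radius (fps_const z * A) = \<infinity>"
        using A by (auto intro!: fps_conv_radius_infinity_mult)
      have ev: "eval_fps (fps_const (\<alpha>\<^sup>2) * (fps_X * A) - fps_const z * A) w = \<alpha>\<^sup>2 * (w * eval_fps A w) - z * eval_fps A w" for w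
        using A e by (simp add: eval_fps_diff eval_fps_mult)
      show ?thesis
        unfolding fe Y_def twisted_series_def potential_def ev by (simp add: algebra_simps)
    qed
    ultimately show ?thesis by simp
  qed
  have per: "twisted_series \<nu> B (2 * pi) = exp (2 * pi * \<i> * \<nu>) * twisted_series \<nu> B 0" for B
  proof -
    have "exp (\<i> * complex_of_real (2 * pi)) = 1" using expi_2pi[of 1] by (simp add: expi_def)
    then show ?thesis by (simp add: twisted_series_def mult_ac)
  qed
  have "\<exists>x. Y x \<noteq> 0"
  proof (rule ccontr)
    assume "\<not> (\<exists>x. Y x \<noteq> 0)"
    then have "eval_fps A (exp (\<i> * complex_of_real x)) = 0" for x by (auto simp: Y_def twisted_series_def)
    moreover have "eval_fps A (exp (\<i> * complex_of_real x)) = (\<Sum>k. A $ k * expi (0 + int k) x)" for x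
      unfolding eval_fps_def by (intro suminf_cong) (simp add: expi_def exp_of_nat_mult[symmetric] mult_ac)
    ultimately have "(\<lambda>x. \<Sum>k. A $ k * expi (0 + int k) x) = (\<lambda>_. 0)" by simp
    then have "fc 0 (L2_class (\<lambda>x. \<Sum>k. A $ k * expi (0 + int k) x)) = 0" by (simp add: L2_class_zero)
    moreover have "fc 0 (L2_class (\<lambda>x. \<Sum>k. A $ k * expi (0 + int k) x)) = A $ 0"
      using sumA[of 1] by (subst trig_series_L2(2)) auto
    ultimately show False by (simp add: A_def frobenius_coeff_def)
  qed
  moreover have "derivative_on UNIV Y (2 * pi) = exp (2 * pi * \<i> * \<nu>) * derivative_on UNIV Y 0"
    unfolding tau_solutionI(2)[OF 1 2] unfolding Y'_def by (rule per)
  ultimately show thesis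
    by (intro that[OF tau_solutionI(1)[OF 1 2] refl]) (simp_all only: Y_def per)
qed

text \<open>The monodromy matrix has determinant \<open>1\<close>, being a Wronskian, and it has the eigenvalue
  \<open>\<mu> = exp(2\<pi>i\<nu>)\<close> with \<open>\<nu>\<close> the square root of \<open>z\<close>, because of the Frobenius solution. So its trace is \<open>\<mu> + 1/\<mu>\<close>, also
  in the cases where the two eigenvalues coincide and the second solution is not of Floquet form.\<close>

theorem floquet_discriminant_eq_cos:
  "floquet_discriminant \<alpha> z = cos (2 * complex_of_real pi * csqrt z)"
proof -
  define \<nu> where "\<nu> = csqrt z"
  have \<nu>: "Re \<nu> \<ge> 0" "z = \<nu>\<^sup>2" using csqrt_principal[of z] by (auto simp: \<nu>_def)
  obtain Y \<mu> where Y: "tau_solution \<alpha> z Y" and \<mu>: "\<mu> = exp (2 * pi * \<i> * \<nu>)"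
    and Y2: "Y (2 * pi) = \<mu> * Y 0" "derivative_on UNIV Y (2 * pi) = \<mu> * derivative_on UNIV Y 0"
    and Ynz: "\<exists>x. Y x \<noteq> 0"
    by (rule frobenius_solution[OF \<nu>, where \<alpha> = \<alpha>]) blast
  let ?d = "derivative_on UNIV"
  let ?t = "theta0 \<alpha> z" and ?p = "phi0 \<alpha> z"
  note t = theta0_props[of \<alpha> z] and p = phi0_props[of \<alpha> z]
  define a b where "a = Y 0" and "b = ?d Y 0"
  have comb: "Y = (\<lambda>x. a * ?t x + b * ?p x)"
    by (rule tau_solution_unique[OF Y tau_solution_combination(1)[OF t(1) p(1)]])
       (simp_all add: tau_solution_combination(2)[OF t(1) p(1)] t p a_def b_def)
  have dcomb: "?d Y x = a * ?d ?t x + b * ?d ?p x" for x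
    unfolding comb by (rule tau_solution_combination(2)[OF t(1) p(1)])
  have ab: "a \<noteq> 0 \<or> b \<noteq> 0" using Ynz unfolding comb by auto
  define A B C D where "A = ?t (2*pi)" and "B = ?p (2*pi)" and "C = ?d ?t (2*pi)" and "D = ?d ?p (2*pi)"
  have e1: "(A - \<mu>) * a + B * b = 0"
    using Y2(1) fun_cong[OF comb, of "2*pi"] by (simp add: a_def[symmetric] A_def B_def algebra_simps)
  have e2: "C * a + (D - \<mu>) * b = 0"
    using Y2(2) dcomb[of "2*pi"] by (simp add: b_def[symmetric] C_def D_def algebra_simps)
  have det: "A * D - C * B = 1"
    using wronskian_constant[OF t(1) p(1), of "2*pi"] t p by (simp add: A_def B_def C_def D_def)
  \<comment> \<open>The characteristic polynomial of the monodromy matrix at \<open>\<mu>\<close>; it vanishes because the initial data \<open>(a, b)\<close> of the Frobenius solution are an eigenvector.\<close>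
  define E where "E = (A - \<mu>) * (D - \<mu>) - B * C"
  have "E * a = (D - \<mu>) * ((A - \<mu>) * a + B * b) - B * (C * a + (D - \<mu>) * b)" by (simp add: E_def algebra_simps)
  then have Ea: "E * a = 0" unfolding e1 e2 by simp
  have "E * b = (A - \<mu>) * (C * a + (D - \<mu>) * b) - C * ((A - \<mu>) * a + B * b)" by (simp add: E_def algebra_simps)
  then have Eb: "E * b = 0" unfolding e1 e2 by simp
  have "E = 0" using Ea Eb ab by auto
  moreover have "E = (A * D - C * B) - \<mu> * (A + D) + \<mu> * \<mu>" by (simp add: E_def algebra_simps)
  ultimately have "\<mu> * (A + D) = 1 + \<mu> * \<mu>" unfolding det by (simp add: algebra_simps)
  moreover have "\<mu> \<noteq> 0" by (simp add: \<mu>)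
  ultimately have "A + D = (1 + \<mu> * \<mu>) / \<mu>" by (simp add: eq_divide_eq mult.commute)
  then have "A + D = \<mu> + inverse \<mu>" using \<open>\<mu> \<noteq> 0\<close> by (simp add: field_simps)
  then have "floquet_discriminant \<alpha> z = (\<mu> + inverse \<mu>) / 2"
    by (simp add: floquet_discriminant_def A_def D_def)
  also have "\<dots> = cos (2 * complex_of_real pi * \<nu>)"
    unfolding cos_exp_eq \<mu> by (simp add: exp_minus[symmetric] mult_ac)
  finally show ?thesis by (simp add: \<nu>_def)
qed

lemma cos_two_pi_csqrt_eq_1_iff: "cos (2 * complex_of_real pi * csqrt z) = 1 \<longleftrightarrow> z \<in> squares"
proof
  assume "cos (2 * complex_of_real pi * csqrt z) = 1"
  then obtain n :: int where "2 * complex_of_real pi * csqrt z = complex_of_real (2 * real_of_int n * pi)"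
    unfolding cos_eq_1 by blast
  then have "csqrt z = of_int n" by simp
  then have "z = (of_int n)\<^sup>2" by (metis power2_csqrt)
  then show "z \<in> squares" using int_square_in_squares by simp
next
  assume "z \<in> squares"
  then obtain m :: nat where m: "z = (of_nat m)\<^sup>2" by (auto simp: squares_def)
  have "csqrt z = of_nat m" unfolding m by (rule csqrt_square) auto
  then have "2 * complex_of_real pi * csqrt z = complex_of_real (2 * of_int (int m) * pi)" by simp
  then show "cos (2 * complex_of_real pi * csqrt z) = 1" unfolding cos_eq_1 by blast
qed

section \<open>The spectral theorem for the periodic operator\<close>

lemma floquet_level_set: "{z. floquet_discriminant \<alpha> z = 1} = squares"
  by (simp add: floquet_discriminant_eq_cos cos_two_pi_csqrt_eq_1_iff)

lemma squares_eq: "squares = {(of_nat m)\<^sup>2 | m :: nat. True}"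
  by (auto simp: squares_def)

lemma op_minus_imp_Domain: "(u, v) \<in> op_minus A l \<Longrightarrow> u \<in> Domain A"
  by (auto simp: op_minus_def)

theorem proposition2p2:
  fixes \<alpha> :: complex
  shows
    "(spectrum (Hp \<alpha>) = discrete_spectrum (Hp \<alpha>)
      \<and> spectrum (Hp \<alpha>) = {z. floquet_discriminant \<alpha> z = 1}
      \<and> {z. floquet_discriminant \<alpha> z = 1} = {(of_nat m)\<^sup>2 | m :: nat. True}
      \<and> (\<forall>z. floquet_discriminant \<alpha> z = cos (2 * complex_of_real pi * csqrt z)))
     \<and>
     (\<alpha> \<noteq> 0 \<longrightarrow>
      (\<forall>m :: nat.
        L2_class (y_fun \<alpha> m) \<in> Domain (Hp \<alpha>)
        \<and> eigenvector (Hp \<alpha>) ((of_nat m)\<^sup>2) (L2_class (y_fun \<alpha> m))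
        \<and> op_ker (op_minus (Hp \<alpha>) ((of_nat m)\<^sup>2)) = {c *\<^sub>C L2_class (y_fun \<alpha> m) | c. True}
        \<and> cvec.dim (op_ker (op_minus (Hp \<alpha>) ((of_nat m)\<^sup>2))) = 1))
     \<and>
     (\<alpha> = 0 \<longrightarrow>
      (\<forall>m :: nat.
        op_ker (op_minus (Hp 0) ((of_nat m)\<^sup>2)) =
          {L2_class (\<lambda>x. c * exp (\<i> * of_nat m * complex_of_real x)
                       + d * exp (- \<i> * of_nat m * complex_of_real x)) | c d. True}
        \<and> cvec.dim (op_ker (op_minus (Hp 0) ((of_nat m)\<^sup>2))) = (if m = 0 then 1 else 2)))
     \<and>
     (\<alpha> \<noteq> 0 \<longrightarrow>
      (\<forall>m :: nat. m \<ge> 1 \<longrightarrow>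
        L2_class (ydot_fun \<alpha> m) \<in> Domain (op_minus (Hp \<alpha>) ((of_nat m)\<^sup>2) ^^ 2)
        \<and> (L2_class (ydot_fun \<alpha> m), L2_class (y_fun \<alpha> m)) \<in> op_minus (Hp \<alpha>) ((of_nat m)\<^sup>2)
        \<and> (L2_class (ydot_fun \<alpha> m), 0) \<in> op_minus (Hp \<alpha>) ((of_nat m)\<^sup>2) ^^ 2
        \<and> cvec.dim (alg_eigenspace (Hp \<alpha>) ((of_nat m)\<^sup>2)) = 2
        \<and> alg_eigenspace (Hp \<alpha>) ((of_nat m)\<^sup>2) =
            {c *\<^sub>C L2_class (y_fun \<alpha> m) + d *\<^sub>C L2_class (ydot_fun \<alpha> m) | c d. True}
        \<and> jordan_chain (Hp \<alpha>) ((of_nat m)\<^sup>2) [L2_class (y_fun \<alpha> m), L2_class (ydot_fun \<alpha> m)]))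
     \<and>
     (geometric_mult (Hp \<alpha>) 0 = 1 \<and> algebraic_mult (Hp \<alpha>) 0 = 1
      \<and> (\<forall>m :: nat. m \<ge> 1 \<longrightarrow>
           (\<alpha> \<noteq> 0 \<longrightarrow> geometric_mult (Hp \<alpha>) ((of_nat m)\<^sup>2) = 1)
           \<and> geometric_mult (Hp 0) ((of_nat m)\<^sup>2) = 2
           \<and> algebraic_mult (Hp \<alpha>) ((of_nat m)\<^sup>2) = 2))"
proof (intro conjI allI impI)
  let ?A = "\<lambda>m::nat. op_minus (Hp \<alpha>) ((of_nat m)\<^sup>2)"
  let ?Y = "\<lambda>m. L2_class (y_fun \<alpha> m)" and ?Z = "\<lambda>m. L2_class (ydot_fun \<alpha> m)"
  show "spectrum (Hp \<alpha>) = discrete_spectrum (Hp \<alpha>)"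
    by (simp only: spectrum_Hp discrete_spectrum_Hp)
  show "spectrum (Hp \<alpha>) = {z. floquet_discriminant \<alpha> z = 1}"
    by (simp only: spectrum_Hp floquet_level_set)
  show "{z. floquet_discriminant \<alpha> z = 1} = {(of_nat m)\<^sup>2 | m :: nat. True}"
    by (simp only: floquet_level_set squares_eq)
  show "floquet_discriminant \<alpha> z = cos (2 * complex_of_real pi * csqrt z)" for z
    by (rule floquet_discriminant_eq_cos)
  show "op_ker (op_minus (Hp 0) ((of_nat m)\<^sup>2)) =
      {L2_class (\<lambda>x. c * exp (\<i> * of_nat m * complex_of_real x) + d * exp (- \<i> * of_nat m * complex_of_real x)) | c d. True}" for m
    by (rule free_kernel_functions)
  show "cvec.dim (op_ker (op_minus (Hp 0) ((of_nat m)\<^sup>2))) = (if m = 0 then 1 else 2)" for m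
    by (rule free_kernel_dim)
  show "geometric_mult (Hp 0) ((of_nat m)\<^sup>2) = 2" if "m \<ge> 1" for m
    using that by (simp add: geometric_mult_def free_kernel_dim)
  show "algebraic_mult (Hp \<alpha>) ((of_nat m)\<^sup>2) = 2" if "m \<ge> 1" for m
    using that by (simp add: algebraic_mult_def alg_eigenspace_dim)
  show "algebraic_mult (Hp \<alpha>) 0 = 1"
    using alg_eigenspace_dim[of \<alpha> 0] by (simp add: algebraic_mult_def)
  show "geometric_mult (Hp \<alpha>) 0 = 1"
    using free_kernel_dim[of 0] kernel_dim[of \<alpha> 0] by (cases "\<alpha> = 0") (simp_all add: geometric_mult_def)
  assume \<alpha>: "\<alpha> \<noteq> 0"
  show "?Y m \<in> Domain (Hp \<alpha>)" for m
    by (rule op_minus_imp_Domain[OF y_fun_in_kernel])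
  show "eigenvector (Hp \<alpha>) ((of_nat m)\<^sup>2) (?Y m)" for m
    using y_fun_in_kernel y_fun_nonzero[OF \<alpha>] by (simp add: eigenvector_def op_ker_def)
  show "op_ker (?A m) = {c *\<^sub>C ?Y m | c. True}" for m
    by (rule kernel_eq_y_fun[OF \<alpha>])
  show "cvec.dim (op_ker (?A m)) = 1" for m
    by (rule kernel_dim[OF \<alpha>])
  show "geometric_mult (Hp \<alpha>) ((of_nat m)\<^sup>2) = 1" for m
    unfolding geometric_mult_def by (rule kernel_dim[OF \<alpha>])
  fix m :: nat assume m: "m \<ge> 1"
  note Z = ydot_fun_generalized[OF \<alpha> m]
  show "(?Z m, ?Y m) \<in> ?A m" by (rule Z)
  have "?A m ^^ 2 = ?A m O ?A m" by (simp add: numeral_2_eq_2)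
  then show sq: "(?Z m, 0) \<in> ?A m ^^ 2"
    using Z y_fun_in_kernel[of \<alpha> m] by blast
  then show "?Z m \<in> Domain (?A m ^^ 2)" by (rule DomainI)
  show "cvec.dim (alg_eigenspace (Hp \<alpha>) ((of_nat m)\<^sup>2)) = 2"
    using m by (simp add: alg_eigenspace_dim)
  show "alg_eigenspace (Hp \<alpha>) ((of_nat m)\<^sup>2) = {c *\<^sub>C ?Y m + d *\<^sub>C ?Z m | c d. True}"
    by (rule alg_eigenspace_eq_span_y_ydot[OF \<alpha> m])
  have "(([?Y m, ?Z m]) ! j, [?Y m, ?Z m] ! (j - 1)) \<in> ?A m" if "1 \<le> j \<and> j < length [?Y m, ?Z m]" for j
  proof -
    have "j = 1" using that by simp
    then show ?thesis using Z by simp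
  qed
  then show "jordan_chain (Hp \<alpha>) ((of_nat m)\<^sup>2) [?Y m, ?Z m]"
    unfolding jordan_chain_def using y_fun_in_kernel y_fun_nonzero[OF \<alpha>] by simp
qed

end
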